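(* Let $\mathcal{P}=\mathcal{T}(V)/(R)$ be an operad defined by an $\mathbb{S}$-module $V=\bigoplus_{n\ge1}V(n)$ with basis $\mathcal{V}=\coprod_{n\ge1}\mathcal{V}(n)$ and relations $R$, and let $\mathcal{C}=(C_n)_{n\ge1}$ be an $\mathbb{S}$-invariant configuration. Let $A$ be a $\mathcal{P}$-algebra, let $(U,\{l_I^\omega\mid\omega\in\mathcal{V},I\in C_{|\omega|}\})$ be an $A$-$\mathcal{C}$-module, and let $\alpha:U\to A$ be a relative $\mathcal{C}$-Rota-Baxter operator of weight one on $U$. For $\omega\in\mathcal{V}$, $I\in C_{|\omega|}$ and $\vec u=(u_1,\dots,u_{|\omega|})\in U^{|\omega|}$ define $$\binom{\omega}{e_I}(\vec u):=l_I^\omega\big(\alpha(\vec u)_I\big)({}_I\vec u).$$ Then $\big(U,\{\binom{\omega}{e_I}\mid\omega\in\mathcal{V},I\in C_{|\omega|}\}\big)$ is a $\mathcal{C}\mathrm{Sp}(\mathcal{P})$-algebra. Moreover, when the splitting is the arity-splitting ($\mathcal{C}=\mathcal{A}$) or the power-splitting ($\mathcal{C}=\mathcal{B}$), there is a $\mathcal{P}$-algebra structure on $U$ given by $$\binom{\omega}{\star}=\sum_{I\in C_{|\omega|}}\binom{\omega}{e_I},\qquad\omega\in\mathcal{V},$$ and $\alpha$ is a homomorphism of $\mathcal{P}$-algebras.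
   Context: $\mathbf{k}$ is the base field, $[n]=\{1,\dots,n\}$, and $|\omega|$ is the arity of $\omega$. Trees. Consider planar rooted reduced trees (every vertex has at least one input), including the trivial tree $|$ with one leaf and no vertex. A labeled tree over a graded set $\Omega=\coprod_n\Omega_n$ has each vertex with $\ell$ inputs decorated by an element of $\Omega_\ell$ and the leaves decorated by distinct positive integers; $\mathrm{Lin}(\tau)$ is the set of leaf labels; inputs of a vertex are numbered $1,\dots,\ell$ from left to right. A nontrivial $\tau$ is uniquely a grafting $\tau=\omega(\tau_1\vee\cdots\vee\tau_\ell)$. For $\emptyset\ne J\subseteq\mathrm{Lin}(\tau)$ and a vertex $\omega$ whose subtree is $\omega(\sigma_1\vee\cdots\vee\sigma_\ell)$, put $J\sqcap\omega=\{i\in[\ell]:J\cap\mathrm{Lin}(\sigma_i)\ne\emptyset\}$. Configurations. $B_n$ is the set of nonempty subsets of $[n]$, $A_n$ the set of one-element subsets. A configuration is a sequence $\mathcal{C}=(C_n)_{n\ge1}$, $C_n\subseteq B_n$, such that for every labeled tree $\tau$ with $n$ leaves, every $J\in C_n$ (viewed as a set of leaves by numbering the leaves left to right) and every vertex $\omega$ with $\ell$ inputs, $J\sqcap\omega\in C_\ell$ whenever $J\sqcap\omega\ne\emptyset$. It is $\mathbb{S}$-invariant if each $C_n$ is stable under $\mathbb{S}_n$. $\mathcal{A}=(A_n)$, $\mathcal{B}=(B_n)$. Splitting. $\mathcal{V}(n)$ is assumed invariant under $\mathbb{S}_n$. $\mathcal{C}\mathrm{Sp}(V)(n)=V(n)\otimes\bigoplus_{I\in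 C_n}\mathbf{k}e_I$, $\binom{\omega}{e_I}=\omega\otimes e_I$, $\binom{\omega}{*}=\sum_{I\in C_n}\binom{\omega}{e_I}$, action $\binom{\omega}{e_I}^\sigma=\binom{\omega^\sigma}{e_{\sigma(I)}}$. For a labeled tree $\tau$ over $\mathcal{V}$, $\mathcal{C}\mathrm{Sp}(\tau)=\mathcal{C}\mathrm{Sp}_\emptyset(\tau)$ replaces every vertex $\omega$ by $\binom{\omega}{*}$; for $J\in C_{|\mathrm{Lin}(\tau)|}$, $\mathcal{C}\mathrm{Sp}_J(|)=|$ and for $\tau=\omega(\tau_1\vee\cdots\vee\tau_\ell)$, $\mathcal{C}\mathrm{Sp}_J(\tau)=\binom{\omega}{e_{J\sqcap\omega}}(\mathcal{C}\mathrm{Sp}_{J\cap\mathrm{Lin}(\tau_1)}(\tau_1)\vee\cdots\vee\mathcal{C}\mathrm{Sp}_{J\cap\mathrm{Lin}(\tau_\ell)}(\tau_\ell))$. The free operad is $\mathcal{T}(V)\cong\bigoplus_{t\in\mathfrak{R}}t[V]$, $\mathfrak{R}$ a set of planar representatives of isomorphism classes of reduced leaf-labeled trees. $R$ consists of locally homogeneous elements $r_s=\sum_ic_{s,i}\tau_{s,i}$, $1\le s\le k$ ($\mathrm{Lin}(\tau_{s,i})=:\mathrm{Lin}(r_s)$ independent of $i$). $\mathcal{C}\mathrm{Sp}(\mathcal{P})=\mathcal{T}(\mathcal{C}\mathrm{Sp}(V))/(\sum_ic_{s,i}\mathcal{C}\mathrm{Sp}_J(\tau_{s,i}):\ s,\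 J\in C_{|\mathrm{Lin}(r_s)|})$. Modules and relative Rota-Baxter operators. For $\vec x=(x_1,\dots,x_n)$ and $I=\{i_1<\cdots<i_t\}\subseteq[n]$, $\vec x_I$ is the tuple obtained from $\vec x$ by deleting the entries in positions $I$, ${}_I\vec x=(x_{i_1},\dots,x_{i_t})$, and $\alpha(\vec x)=(\alpha(x_1),\dots,\alpha(x_n))$. A $\mathcal{C}$-module for a $\mathcal{P}$-algebra $A$ (an $A$-$\mathcal{C}$-module) is a $\mathbf{k}$-module $U$ with linear maps $l_I^\omega:A^{\otimes(|\omega|-|I|)}\otimes U^{\otimes|I|}\to U$, $\omega\in\mathcal{V}$, $I\in C_{|\omega|}$, such that $A\oplus U$ is a $\mathcal{P}$-algebra with operations $\widetilde\omega((x_1,u_1),\dots,(x_{|\omega|},u_{|\omega|}))=\big(\omega(\vec x),\sum_{I\in C_{|\omega|}}l_I^\omega(\vec x_I)({}_I\vec u)\big)$, $\omega\in\mathcal{V}$. A linear map $\alpha:U\to A$ is a relative $\mathcal{C}$-Rota-Baxter operator of weight one if $\omega(\alpha(\vec u))=\sum_{I\in C_{|\omega|}}\alpha\big(l_I^\omega(\alpha(\vec u)_I)({}_I\vec u)\big)$ for all $\omega\in\mathcal{V}$, $\vec u\in U^{|\omega|}$. *)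

theory Defs
  imports
    "HOL-Analysis.Product_Vector"
    "HOL-Combinatorics.Permutations"
    "HOL-Library.FuncSet"
    "HOL-Library.Poly_Mapping"
begin

section \<open>Planar rooted trees\<close>

datatype 'o tree = Leaf nat | Node 'o "'o tree list"

fun leaves :: "'o tree \<Rightarrow> nat list" where
  "leaves (Leaf j) = [j]"
| "leaves (Node w ts) = concat (map leaves ts)"

abbreviation Lin :: "'o tree \<Rightarrow> nat set" where
  "Lin t \<equiv> set (leaves t)"

fun reduced :: "'o tree \<Rightarrow> bool" where
  "reduced (Leaf j) \<longleftrightarrow> True"
| "reduced (Node w ts) \<longleftrightarrow> ts \<noteq> [] \<and> (\<forall>t\<in>set ts. reduced t)"

definition labeled_tree :: "'o tree \<Rightarrow> bool" where
  "labeled_tree t \<longleftrightarrow> reduced t \<and> distinct (leaves t) \<and> 0 \<notin> Lin t"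

fun subtrees :: "'o tree \<Rightarrow> 'o tree set" where
  "subtrees (Leaf j) = {Leaf j}"
| "subtrees (Node w ts) = insert (Node w ts) (\<Union>t\<in>set ts. subtrees t)"

fun graft :: "(nat \<Rightarrow> 'o tree) \<Rightarrow> 'o tree \<Rightarrow> 'o tree" where
  "graft f (Leaf j) = f j"
| "graft f (Node w ts) = Node w (map (graft f) ts)"

abbreviation relabel :: "(nat \<Rightarrow> nat) \<Rightarrow> 'o tree \<Rightarrow> 'o tree" where
  "relabel f \<equiv> graft (\<lambda>j. Leaf (f j))"

text \<open>The set \<open>J \<sqinter> \<omega>\<close> for a vertex with the list \<open>ts\<close> of subtrees on its inputs; inputs are
  numbered from 1, list positions from 0.\<close>

definition hit_inputs :: "nat set \<Rightarrow> 'o tree list \<Rightarrow> nat set" where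
  "hit_inputs J ts = {i \<in> {1..length ts}. J \<inter> Lin (ts ! (i - 1)) \<noteq> {}}"


section \<open>Configurations\<close>

definition power_config :: "nat \<Rightarrow> nat set set" where
  "power_config n = {I. I \<subseteq> {1..n} \<and> I \<noteq> {}}"

definition arity_config :: "nat \<Rightarrow> nat set set" where
  "arity_config n = {{i} | i. i \<in> {1..n}}"

text \<open>Vertex decorations play no role here, so trees decorated by \<open>unit\<close> (with every positive
  number of inputs allowed at every vertex) are all planar reduced trees. The set \<open>J\<close> consists of
  left-to-right positions of leaves and is turned into a set of labels. For \<open>n = 0\<close> the first
  clause forces \<open>C 0 = {}\<close>.\<close>

definition configuration :: "(nat \<Rightarrow> nat set set) \<Rightarrow> bool" where
  "configuration C \<longleftrightarrow>
     (\<forall>n. C n \<subseteq> power_config n) \<and>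
     (\<forall>\<tau> :: unit tree. labeled_tree \<tau> \<longrightarrow>
       (\<forall>J \<in> C (length (leaves \<tau>)). \<forall>w ts. Node w ts \<in> subtrees \<tau> \<longrightarrow>
         (let I = hit_inputs ((\<lambda>j. leaves \<tau> ! (j - 1)) ` J) ts
          in I \<noteq> {} \<longrightarrow> I \<in> C (length ts))))"

definition symmetric_config :: "(nat \<Rightarrow> nat set set) \<Rightarrow> bool" where
  "symmetric_config C \<longleftrightarrow> (\<forall>n \<sigma>. \<sigma> permutes {1..n} \<longrightarrow> (\<forall>I \<in> C n. \<sigma> ` I \<in> C n))"


section \<open>Symmetric operads over a field\<close>

text \<open>Operads are given by partial compositions: \<open>ocomp P m n i p q\<close> is \<open>p \<circ>\<^sub>i q\<close>
  for \<open>p\<close> of arity \<open>m\<close>, \<open>q\<close> of arity \<open>n\<close> and \<open>i \<in> {1..m}\<close>.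

  Convention for the symmetric groups: \<open>p\<^sup>\<sigma>\<close> is the operation
  \<open>(x\<^sub>1, \<dots>, x\<^sub>n) \<mapsto> p (x\<^bsub>\<sigma>(1)\<^esub>, \<dots>, x\<^bsub>\<sigma>(n)\<^esub>)\<close>, which is the convention under which
  the \<open>i\<close>-th input of \<open>p\<close> is the \<open>\<sigma>(i)\<close>-th input of \<open>p\<^sup>\<sigma>\<close>, as required by the
  formula \<open>(\<omega> \<otimes> e\<^sub>I)\<^sup>\<sigma> = \<omega>\<^sup>\<sigma> \<otimes> e\<^bsub>\<sigma>(I)\<^esub>\<close>. Hence \<open>(p\<^sup>\<sigma>)\<^sup>\<tau> = p\<^bsup>\<tau> \<circ> \<sigma>\<^esup>\<close>; this is a right
  action when permutations are multiplied from left to right.\<close>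

record ('k, 'p) operad =
  ospace :: "nat \<Rightarrow> 'p set"
  oadd :: "nat \<Rightarrow> 'p \<Rightarrow> 'p \<Rightarrow> 'p"
  ozero :: "nat \<Rightarrow> 'p"
  oscale :: "nat \<Rightarrow> 'k \<Rightarrow> 'p \<Rightarrow> 'p"
  oact :: "nat \<Rightarrow> (nat \<Rightarrow> nat) \<Rightarrow> 'p \<Rightarrow> 'p"
  ounit :: 'p
  ocomp :: "nat \<Rightarrow> nat \<Rightarrow> nat \<Rightarrow> 'p \<Rightarrow> 'p \<Rightarrow> 'p"

definition operad_morphism ::
  "('k, 'p) operad \<Rightarrow> ('k, 'q) operad \<Rightarrow> (nat \<Rightarrow> 'p \<Rightarrow> 'q) \<Rightarrow> bool" where
  "operad_morphism P Q \<phi> \<longleftrightarrow>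
     (\<forall>n. \<forall>p \<in> ospace P n. \<phi> n p \<in> ospace Q n) \<and>
     (\<forall>n. \<forall>p \<in> ospace P n. \<forall>q \<in> ospace P n.
        \<phi> n (oadd P n p q) = oadd Q n (\<phi> n p) (\<phi> n q)) \<and>
     (\<forall>n c. \<forall>p \<in> ospace P n. \<phi> n (oscale P n c p) = oscale Q n c (\<phi> n p)) \<and>
     (\<forall>n \<sigma>. \<sigma> permutes {1..n} \<longrightarrow>
        (\<forall>p \<in> ospace P n. \<phi> n (oact P n \<sigma> p) = oact Q n \<sigma> (\<phi> n p))) \<and>
     \<phi> 1 (ounit P) = ounit Q \<and>
     (\<forall>m n. \<forall>i \<in> {1..m}. \<forall>p \<in> ospace P m. \<forall>q \<in> ospace P n.
        \<phi> (m + n - 1) (ocomp P m n i p q) = ocomp Q m n i (\<phi> m p) (\<phi> n q))"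

definition operad_ideal :: "('k, 'p) operad \<Rightarrow> (nat \<Rightarrow> 'p set) \<Rightarrow> bool" where
  "operad_ideal P I \<longleftrightarrow>
     (\<forall>n. I n \<subseteq> ospace P n) \<and>
     (\<forall>n. ozero P n \<in> I n) \<and>
     (\<forall>n. \<forall>p \<in> I n. \<forall>q \<in> I n. oadd P n p q \<in> I n) \<and>
     (\<forall>n c. \<forall>p \<in> I n. oscale P n c p \<in> I n) \<and>
     (\<forall>n \<sigma>. \<sigma> permutes {1..n} \<longrightarrow> (\<forall>p \<in> I n. oact P n \<sigma> p \<in> I n)) \<and>
     (\<forall>m n. \<forall>i \<in> {1..m}. \<forall>p \<in> I m. \<forall>q \<in> ospace P n. ocomp P m n i p q \<in> I (m + n - 1)) \<and>
     (\<forall>m n. \<forall>i \<in> {1..m}. \<forall>p \<in> ospace P m. \<forall>q \<in> I n. ocomp P m n i p q \<in> I (m + n - 1))"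

definition ideal_gen :: "('k, 'p) operad \<Rightarrow> (nat \<Rightarrow> 'p set) \<Rightarrow> nat \<Rightarrow> 'p set" where
  "ideal_gen P S n = \<Inter> {I n | I. operad_ideal P I \<and> (\<forall>m. S m \<subseteq> I m)}"

definition ocoset :: "('k, 'p) operad \<Rightarrow> (nat \<Rightarrow> 'p set) \<Rightarrow> nat \<Rightarrow> 'p \<Rightarrow> 'p set" where
  "ocoset P I n p = oadd P n p ` I n"

definition quot_operad :: "('k, 'p) operad \<Rightarrow> (nat \<Rightarrow> 'p set) \<Rightarrow> ('k, 'p set) operad" where
  "quot_operad P I = \<lparr>
     ospace = (\<lambda>n. ocoset P I n ` ospace P n),
     oadd = (\<lambda>n X Y. \<Union>x\<in>X. \<Union>y\<in>Y. ocoset P I n (oadd P n x y)),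
     ozero = (\<lambda>n. ocoset P I n (ozero P n)),
     oscale = (\<lambda>n c X. \<Union>x\<in>X. ocoset P I n (oscale P n c x)),
     oact = (\<lambda>n \<sigma> X. \<Union>x\<in>X. ocoset P I n (oact P n \<sigma> x)),
     ounit = ocoset P I 1 (ounit P),
     ocomp = (\<lambda>m n i X Y. \<Union>x\<in>X. \<Union>y\<in>Y. ocoset P I (m + n - 1) (ocomp P m n i x y)) \<rparr>"


section \<open>Endomorphism operads and algebras\<close>

definition tuples :: "nat \<Rightarrow> 'a list set" where
  "tuples n = {xs. length xs = n}"

definition multilinear_map ::
  "('k::field \<Rightarrow> 'a::ab_group_add \<Rightarrow> 'a) \<Rightarrow> ('k \<Rightarrow> 'b::ab_group_add \<Rightarrow> 'b) \<Rightarrow> nat \<Rightarrow>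
   ('a list \<Rightarrow> 'b) \<Rightarrow> bool" where
  "multilinear_map s1 s2 n f \<longleftrightarrow>
     (\<forall>xs \<in> tuples n. \<forall>i < n. Vector_Spaces.linear s1 s2 (\<lambda>z. f (xs[i := z])))"

definition End_operad ::
  "('k::field \<Rightarrow> 'a::ab_group_add \<Rightarrow> 'a) \<Rightarrow> ('k, 'a list \<Rightarrow> 'a) operad" where
  "End_operad s = \<lparr>
     ospace = (\<lambda>n. {f \<in> extensional (tuples n). multilinear_map s s n f}),
     oadd = (\<lambda>n f g. restrict (\<lambda>xs. f xs + g xs) (tuples n)),
     ozero = (\<lambda>n. restrict (\<lambda>xs. 0) (tuples n)),
     oscale = (\<lambda>n c f. restrict (\<lambda>xs. s c (f xs)) (tuples n)),
     oact = (\<lambda>n \<sigma> f. restrict (\<lambda>xs. f (map (\<lambda>j. xs ! (\<sigma> j - 1)) [1..<Suc n])) (tuples n)),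
     ounit = restrict hd (tuples 1),
     ocomp = (\<lambda>m n i f g. restrict
       (\<lambda>xs. f (take (i - 1) xs @ [g (take n (drop (i - 1) xs))] @ drop (i - 1 + n) xs))
       (tuples (m + n - 1))) \<rparr>"

text \<open>An algebra over \<open>P\<close> on the vector space with scalar multiplication \<open>s\<close> is a morphism
  \<open>\<phi>\<close> from \<open>P\<close> to the endomorphism operad.\<close>

definition operad_algebra ::
  "('k::field, 'p) operad \<Rightarrow> ('k \<Rightarrow> 'a::ab_group_add \<Rightarrow> 'a) \<Rightarrow>
   (nat \<Rightarrow> 'p \<Rightarrow> 'a list \<Rightarrow> 'a) \<Rightarrow> bool" where
  "operad_algebra P s \<phi> \<longleftrightarrow> vector_space s \<and> operad_morphism P (End_operad s) \<phi>"

definition algebra_hom ::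
  "('k::field, 'p) operad \<Rightarrow>
   ('k \<Rightarrow> 'a::ab_group_add \<Rightarrow> 'a) \<Rightarrow> (nat \<Rightarrow> 'p \<Rightarrow> 'a list \<Rightarrow> 'a) \<Rightarrow>
   ('k \<Rightarrow> 'b::ab_group_add \<Rightarrow> 'b) \<Rightarrow> (nat \<Rightarrow> 'p \<Rightarrow> 'b list \<Rightarrow> 'b) \<Rightarrow> ('a \<Rightarrow> 'b) \<Rightarrow> bool" where
  "algebra_hom P s1 \<phi> s2 \<psi> f \<longleftrightarrow> Vector_Spaces.linear s1 s2 f \<and>
     (\<forall>n. \<forall>p \<in> ospace P n. \<forall>xs \<in> tuples n. f (\<phi> n p xs) = \<psi> n p (map f xs))"


section \<open>Free operads and operads given by generators and relations\<close>

text \<open>An \<open>\<S>\<close>-module \<open>V\<close> with a basis stable under the symmetric groups is the linearisation of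
  that basis, so it is recorded as the basis (\<open>gens\<close>) with the arities of its elements and the
  permutation action of the symmetric group of degree \<open>arity \<omega>\<close> on \<open>\<omega>\<close>.\<close>

record 'v basis =
  gens :: "'v set"
  arity :: "'v \<Rightarrow> nat"
  act :: "(nat \<Rightarrow> nat) \<Rightarrow> 'v \<Rightarrow> 'v"

definition S_module_basis :: "'v basis \<Rightarrow> bool" where
  "S_module_basis V \<longleftrightarrow>
     (\<forall>\<omega> \<in> gens V. arity V \<omega> \<ge> 1 \<and> act V id \<omega> = \<omega> \<and>
       (\<forall>\<sigma>. \<sigma> permutes {1..arity V \<omega>} \<longrightarrow>
          act V \<sigma> \<omega> \<in> gens V \<and> arity V (act V \<sigma> \<omega>) = arity V \<omega> \<and>
          (\<forall>\<tau>. \<tau> permutes {1..arity V \<omega>} \<longrightarrow> act V \<tau> (act V \<sigma> \<omega>) = act V (\<tau> \<circ> \<sigma>) \<omega>)))"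

fun decorated_by :: "'v basis \<Rightarrow> 'v tree \<Rightarrow> bool" where
  "decorated_by V (Leaf j) \<longleftrightarrow> True"
| "decorated_by V (Node \<omega> ts) \<longleftrightarrow>
     \<omega> \<in> gens V \<and> arity V \<omega> = length ts \<and> (\<forall>t\<in>set ts. decorated_by V t)"

definition corolla :: "'v basis \<Rightarrow> 'v \<Rightarrow> 'v tree" where
  "corolla V \<omega> = Node \<omega> (map Leaf [1..<Suc (arity V \<omega>)])"

definition tree_comp :: "nat \<Rightarrow> nat \<Rightarrow> 'o tree \<Rightarrow> 'o tree \<Rightarrow> 'o tree" where
  "tree_comp n i t t' = graft (\<lambda>j. if j < i then Leaf j
     else if j = i then relabel (\<lambda>l. l + i - 1) t'
     else Leaf (j + n - 1)) t"

definition lin_extend ::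
  "('a \<Rightarrow> 'b \<Rightarrow>\<^sub>0 'k) \<Rightarrow> ('a \<Rightarrow>\<^sub>0 'k::field) \<Rightarrow> ('b \<Rightarrow>\<^sub>0 'k)" where
  "lin_extend F p = (\<Sum>t\<in>Poly_Mapping.keys p.
     Poly_Mapping.map ((*) (Poly_Mapping.lookup p t)) (F t))"

abbreviation btree :: "'o tree \<Rightarrow> 'o tree \<Rightarrow>\<^sub>0 'k::field" where
  "btree t \<equiv> Poly_Mapping.single t 1"

text \<open>The operad spanned by all planar decorated trees with arbitrary leaf labellings by
  \<open>{1..n}\<close>; here the action of the symmetric groups on the decorations is not yet taken into
  account.\<close>

definition tree_operad :: "'v basis \<Rightarrow> ('k::field, 'v tree \<Rightarrow>\<^sub>0 'k) operad" where
  "tree_operad V = \<lparr>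
     ospace = (\<lambda>n. {p. \<forall>t \<in> Poly_Mapping.keys p.
        labeled_tree t \<and> decorated_by V t \<and> Lin t = {1..n}}),
     oadd = (\<lambda>n p q. p + q),
     ozero = (\<lambda>n. 0),
     oscale = (\<lambda>n c p. Poly_Mapping.map ((*) c) p),
     oact = (\<lambda>n \<sigma> p. lin_extend (\<lambda>t. btree (relabel \<sigma> t)) p),
     ounit = btree (Leaf 1),
     ocomp = (\<lambda>m n i p q. lin_extend (\<lambda>t. lin_extend (\<lambda>t'. btree (tree_comp n i t t')) q) p) \<rparr>"

text \<open>\<open>\<T>(V)\<close> is obtained by identifying \<open>\<omega>\<^sup>\<sigma>(x\<^sub>1, \<dots>, x\<^sub>n)\<close> with
  \<open>\<omega>(x\<^bsub>\<sigma>(1)\<^esub>, \<dots>, x\<^bsub>\<sigma>(n)\<^esub>)\<close>. Since leaf-labelled reduced trees have no nontrivial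
  automorphisms, each resulting class of decorated trees has exactly one member of any
  prescribed planar shape of its isomorphism class, so that the \<open>n\<close>-th space is the direct sum of
  the \<open>t[V]\<close> over planar representatives \<open>t\<close> of the isomorphism classes.\<close>

definition equivariance :: "'v basis \<Rightarrow> nat \<Rightarrow> ('v tree \<Rightarrow>\<^sub>0 'k::field) set" where
  "equivariance V n = {btree (corolla V (act V \<sigma> \<omega>)) - btree (relabel \<sigma> (corolla V \<omega>))
     | \<omega> \<sigma>. \<omega> \<in> gens V \<and> arity V \<omega> = n \<and> \<sigma> permutes {1..n}}"

definition equivariance_ideal :: "'v basis \<Rightarrow> nat \<Rightarrow> ('v tree \<Rightarrow>\<^sub>0 'k::field) set" where
  "equivariance_ideal V = ideal_gen (tree_operad V) (equivariance V)"

definition free_operad :: "'v basis \<Rightarrow> ('k::field, ('v tree \<Rightarrow>\<^sub>0 'k) set) operad" where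
  "free_operad V = quot_operad (tree_operad V) (equivariance_ideal V)"

definition free_class :: "'v basis \<Rightarrow> nat \<Rightarrow> ('v tree \<Rightarrow>\<^sub>0 'k::field) \<Rightarrow> ('v tree \<Rightarrow>\<^sub>0 'k) set" where
  "free_class V n p = ocoset (tree_operad V) (equivariance_ideal V) n p"

text \<open>Relations are formal linear combinations of labelled trees with a common set of leaf labels.
  As an element of the operad, with leaves labelled by \<open>{1..n}\<close>, a relation is read through the
  order preserving numbering of its leaf labels.\<close>

definition rel_Lin :: "('v tree \<Rightarrow>\<^sub>0 'k::field) \<Rightarrow> nat set" where
  "rel_Lin r = (\<Union>t\<in>Poly_Mapping.keys r. Lin t)"

definition locally_homogeneous :: "'v basis \<Rightarrow> ('v tree \<Rightarrow>\<^sub>0 'k::field) set \<Rightarrow> bool" where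
  "locally_homogeneous V R \<longleftrightarrow> finite R \<and>
     (\<forall>r \<in> R. \<forall>t \<in> Poly_Mapping.keys r.
        labeled_tree t \<and> decorated_by V t \<and> Lin t = rel_Lin r)"

definition label_rank :: "nat set \<Rightarrow> nat \<Rightarrow> nat" where
  "label_rank X j = card {x \<in> X. x \<le> j}"

definition standardize :: "('v tree \<Rightarrow>\<^sub>0 'k::field) \<Rightarrow> ('v tree \<Rightarrow>\<^sub>0 'k)" where
  "standardize r = lin_extend (\<lambda>t. btree (relabel (label_rank (rel_Lin r)) t)) r"

definition relation_ideal ::
  "'v basis \<Rightarrow> ('v tree \<Rightarrow>\<^sub>0 'k::field) set \<Rightarrow> nat \<Rightarrow> ('v tree \<Rightarrow>\<^sub>0 'k) set set" where
  "relation_ideal V R = ideal_gen (free_operad V)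
     (\<lambda>n. {free_class V n (standardize r) | r. r \<in> R \<and> card (rel_Lin r) = n})"

definition presented_operad ::
  "'v basis \<Rightarrow> ('v tree \<Rightarrow>\<^sub>0 'k::field) set \<Rightarrow> ('k, ('v tree \<Rightarrow>\<^sub>0 'k) set set) operad" where
  "presented_operad V R = quot_operad (free_operad V) (relation_ideal V R)"

definition gen_class ::
  "'v basis \<Rightarrow> ('v tree \<Rightarrow>\<^sub>0 'k::field) set \<Rightarrow> 'v \<Rightarrow> ('v tree \<Rightarrow>\<^sub>0 'k) set set" where
  "gen_class V R \<omega> = ocoset (free_operad V) (relation_ideal V R) (arity V \<omega>)
     (free_class V (arity V \<omega>) (btree (corolla V \<omega>)))"

text \<open>\<open>presented_algebra V R s \<phi> f\<close>: \<open>\<phi>\<close> is an algebra over \<open>\<T>(V)/(R)\<close> on which each generator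
  \<open>\<omega>\<close> acts by \<open>f \<omega>\<close>.\<close>

definition presented_algebra ::
  "'v basis \<Rightarrow> ('v tree \<Rightarrow>\<^sub>0 'k::field) set \<Rightarrow> ('k \<Rightarrow> 'a::ab_group_add \<Rightarrow> 'a) \<Rightarrow>
   (nat \<Rightarrow> ('v tree \<Rightarrow>\<^sub>0 'k) set set \<Rightarrow> 'a list \<Rightarrow> 'a) \<Rightarrow> ('v \<Rightarrow> 'a list \<Rightarrow> 'a) \<Rightarrow> bool" where
  "presented_algebra V R s \<phi> f \<longleftrightarrow> operad_algebra (presented_operad V R) s \<phi> \<and>
     (\<forall>\<omega> \<in> gens V. \<forall>xs \<in> tuples (arity V \<omega>). \<phi> (arity V \<omega>) (gen_class V R \<omega>) xs = f \<omega> xs)"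


section \<open>Splitting\<close>

text \<open>The pair \<open>(\<omega>, I)\<close> is the basis element \<open>\<omega> \<otimes> e\<^sub>I\<close>.\<close>

definition csp_basis :: "(nat \<Rightarrow> nat set set) \<Rightarrow> 'v basis \<Rightarrow> ('v \<times> nat set) basis" where
  "csp_basis C V = \<lparr>
     gens = {(\<omega>, I). \<omega> \<in> gens V \<and> I \<in> C (arity V \<omega>)},
     arity = (\<lambda>(\<omega>, I). arity V \<omega>),
     act = (\<lambda>\<sigma> (\<omega>, I). (act V \<sigma> \<omega>, \<sigma> ` I)) \<rparr>"

text \<open>The grafting \<open>v(p\<^sub>1 \<or> \<dots> \<or> p\<^sub>l)\<close>, extended multilinearly to linear combinations of
  trees.\<close>

definition graft_node :: "'o \<Rightarrow> ('o tree \<Rightarrow>\<^sub>0 'k::field) list \<Rightarrow> ('o tree \<Rightarrow>\<^sub>0 'k)" where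
  "graft_node v ps = (\<Sum>ts \<in> listset (map Poly_Mapping.keys ps).
     Poly_Mapping.single (Node v ts) (\<Prod>i<length ps. Poly_Mapping.lookup (ps ! i) (ts ! i)))"

text \<open>For \<open>J = {}\<close> every vertex receives the sum of the \<open>e\<^sub>I\<close> over all \<open>I\<close>; \<open>J\<close> is a set of leaf
  labels.\<close>

fun csp_tree ::
  "(nat \<Rightarrow> nat set set) \<Rightarrow> nat set \<Rightarrow> 'v tree \<Rightarrow> (('v \<times> nat set) tree \<Rightarrow>\<^sub>0 'k::field)" where
  "csp_tree C J (Leaf j) = btree (Leaf j)"
| "csp_tree C J (Node \<omega> ts) =
     (\<Sum>I \<in> (if J = {} then C (length ts) else {hit_inputs J ts}).
        graft_node (\<omega>, I) (map (\<lambda>t. csp_tree C (J \<inter> Lin t) t) ts))"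

text \<open>A member \<open>J\<close> of \<open>C n\<close> is read as a set of leaf labels of a relation \<open>r\<close> of arity \<open>n\<close>
  through the order preserving numbering of the leaf labels of \<open>r\<close>. For a symmetric
  configuration any other numbering yields the same relations.\<close>

definition csp_relations ::
  "(nat \<Rightarrow> nat set set) \<Rightarrow> ('v tree \<Rightarrow>\<^sub>0 'k::field) set \<Rightarrow>
   (('v \<times> nat set) tree \<Rightarrow>\<^sub>0 'k) set" where
  "csp_relations C R =
     {lin_extend (csp_tree C {x \<in> rel_Lin r. label_rank (rel_Lin r) x \<in> J}) r
      | r J. r \<in> R \<and> J \<in> C (card (rel_Lin r))}"


section \<open>Modules and relative Rota-Baxter operators\<close>

definition entries_at :: "nat set \<Rightarrow> 'a list \<Rightarrow> 'a list" where
  "entries_at I xs = nths xs {k. Suc k \<in> I}"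

definition entries_off :: "nat set \<Rightarrow> 'a list \<Rightarrow> 'a list" where
  "entries_off I xs = nths xs {k. Suc k \<notin> I}"

definition C_module ::
  "'v basis \<Rightarrow> ('v tree \<Rightarrow>\<^sub>0 'k::field) set \<Rightarrow> (nat \<Rightarrow> nat set set) \<Rightarrow>
   ('k \<Rightarrow> 'a::ab_group_add \<Rightarrow> 'a) \<Rightarrow> ('v \<Rightarrow> 'a list \<Rightarrow> 'a) \<Rightarrow>
   ('k \<Rightarrow> 'u::ab_group_add \<Rightarrow> 'u) \<Rightarrow> ('v \<Rightarrow> nat set \<Rightarrow> 'a list \<Rightarrow> 'u list \<Rightarrow> 'u) \<Rightarrow> bool" where
  "C_module V R C sA opA sU l \<longleftrightarrow>
     vector_space sU \<and>
     (\<forall>\<omega> \<in> gens V. \<forall>I \<in> C (arity V \<omega>).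
        (\<forall>us \<in> tuples (card I).
           multilinear_map sA sU (arity V \<omega> - card I) (\<lambda>xs. l \<omega> I xs us)) \<and>
        (\<forall>xs \<in> tuples (arity V \<omega> - card I). multilinear_map sU sU (card I) (l \<omega> I xs))) \<and>
     (\<exists>\<psi>. presented_algebra V R (module_prod.scale sA sU) \<psi>
        (\<lambda>\<omega> zs. (opA \<omega> (map fst zs),
          \<Sum>I \<in> C (arity V \<omega>). l \<omega> I (entries_off I (map fst zs)) (entries_at I (map snd zs)))))"

definition relative_Rota_Baxter ::
  "'v basis \<Rightarrow> (nat \<Rightarrow> nat set set) \<Rightarrow>
   ('k::field \<Rightarrow> 'a::ab_group_add \<Rightarrow> 'a) \<Rightarrow> ('v \<Rightarrow> 'a list \<Rightarrow> 'a) \<Rightarrow>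
   ('k \<Rightarrow> 'u::ab_group_add \<Rightarrow> 'u) \<Rightarrow> ('v \<Rightarrow> nat set \<Rightarrow> 'a list \<Rightarrow> 'u list \<Rightarrow> 'u) \<Rightarrow>
   ('u \<Rightarrow> 'a) \<Rightarrow> bool" where
  "relative_Rota_Baxter V C sA opA sU l \<alpha> \<longleftrightarrow>
     Vector_Spaces.linear sU sA \<alpha> \<and>
     (\<forall>\<omega> \<in> gens V. \<forall>us \<in> tuples (arity V \<omega>).
        opA \<omega> (map \<alpha> us) =
        (\<Sum>I \<in> C (arity V \<omega>). \<alpha> (l \<omega> I (entries_off I (map \<alpha> us)) (entries_at I us))))"

definition split_op ::
  "('v \<Rightarrow> nat set \<Rightarrow> 'a list \<Rightarrow> 'u list \<Rightarrow> 'u) \<Rightarrow> ('u \<Rightarrow> 'a) \<Rightarrow> 'v \<times> nat set \<Rightarrow> 'u list \<Rightarrow> 'u" where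
  "split_op l \<alpha> = (\<lambda>(\<omega>, I) us. l \<omega> I (entries_off I (map \<alpha> us)) (entries_at I us))"

end

theory Submission
  imports Defs
begin

text \<open>
  An algebra over \<open>\<T>(V)/(R)\<close> is the same as a family of multilinear operations, one for each
  generator, that is equivariant and satisfies the relations, where a tree is evaluated at an
  assignment of values to its leaf labels.

  Let \<open>\<rho> = (a, u)\<close> be an assignment with values in \<open>A \<oplus> U\<close>. The \<open>U\<close>-component of the value of
  a tree \<open>\<tau>\<close> is a sum of terms \<open>M\<^sub>J(\<tau>)\<close> over the nonempty sets \<open>J\<close> of leaf labels, where
  \<open>M\<^sub>J(\<tau>)\<close> uses \<open>u\<close> on \<open>J\<close> and \<open>a\<close> elsewhere and applies \<open>l\<^sub>I\<close> with \<open>I = J \<sqinter> \<omega>\<close> at each vertex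
  \<open>\<omega>\<close> whose inputs meet \<open>J\<close>. Hence every relation of \<open>A \<oplus> U\<close> splits into one relation for
  each \<open>J\<close>. Subtrees disjoint from \<open>J\<close> are evaluated in the
  splitting with \<open>*\<close> at every vertex, and the Rota-Baxter identity says that \<open>\<alpha>\<close> sends the result
  to the value of the subtree in \<open>A\<close>. So, for \<open>a = \<alpha> \<circ> u\<close>, the term \<open>M\<^sub>J(\<tau>)\<close> is exactly the
  value of the splitting of \<open>\<tau>\<close> along \<open>J\<close>, which gives the relations of the first claim;
  equivariance is the same argument applied to corollas. For the second claim, the Rota-Baxter
  identity makes the graph of \<open>\<alpha>\<close> a subalgebra of \<open>A \<oplus> U\<close> that projects isomorphically onto \<open>U\<close>.
\<close>

section \<open>Ideals and quotients of operads\<close>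

text \<open>The stated description of algebras over \<T>(V)/(R) has an easy and a laborious half.
  Operations satisfying equivariance and relations give a morphism because tree evaluation kills the
  generators of both ideals, and the kernel of a morphism to an endomorphism operad is an ideal.
  Conversely, \<open>presented_algebra\<close> supplies an arbitrary morphism of which only the
  values on generators are prescribed. That it evaluates every tree in the expected way has to be
  proved by building each tree from corollas by partial compositions and permutations. The obstacle
  is the labels: operad elements have leaves 1, ..., n, whereas subtrees and relations carry
  arbitrary labels, so the induction must be carried out up to renumbering. Labels also matter for
  configurations. A member of C_n is a set of left-to-right positions in the definition of a
  configuration, but a set of ranks of labels in the split relations. The two readings differ by a
  permutation that depends on the tree, and S-invariance reconciles them.\<close>

lemma
  assumes "operad_ideal P I"
  shows operad_ideal_subset: "p \<in> I n \<Longrightarrow> p \<in> ospace P n"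
    and operad_ideal_zero: "ozero P n \<in> I n"
    and operad_ideal_add: "p \<in> I n \<Longrightarrow> q \<in> I n \<Longrightarrow> oadd P n p q \<in> I n"
    and operad_ideal_scale: "p \<in> I n \<Longrightarrow> oscale P n c p \<in> I n"
    and operad_ideal_act: "\<sigma> permutes {1..n} \<Longrightarrow> p \<in> I n \<Longrightarrow> oact P n \<sigma> p \<in> I n"
    and operad_ideal_comp_left: "i \<in> {1..m} \<Longrightarrow> p \<in> I m \<Longrightarrow> q \<in> ospace P n \<Longrightarrow>
      ocomp P m n i p q \<in> I (m + n - 1)"
    and operad_ideal_comp_right: "i \<in> {1..m} \<Longrightarrow> p \<in> ospace P m \<Longrightarrow> q \<in> I n \<Longrightarrow>
      ocomp P m n i p q \<in> I (m + n - 1)"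
  using assms by (simp_all add: operad_ideal_def subset_iff)

lemma mem_ideal_gen_iff: "p \<in> ideal_gen P S n \<longleftrightarrow>
    (\<forall>I. operad_ideal P I \<and> (\<forall>m. S m \<subseteq> I m) \<longrightarrow> p \<in> I n)"
  unfolding ideal_gen_def by blast

text \<open>Collects what quotients by ideals rely on: closure of the spaces and additivity of the
  structure maps. All of it passes to quotients (\<open>linear_operad_quot\<close>), so the
  construction can be applied again to \<open>free_operad V\<close>.\<close>

locale linear_operad =
  fixes P :: "('k::field, 'p) operad"
  assumes add_closed: "p \<in> ospace P n \<Longrightarrow> q \<in> ospace P n \<Longrightarrow> oadd P n p q \<in> ospace P n"
    and zero_closed: "ozero P n \<in> ospace P n"
    and scale_closed: "p \<in> ospace P n \<Longrightarrow> oscale P n c p \<in> ospace P n"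
    and act_closed: "\<sigma> permutes {1..n} \<Longrightarrow> p \<in> ospace P n \<Longrightarrow> oact P n \<sigma> p \<in> ospace P n"
    and unit_closed: "ounit P \<in> ospace P 1"
    and comp_closed: "i \<in> {1..m} \<Longrightarrow> p \<in> ospace P m \<Longrightarrow> q \<in> ospace P n \<Longrightarrow>
      ocomp P m n i p q \<in> ospace P (m + n - 1)"
    and add_assoc: "p \<in> ospace P n \<Longrightarrow> q \<in> ospace P n \<Longrightarrow> r \<in> ospace P n \<Longrightarrow>
      oadd P n (oadd P n p q) r = oadd P n p (oadd P n q r)"
    and add_commute: "p \<in> ospace P n \<Longrightarrow> q \<in> ospace P n \<Longrightarrow> oadd P n p q = oadd P n q p"
    and add_zero: "p \<in> ospace P n \<Longrightarrow> oadd P n p (ozero P n) = p"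
    and add_neg: "p \<in> ospace P n \<Longrightarrow> oadd P n p (oscale P n (-1) p) = ozero P n"
    and scale_add: "p \<in> ospace P n \<Longrightarrow> q \<in> ospace P n \<Longrightarrow>
      oscale P n c (oadd P n p q) = oadd P n (oscale P n c p) (oscale P n c q)"
    and act_add: "\<sigma> permutes {1..n} \<Longrightarrow> p \<in> ospace P n \<Longrightarrow> q \<in> ospace P n \<Longrightarrow>
      oact P n \<sigma> (oadd P n p q) = oadd P n (oact P n \<sigma> p) (oact P n \<sigma> q)"
    and comp_add_left: "i \<in> {1..m} \<Longrightarrow> p \<in> ospace P m \<Longrightarrow> p' \<in> ospace P m \<Longrightarrow> q \<in> ospace P n \<Longrightarrow>
      ocomp P m n i (oadd P m p p') q =
      oadd P (m + n - 1) (ocomp P m n i p q) (ocomp P m n i p' q)"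
    and comp_add_right: "i \<in> {1..m} \<Longrightarrow> p \<in> ospace P m \<Longrightarrow> q \<in> ospace P n \<Longrightarrow> q' \<in> ospace P n \<Longrightarrow>
      ocomp P m n i p (oadd P n q q') =
      oadd P (m + n - 1) (ocomp P m n i p q) (ocomp P m n i p q')"
begin

lemma operad_ideal_ospace: "operad_ideal P (ospace P)"
  unfolding operad_ideal_def
  using add_closed zero_closed scale_closed act_closed comp_closed by blast

text \<open>The full family of spaces is itself an ideal containing the generators, which keeps the
  intersection inside the spaces; each closure property holds in every ideal of the
  intersection.\<close>

lemma operad_ideal_ideal_gen:
  assumes "\<And>n. S n \<subseteq> ospace P n"
  shows "operad_ideal P (ideal_gen P S)"
proof -
  let ?I = "ideal_gen P S"
  have "p \<in> ospace P n" if "p \<in> ?I n" for n p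
    using that operad_ideal_ospace assms unfolding mem_ideal_gen_iff by blast
  moreover have "ozero P n \<in> ?I n" for n
    unfolding mem_ideal_gen_iff by (simp add: operad_ideal_zero)
  moreover have "oadd P n p q \<in> ?I n" if "p \<in> ?I n" "q \<in> ?I n" for n p q
    using that unfolding mem_ideal_gen_iff by (meson operad_ideal_add)
  moreover have "oscale P n c p \<in> ?I n" if "p \<in> ?I n" for n c p
    using that unfolding mem_ideal_gen_iff by (meson operad_ideal_scale)
  moreover have "oact P n \<sigma> p \<in> ?I n" if "\<sigma> permutes {1..n}" "p \<in> ?I n" for n \<sigma> p
    using that unfolding mem_ideal_gen_iff by (meson operad_ideal_act)
  moreover have "ocomp P m n i p q \<in> ?I (m + n - 1)"
    if "i \<in> {1..m}" "p \<in> ?I m" "q \<in> ospace P n" for m n i p q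
    using that unfolding mem_ideal_gen_iff by (meson operad_ideal_comp_left)
  moreover have "ocomp P m n i p q \<in> ?I (m + n - 1)"
    if "i \<in> {1..m}" "p \<in> ospace P m" "q \<in> ?I n" for m n i p q
    using that unfolding mem_ideal_gen_iff by (meson operad_ideal_comp_right)
  ultimately show ?thesis
    unfolding operad_ideal_def by (simp add: subset_iff)
qed

end

lemma ideal_gen_superset: "S n \<subseteq> ideal_gen P S n"
  unfolding ideal_gen_def by blast

lemma ideal_gen_least: "operad_ideal P I \<Longrightarrow> (\<And>m. S m \<subseteq> I m) \<Longrightarrow> ideal_gen P S n \<subseteq> I n"
  unfolding ideal_gen_def by blast

locale operad_quotient = linear_operad P
  for P :: "('k::field, 'p) operad" +
  fixes I :: "nat \<Rightarrow> 'p set"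
  assumes ideal: "operad_ideal P I"
begin

lemmas ideal_subset = operad_ideal_subset[OF ideal]
  and ideal_zero = operad_ideal_zero[OF ideal]
  and ideal_add = operad_ideal_add[OF ideal]
  and ideal_scale = operad_ideal_scale[OF ideal]
  and ideal_act = operad_ideal_act[OF ideal]
  and ideal_comp_left = operad_ideal_comp_left[OF ideal]
  and ideal_comp_right = operad_ideal_comp_right[OF ideal]

abbreviation coset :: "nat \<Rightarrow> 'p \<Rightarrow> 'p set" where
  "coset \<equiv> ocoset P I"

lemma coset_self: "p \<in> ospace P n \<Longrightarrow> p \<in> coset n p"
  unfolding ocoset_def using ideal_zero add_zero by force

lemma coset_nonempty: "p \<in> ospace P n \<Longrightarrow> coset n p \<noteq> {}"
  using coset_self by blast

lemma coset_add_ideal: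
  assumes p: "p \<in> ospace P n" and i: "i \<in> I n"
  shows "coset n (oadd P n p i) = coset n p"
proof
  show "coset n (oadd P n p i) \<subseteq> coset n p"
    unfolding ocoset_def using p i by (auto simp: add_assoc ideal_subset ideal_add)
  have "oadd P n p k \<in> coset n (oadd P n p i)" if k: "k \<in> I n" for k
  proof -
    \<comment> \<open>The element k - i of the ideal: p + k = (p + i) + (k - i).\<close>
    let ?j = "oadd P n (oscale P n (-1) i) k"
    have j: "?j \<in> I n"
      using i k ideal_add ideal_scale by blast
    have "oadd P n i ?j = oadd P n (ozero P n) k"
      using i k by (simp add: add_assoc[symmetric] ideal_subset scale_closed add_neg)
    also have "\<dots> = k"
      using k by (simp add: add_commute[of "ozero P n"] ideal_subset zero_closed add_zero)
    finally have "oadd P n (oadd P n p i) ?j = oadd P n p k"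
      using p i k j by (simp add: add_assoc ideal_subset)
    with j show ?thesis
      unfolding ocoset_def by (metis image_eqI)
  qed
  then show "coset n p \<subseteq> coset n (oadd P n p i)"
    unfolding ocoset_def[of P I n p] by blast
qed

lemma coset_memE:
  assumes "x \<in> coset n p" "p \<in> ospace P n"
  obtains i where "i \<in> I n" "x = oadd P n p i" "x \<in> ospace P n" "coset n x = coset n p"
  using assms coset_add_ideal add_closed ideal_subset unfolding ocoset_def by blast

lemma coset_ideal: "p \<in> I n \<Longrightarrow> coset n p = coset n (ozero P n)"
  by (metis add_commute add_zero coset_add_ideal ideal_subset zero_closed)

text \<open>Operations of \<open>quot_operad\<close> are unions over all representatives. Once the
  result does not depend on the representative, the union collapses to it, because a coset is
  nonempty.\<close>

lemma UN_coset_const: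
  assumes "p \<in> ospace P n" and "\<And>x. x \<in> coset n p \<Longrightarrow> x \<in> ospace P n \<Longrightarrow> F x = c"
  shows "(\<Union>x\<in>coset n p. F x) = c"
  using assms coset_self by (blast elim: coset_memE)

lemma coset_add_cong:
  assumes "x \<in> coset n p" "y \<in> coset n q" and p: "p \<in> ospace P n" and q: "q \<in> ospace P n"
  shows "coset n (oadd P n x y) = coset n (oadd P n p q)"
proof -
  obtain i where "i \<in> I n" "x = oadd P n p i"
    using \<open>x \<in> coset n p\<close> p by (rule coset_memE)
  moreover obtain j where "j \<in> I n" "y = oadd P n q j"
    using \<open>y \<in> coset n q\<close> q by (rule coset_memE)
  ultimately have ij: "i \<in> I n" "x = oadd P n p i" "j \<in> I n" "y = oadd P n q j"
    by auto
  have i: "i \<in> ospace P n" and j: "j \<in> ospace P n"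
    using ij ideal_subset by auto
  have "oadd P n x y = oadd P n p (oadd P n (oadd P n i q) j)"
    using p q i j by (simp add: ij add_assoc add_closed)
  also have "\<dots> = oadd P n (oadd P n p q) (oadd P n i j)"
    using p q i j by (simp add: add_commute[of i n q] add_assoc add_closed)
  finally show ?thesis
    using ij p q by (simp add: coset_add_ideal ideal_add add_closed)
qed

lemma quot_simps:
  "ospace (quot_operad P I) n = coset n ` ospace P n"
  "ozero (quot_operad P I) n = coset n (ozero P n)"
  "ounit (quot_operad P I) = coset 1 (ounit P)"
  by (simp_all add: quot_operad_def)

lemma quot_add:
  assumes "p \<in> ospace P n" "q \<in> ospace P n"
  shows "oadd (quot_operad P I) n (coset n p) (coset n q) = coset n (oadd P n p q)"
  using assms unfolding quot_operad_def by (simp add: UN_coset_const coset_add_cong coset_nonempty)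

lemma quot_scale:
  assumes p: "p \<in> ospace P n"
  shows "oscale (quot_operad P I) n c (coset n p) = coset n (oscale P n c p)"
proof -
  have "coset n (oscale P n c x) = coset n (oscale P n c p)" if "x \<in> coset n p" for x
    using that p
    by (elim coset_memE) (auto simp: scale_add coset_add_ideal ideal_scale ideal_subset scale_closed)
  then show ?thesis
    using p unfolding quot_operad_def by (simp add: UN_coset_const coset_nonempty)
qed

lemma quot_act:
  assumes \<sigma>: "\<sigma> permutes {1..n}" and p: "p \<in> ospace P n"
  shows "oact (quot_operad P I) n \<sigma> (coset n p) = coset n (oact P n \<sigma> p)"
proof -
  have "coset n (oact P n \<sigma> x) = coset n (oact P n \<sigma> p)" if "x \<in> coset n p" for x
    using that p \<sigma>
    by (elim coset_memE) (auto simp: act_add[OF \<sigma>] coset_add_ideal ideal_act ideal_subset act_closed)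
  then show ?thesis
    using p unfolding quot_operad_def by (simp add: UN_coset_const coset_nonempty)
qed

lemma quot_comp:
  assumes i: "i \<in> {1..m}" and p: "p \<in> ospace P m" and q: "q \<in> ospace P n"
  shows "ocomp (quot_operad P I) m n i (coset m p) (coset n q) =
    coset (m + n - 1) (ocomp P m n i p q)"
proof -
  have "coset (m + n - 1) (ocomp P m n i x y) = coset (m + n - 1) (ocomp P m n i p q)"
    if "x \<in> coset m p" "y \<in> coset n q" for x y
  proof -
    obtain a where a: "a \<in> I m" "x = oadd P m p a" and x: "x \<in> ospace P m"
      using \<open>x \<in> coset m p\<close> p by (rule coset_memE)
    obtain b where b: "b \<in> I n" "y = oadd P n q b"
      using \<open>y \<in> coset n q\<close> q by (rule coset_memE)
    \<comment> \<open>The representatives are exchanged one factor at a time, so that each exchange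
      uses additivity in a single variable.\<close>
    have "coset (m + n - 1) (ocomp P m n i x y) = coset (m + n - 1) (ocomp P m n i x q)"
      unfolding b(2) comp_add_right[OF i x q ideal_subset[OF b(1)]]
      using i x q b by (intro coset_add_ideal comp_closed ideal_comp_right)
    also have "\<dots> = coset (m + n - 1) (ocomp P m n i p q)"
      unfolding a(2) comp_add_left[OF i p ideal_subset[OF a(1)] q]
      using i p q a by (intro coset_add_ideal comp_closed ideal_comp_left)
    finally show ?thesis .
  qed
  then show ?thesis
    using p q unfolding quot_operad_def by (simp add: UN_coset_const coset_nonempty)
qed

lemma operad_morphism_coset: "operad_morphism P (quot_operad P I) coset"
  unfolding operad_morphism_def
  by (simp add: quot_simps quot_add quot_scale quot_act quot_comp del: One_nat_def atLeastAtMost_iff)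

lemma linear_operad_quot: "linear_operad (quot_operad P I)"
proof unfold_locales
  fix X Y Z :: "'p set" and m n :: nat
  let ?Q = "quot_operad P I"
  show "oadd ?Q n X Y \<in> ospace ?Q n" if "X \<in> ospace ?Q n" "Y \<in> ospace ?Q n"
    using that by (auto simp: quot_simps quot_add add_closed)
  show "ozero ?Q n \<in> ospace ?Q n"
    by (simp add: quot_simps zero_closed)
  show "oscale ?Q n c X \<in> ospace ?Q n" if "X \<in> ospace ?Q n" for c
    using that by (auto simp: quot_simps quot_scale scale_closed)
  show "oact ?Q n \<sigma> X \<in> ospace ?Q n" if "\<sigma> permutes {1..n}" "X \<in> ospace ?Q n" for \<sigma>
    using that by (auto simp: quot_simps quot_act act_closed)
  show "ounit ?Q \<in> ospace ?Q 1"
    using unit_closed by (simp add: quot_simps)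
  show "ocomp ?Q m n i X Y \<in> ospace ?Q (m + n - 1)"
    if "i \<in> {1..m}" "X \<in> ospace ?Q m" "Y \<in> ospace ?Q n" for i
    using that comp_closed[OF that(1)] quot_comp[OF that(1)] by (auto simp: quot_simps)
  show "oadd ?Q n (oadd ?Q n X Y) Z = oadd ?Q n X (oadd ?Q n Y Z)"
    if "X \<in> ospace ?Q n" "Y \<in> ospace ?Q n" "Z \<in> ospace ?Q n"
    using that by (auto simp: quot_simps quot_add add_closed add_assoc)
  show "oadd ?Q n X Y = oadd ?Q n Y X" if "X \<in> ospace ?Q n" "Y \<in> ospace ?Q n"
    using that by (auto simp: quot_simps quot_add add_commute)
  show "oadd ?Q n X (ozero ?Q n) = X" if "X \<in> ospace ?Q n"
    using that by (auto simp: quot_simps quot_add add_zero zero_closed)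
  show "oadd ?Q n X (oscale ?Q n (-1) X) = ozero ?Q n" if "X \<in> ospace ?Q n"
    using that by (auto simp: quot_simps quot_add quot_scale add_neg scale_closed)
  show "oscale ?Q n c (oadd ?Q n X Y) = oadd ?Q n (oscale ?Q n c X) (oscale ?Q n c Y)"
    if "X \<in> ospace ?Q n" "Y \<in> ospace ?Q n" for c
    using that by (auto simp: quot_simps quot_add quot_scale scale_add scale_closed add_closed)
  show "oact ?Q n \<sigma> (oadd ?Q n X Y) = oadd ?Q n (oact ?Q n \<sigma> X) (oact ?Q n \<sigma> Y)"
    if "\<sigma> permutes {1..n}" "X \<in> ospace ?Q n" "Y \<in> ospace ?Q n" for \<sigma>
    using that by (auto simp: quot_simps quot_add quot_act act_add act_closed add_closed)
  show "ocomp ?Q m n i (oadd ?Q m X Y) Z =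
      oadd ?Q (m + n - 1) (ocomp ?Q m n i X Z) (ocomp ?Q m n i Y Z)"
    if i: "i \<in> {1..m}" and "X \<in> ospace ?Q m" "Y \<in> ospace ?Q m" "Z \<in> ospace ?Q n" for i
    using that(2-) quot_comp[OF i] comp_add_left[OF i] comp_closed[OF i]
    by (auto simp: quot_simps quot_add add_closed)
  show "ocomp ?Q m n i X (oadd ?Q n Y Z) =
      oadd ?Q (m + n - 1) (ocomp ?Q m n i X Y) (ocomp ?Q m n i X Z)"
    if i: "i \<in> {1..m}" and "X \<in> ospace ?Q m" "Y \<in> ospace ?Q n" "Z \<in> ospace ?Q n" for i
    using that(2-) quot_comp[OF i] comp_add_right[OF i] comp_closed[OF i]
    by (auto simp: quot_simps quot_add add_closed)
qed

text \<open>The lift evaluates \<Phi> at a chosen representative. As \<open>Q\<close> is an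
  arbitrary record without any laws, \<open>ker\<close> is phrased as invariance under adding
  elements of the ideal rather than as vanishing on it.\<close>

lemma quot_morphism_lift:
  assumes \<Phi>: "operad_morphism P Q \<Phi>"
    and ker: "\<And>n p i. p \<in> ospace P n \<Longrightarrow> i \<in> I n \<Longrightarrow> \<Phi> n (oadd P n p i) = \<Phi> n p"
  obtains \<Psi> where "operad_morphism (quot_operad P I) Q \<Psi>"
    and "\<And>n p. p \<in> ospace P n \<Longrightarrow> \<Psi> n (coset n p) = \<Phi> n p"
proof
  define \<Psi> where "\<Psi> n X = \<Phi> n (SOME x. x \<in> X)" for n X
  show \<Psi>: "\<Psi> n (coset n p) = \<Phi> n p" if "p \<in> ospace P n" for n p
  proof -
    have "(SOME x. x \<in> coset n p) \<in> coset n p"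
      using coset_self[OF that] by (rule someI)
    then show ?thesis
      unfolding \<Psi>_def using ker that by (metis coset_memE)
  qed
  have Q: "(\<forall>X\<in>ospace (quot_operad P I) n. F X) \<longleftrightarrow> (\<forall>p\<in>ospace P n. F (coset n p))" for F n
    by (simp add: quot_simps)
  note quot = quot_simps(3) quot_add quot_scale quot_act quot_comp \<Psi>
    add_closed scale_closed act_closed unit_closed comp_closed
  show "operad_morphism (quot_operad P I) Q \<Psi>"
    using \<Phi> unfolding operad_morphism_def Q
    by (simp add: quot del: One_nat_def atLeastAtMost_iff)
qed

end

section \<open>Morphisms to endomorphism operads\<close>

lemma multilinear_map_update:
  "multilinear_map s1 s2 n f \<Longrightarrow> length xs = n \<Longrightarrow> i < n \<Longrightarrow>
    Vector_Spaces.linear s1 s2 (\<lambda>z. f (xs[i := z]))"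
  by (simp add: multilinear_map_def tuples_def)

lemma multilinear_map_zero:
  assumes "multilinear_map s1 s2 n f" "length xs + length ys + 1 = n"
  shows "f (xs @ 0 # ys) = 0"
proof -
  have "Vector_Spaces.linear s1 s2 (\<lambda>z. f ((xs @ 0 # ys)[length xs := z]))"
    using assms by (intro multilinear_map_update[OF assms(1)]) auto
  then have "f ((xs @ 0 # ys)[length xs := 0]) = 0"
    by (rule module_hom.zero[OF Vector_Spaces.linear.axioms(3)])
  then show ?thesis by simp
qed

lemma mem_End_operad_iff:
  "f \<in> ospace (End_operad s) n \<longleftrightarrow> f \<in> extensional (tuples n) \<and> multilinear_map s s n f"
  by (simp add: End_operad_def)

text \<open>\<open>operad_morphism\<close> does not mention zero. From 0 + 0 = 0 the image equals
  its own double, hence vanishes on tuples; elsewhere both sides are \<open>undefined\<close> by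
  extensionality.\<close>

lemma operad_morphism_End_zero:
  assumes P: "linear_operad P" and \<Phi>: "operad_morphism P (End_operad s) \<Phi>"
  shows "\<Phi> n (ozero P n) = ozero (End_operad s) n"
proof
  interpret linear_operad P by (rule P)
  have ext: "\<Phi> n (ozero P n) \<in> extensional (tuples n)"
    using \<Phi> zero_closed mem_End_operad_iff[of _ s n] unfolding operad_morphism_def by blast
  have "\<Phi> n (oadd P n (ozero P n) (ozero P n)) =
      oadd (End_operad s) n (\<Phi> n (ozero P n)) (\<Phi> n (ozero P n))"
    using \<Phi> zero_closed unfolding operad_morphism_def by blast
  then have eq: "\<Phi> n (ozero P n) = oadd (End_operad s) n (\<Phi> n (ozero P n)) (\<Phi> n (ozero P n))"
    by (simp add: add_zero zero_closed)
  show "\<Phi> n (ozero P n) xs = ozero (End_operad s) n xs" for xs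
    using fun_cong[OF eq, of xs] ext
    by (cases "xs \<in> tuples n") (auto simp: End_operad_def extensional_def)
qed

lemma operad_ideal_kernel:
  assumes P: "linear_operad P" and \<Phi>: "operad_morphism P (End_operad s) \<Phi>"
    and s: "vector_space s"
  shows "operad_ideal P (\<lambda>n. {p \<in> ospace P n. \<Phi> n p = ozero (End_operad s) n})"
proof -
  interpret linear_operad P by (rule P)
  interpret vector_space s by (rule s)
  have space: "\<Phi> n p \<in> ospace (End_operad s) n" if "p \<in> ospace P n" for n p
    using \<Phi> that unfolding operad_morphism_def by blast
  have add: "\<Phi> n (oadd P n p q) = oadd (End_operad s) n (\<Phi> n p) (\<Phi> n q)"
    if "p \<in> ospace P n" "q \<in> ospace P n" for n p q
    using \<Phi> that unfolding operad_morphism_def by blast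
  have scale: "\<Phi> n (oscale P n c p) = oscale (End_operad s) n c (\<Phi> n p)"
    if "p \<in> ospace P n" for n p c
    using \<Phi> that unfolding operad_morphism_def by blast
  have act: "\<Phi> n (oact P n \<sigma> p) = oact (End_operad s) n \<sigma> (\<Phi> n p)"
    if "\<sigma> permutes {1..n}" "p \<in> ospace P n" for n p \<sigma>
    using \<Phi> that unfolding operad_morphism_def by blast
  have comp: "\<Phi> (m + n - 1) (ocomp P m n i p q) = ocomp (End_operad s) m n i (\<Phi> m p) (\<Phi> n q)"
    if "i \<in> {1..m}" "p \<in> ospace P m" "q \<in> ospace P n" for m n i p q
    using \<Phi> that unfolding operad_morphism_def by blast
  have "oact (End_operad s) n \<sigma> (ozero (End_operad s) n) = ozero (End_operad s) n" for n \<sigma>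
    by (auto simp: End_operad_def tuples_def fun_eq_iff restrict_def)
  moreover have "ocomp (End_operad s) m n i (ozero (End_operad s) m) g =
      ozero (End_operad s) (m + n - 1)" if "i \<in> {1..m}" for m n i g
    using that by (auto simp: End_operad_def tuples_def fun_eq_iff restrict_def)
  \<comment> \<open>The composite puts 0 into slot i of \<open>f\<close>, so this case uses
    multilinearity of \<open>f\<close>.\<close>
  moreover have "ocomp (End_operad s) m n i f (ozero (End_operad s) n) =
      ozero (End_operad s) (m + n - 1)" if "i \<in> {1..m}" "f \<in> ospace (End_operad s) m" for m n i f
  proof -
    have "f (take (i - 1) xs @ 0 # drop (i - 1 + n) xs) = 0" if "length xs = m + n - 1" for xs
      using \<open>f \<in> _\<close> \<open>i \<in> _\<close> that
      by (intro multilinear_map_zero[of s s m]) (auto simp: mem_End_operad_iff)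
    then show ?thesis
      using that by (auto simp: End_operad_def tuples_def fun_eq_iff restrict_def)
  qed
  moreover have "oadd (End_operad s) n (ozero (End_operad s) n) (ozero (End_operad s) n) =
      ozero (End_operad s) n" for n
    by (auto simp: End_operad_def)
  moreover have "oscale (End_operad s) n c (ozero (End_operad s) n) = ozero (End_operad s) n" for n c
    by (auto simp: End_operad_def)
  ultimately show ?thesis
    unfolding operad_ideal_def using operad_morphism_End_zero[OF P \<Phi>]
    by (simp add: add scale act comp space add_closed zero_closed scale_closed act_closed
        comp_closed del: One_nat_def atLeastAtMost_iff)
qed

text \<open>The universal property of the quotient by a generated ideal: the kernel is an ideal
  containing the generators, hence contains all of \<open>ideal_gen\<close>. It is applied once for
  equivariance and once for the relations.\<close>

lemma operad_morphism_ideal_gen_lift: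
  assumes P: "linear_operad P" and \<Phi>: "operad_morphism P (End_operad s) \<Phi>"
    and s: "vector_space s"
    and S: "\<And>n. S n \<subseteq> ospace P n" "\<And>n p. p \<in> S n \<Longrightarrow> \<Phi> n p = ozero (End_operad s) n"
  obtains \<Psi> where "operad_morphism (quot_operad P (ideal_gen P S)) (End_operad s) \<Psi>"
    and "\<And>n p. p \<in> ospace P n \<Longrightarrow> \<Psi> n (ocoset P (ideal_gen P S) n p) = \<Phi> n p"
proof -
  interpret linear_operad P by (rule P)
  interpret operad_quotient P "ideal_gen P S"
    by unfold_locales (rule operad_ideal_ideal_gen[OF S(1)])
  interpret vector_space s by (rule s)
  have ker: "\<Phi> n i = ozero (End_operad s) n" if "i \<in> ideal_gen P S n" for n i
    using ideal_gen_least[OF operad_ideal_kernel[OF P \<Phi> s], of S n] S that by blast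
  have "\<Phi> n (oadd P n p i) = \<Phi> n p" if "p \<in> ospace P n" "i \<in> ideal_gen P S n" for n p i
  proof -
    have "\<Phi> n (oadd P n p i) = oadd (End_operad s) n (\<Phi> n p) (\<Phi> n i)"
      and "\<Phi> n p \<in> ospace (End_operad s) n"
      using \<Phi> that ideal_subset unfolding operad_morphism_def by blast+
    with ker[OF that(2)] show ?thesis
      by (auto simp: End_operad_def restrict_def extensional_def fun_eq_iff)
  qed
  with \<Phi> show ?thesis
    using that by (rule quot_morphism_lift)
qed

lemma operad_morphism_compose:
  assumes "operad_morphism P Q \<phi>" "operad_morphism Q S \<psi>"
  shows "operad_morphism P S (\<lambda>n p. \<psi> n (\<phi> n p))"
  using assms unfolding operad_morphism_def
  by (simp del: One_nat_def atLeastAtMost_iff)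

section \<open>Linear functionals on formal linear combinations\<close>

text \<open>The linear extension of \<open>g\<close> from basis elements to formal combinations.
  \<open>lin_extend\<close> is the case in which the target consists of formal combinations too, so
  both share the lemmas below.\<close>

definition lin_eval ::
  "('k::field \<Rightarrow> 'a::ab_group_add \<Rightarrow> 'a) \<Rightarrow> ('b \<Rightarrow> 'a) \<Rightarrow> ('b \<Rightarrow>\<^sub>0 'k) \<Rightarrow> 'a" where
  "lin_eval s g p = (\<Sum>t\<in>Poly_Mapping.keys p. s (Poly_Mapping.lookup p t) (g t))"

lemma lookup_map_times [simp]:
  fixes c :: "'k::field"
  shows "Poly_Mapping.lookup (Poly_Mapping.map ((*) c) p) t = c * Poly_Mapping.lookup p t"
  by (transfer) (auto simp: when_def)

lemma vector_space_poly_mapping: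
  "vector_space (\<lambda>(c::'k::field) (p :: 'b \<Rightarrow>\<^sub>0 'k). Poly_Mapping.map ((*) c) p)"
  by unfold_locales (auto intro!: poly_mapping_eqI simp: lookup_add algebra_simps)

lemma lin_extend_eq_lin_eval:
  "lin_extend F p = lin_eval (\<lambda>c. Poly_Mapping.map ((*) c)) F p"
  by (simp add: lin_extend_def lin_eval_def)

context vector_space
begin

text \<open>Allows combinations with different supports to be summed over one index set; supports
  may shrink by cancellation.\<close>

lemma lin_eval_superset:
  assumes "finite A" "Poly_Mapping.keys p \<subseteq> A"
  shows "lin_eval scale g p = (\<Sum>t\<in>A. scale (Poly_Mapping.lookup p t) (g t))"
  unfolding lin_eval_def using assms
  by (intro sum.mono_neutral_left) (auto simp: in_keys_iff)

lemma lin_eval_zero [simp]: "lin_eval scale g 0 = 0"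
  by (simp add: lin_eval_def)

lemma lin_eval_single [simp]: "lin_eval scale g (Poly_Mapping.single t c) = scale c (g t)"
  by (simp add: lin_eval_def)

lemma lin_eval_add: "lin_eval scale g (p + q) = lin_eval scale g p + lin_eval scale g q"
proof -
  let ?A = "Poly_Mapping.keys p \<union> Poly_Mapping.keys q"
  have "Poly_Mapping.keys (p + q) \<subseteq> ?A"
    by (rule keys_add)
  then show ?thesis
    by (simp add: lin_eval_superset[of ?A] lookup_add scale_left_distrib sum.distrib)
qed

lemma lin_eval_scale:
  "lin_eval scale g (Poly_Mapping.map ((*) c) p) = scale c (lin_eval scale g p)"
proof -
  have "Poly_Mapping.keys (Poly_Mapping.map ((*) c) p) \<subseteq> Poly_Mapping.keys p"
    by (auto simp: in_keys_iff)
  then show ?thesis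
    by (simp add: lin_eval_superset[of "Poly_Mapping.keys p"] scale_sum_right)
qed

lemma lin_eval_uminus: "lin_eval scale g (- p) = - lin_eval scale g p"
  using lin_eval_add[of g p "- p"] by (simp add: eq_neg_iff_add_eq_0 add.commute)

lemma lin_eval_diff: "lin_eval scale g (p - q) = lin_eval scale g p - lin_eval scale g q"
  using lin_eval_add[of g p "- q"] by (simp add: lin_eval_uminus)

lemma lin_eval_sum: "lin_eval scale g (\<Sum>x\<in>A. p x) = (\<Sum>x\<in>A. lin_eval scale g (p x))"
  by (induction A rule: infinite_finite_induct) (simp_all add: lin_eval_add)

lemma lin_eval_lin_extend:
  "lin_eval scale g (lin_extend F p) = lin_eval scale (\<lambda>t. lin_eval scale g (F t)) p"
  unfolding lin_extend_def lin_eval_sum lin_eval_scale by (simp add: lin_eval_def)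

lemma lin_eval_cong:
  "(\<And>t. t \<in> Poly_Mapping.keys p \<Longrightarrow> g t = h t) \<Longrightarrow> lin_eval scale g p = lin_eval scale h p"
  by (simp add: lin_eval_def)

lemma lin_eval_add_fun:
  "lin_eval scale (\<lambda>t. g t + h t) p = lin_eval scale g p + lin_eval scale h p"
  by (simp add: lin_eval_def scale_right_distrib sum.distrib)

lemma lin_eval_sum_fun:
  "lin_eval scale (\<lambda>t. \<Sum>x\<in>A. g x t) p = (\<Sum>x\<in>A. lin_eval scale (g x) p)"
  unfolding lin_eval_def scale_sum_right by (rule sum.swap)

end

lemma linear_lin_eval:
  assumes "Vector_Spaces.linear s1 s2 h"
  shows "h (lin_eval s1 g p) = lin_eval s2 (\<lambda>t. h (g t)) p"
proof -
  interpret Vector_Spaces.linear s1 s2 h by (rule assms)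
  show ?thesis by (simp add: lin_eval_def sum scale)
qed

lemma poly_mapping_sum_single:
  "p = (\<Sum>t\<in>Poly_Mapping.keys p. Poly_Mapping.map ((*) (Poly_Mapping.lookup p t))
    (Poly_Mapping.single t (1::'k::field)))"
  by (rule poly_mapping_eqI) (simp add: lookup_sum lookup_single when_def in_keys_iff)

lemma keys_lin_extend:
  assumes "t' \<in> Poly_Mapping.keys (lin_extend F p)"
  obtains t where "t \<in> Poly_Mapping.keys p" "t' \<in> Poly_Mapping.keys (F t)"
proof -
  have "(\<Sum>t\<in>Poly_Mapping.keys p.
      Poly_Mapping.lookup p t * Poly_Mapping.lookup (F t) t') \<noteq> 0"
    using assms by (simp add: lin_extend_def in_keys_iff lookup_sum)
  then obtain t where "t \<in> Poly_Mapping.keys p" "Poly_Mapping.lookup (F t) t' \<noteq> 0"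
    by (metis (no_types, lifting) mult_zero_right sum.neutral)
  then show ?thesis
    using that by (simp add: in_keys_iff)
qed

lemma
  fixes F G :: "'a \<Rightarrow> 'b \<Rightarrow>\<^sub>0 'k::field"
  shows lin_extend_add:
  "lin_extend F (p + q) = lin_extend F p + lin_extend F q"
  and lin_extend_add_fun:
  "lin_extend (\<lambda>t. F t + G t) p = lin_extend F p + lin_extend G p"
  and lin_extend_single [simp]: "lin_extend F (Poly_Mapping.single t 1) = F t"
proof -
  interpret vector_space "\<lambda>(c::'k) (p :: 'b \<Rightarrow>\<^sub>0 'k). Poly_Mapping.map ((*) c) p"
    by (rule vector_space_poly_mapping)
  show "lin_extend F (p + q) = lin_extend F p + lin_extend F q"
    "lin_extend (\<lambda>t. F t + G t) p = lin_extend F p + lin_extend G p"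
    "lin_extend F (Poly_Mapping.single t 1) = F t"
    by (simp_all add: lin_extend_eq_lin_eval lin_eval_add lin_eval_add_fun)
qed

section \<open>Trees\<close>

lemma leaves_graft: "leaves (graft f t) = concat (map (\<lambda>j. leaves (f j)) (leaves t))"
proof (induction t)
  case (Node w ts)
  have "concat (map (\<lambda>t. leaves (graft f t)) ts) =
      concat (map (\<lambda>j. leaves (f j)) (concat (map leaves ts)))"
    using Node.IH by (induction ts) auto
  then show ?case by (simp add: comp_def)
qed simp

lemma Lin_graft: "Lin (graft f t) = (\<Union>j\<in>Lin t. Lin (f j))"
  by (simp add: leaves_graft)

lemma Lin_relabel: "Lin (relabel f t) = f ` Lin t"
  by (auto simp: Lin_graft)

lemma reduced_graft: "reduced t \<Longrightarrow> (\<And>j. j \<in> Lin t \<Longrightarrow> reduced (f j)) \<Longrightarrow> reduced (graft f t)"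
  by (induction t) auto

lemma decorated_graft:
  "decorated_by V t \<Longrightarrow> (\<And>j. j \<in> Lin t \<Longrightarrow> decorated_by V (f j)) \<Longrightarrow> decorated_by V (graft f t)"
  by (induction t) auto

lemma distinct_concat_map:
  assumes "distinct xs" "\<And>x. x \<in> set xs \<Longrightarrow> distinct (f x)"
    and "\<And>x y. x \<in> set xs \<Longrightarrow> y \<in> set xs \<Longrightarrow> x \<noteq> y \<Longrightarrow> set (f x) \<inter> set (f y) = {}"
  shows "distinct (concat (map f xs))"
  using assms by (induction xs) auto

lemma reduced_Lin_nonempty: "reduced t \<Longrightarrow> Lin t \<noteq> {}"
proof (induction t)
  case (Node w ts)
  then show ?case by (cases ts) auto
qed simp

lemma distinct_leaves_child: "distinct (leaves (Node w ts)) \<Longrightarrow> t \<in> set ts \<Longrightarrow> distinct (leaves t)"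
  by (auto simp: distinct_concat_iff dest!: split_list)

lemma disjoint_Lin_children:
  assumes "distinct (leaves (Node w ts))" "i < length ts" "j < length ts" "i \<noteq> j"
  shows "Lin (ts ! i) \<inter> Lin (ts ! j) = {}"
proof -
  have *: "Lin (ts ! a) \<inter> Lin (ts ! b) = {}"
    if d: "distinct (concat (map leaves ts))" and "a < b" "b < length ts" for a b and ts :: "'a tree list"
  proof -
    have "ts = take b ts @ ts ! b # drop (Suc b) ts"
      using that by (simp add: id_take_nth_drop)
    then have "distinct (concat (map leaves (take b ts @ ts ! b # drop (Suc b) ts)))"
      using d by metis
    moreover have "ts ! a \<in> set (take b ts)"
      using that by (metis in_set_conv_nth length_take min_less_iff_conj nth_take order_less_trans)
    ultimately show ?thesis
      by auto
  qed
  show ?thesis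
    using assms *[of ts i j] *[of ts j i] by (cases "i < j") (auto simp: Int_commute)
qed

fun tree_eval :: "('o \<Rightarrow> 'a list \<Rightarrow> 'a) \<Rightarrow> (nat \<Rightarrow> 'a) \<Rightarrow> 'o tree \<Rightarrow> 'a" where
  "tree_eval f \<rho> (Leaf j) = \<rho> j"
| "tree_eval f \<rho> (Node w ts) = f w (map (tree_eval f \<rho>) ts)"

lemma tree_eval_cong: "(\<And>j. j \<in> Lin t \<Longrightarrow> \<rho> j = \<rho>' j) \<Longrightarrow> tree_eval f \<rho> t = tree_eval f \<rho>' t"
proof (induction t)
  case (Node w ts)
  then have "map (tree_eval f \<rho>) ts = map (tree_eval f \<rho>') ts"
    by auto
  then show ?case by (simp only: tree_eval.simps)
qed simp

lemma tree_eval_graft: "tree_eval f \<rho> (graft g t) = tree_eval f (\<lambda>j. tree_eval f \<rho> (g j)) t"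
  by (induction t) (auto intro!: arg_cong[of _ _ "f _"])

lemma tree_eval_relabel: "tree_eval f \<rho> (relabel \<sigma> t) = tree_eval f (\<rho> \<circ> \<sigma>) t"
  by (simp add: tree_eval_graft comp_def)

text \<open>As the leaf labels are distinct, j occurs in exactly one child. Varying the value at j
  therefore changes one argument of the root operation, and linear maps are composed along the path
  from the root to j.\<close>

lemma tree_eval_linear:
  assumes s: "vector_space s"
    and f: "\<And>\<omega>. \<omega> \<in> gens V \<Longrightarrow> multilinear_map s s (arity V \<omega>) (f \<omega>)"
    and t: "decorated_by V t" "distinct (leaves t)" "j \<in> Lin t"
  shows "Vector_Spaces.linear s s (\<lambda>z. tree_eval f (\<rho>(j := z)) t)"
  using t
proof (induction t)
  case (Leaf i)
  interpret vector_space s by (rule s)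
  show ?case
    using Leaf linear_id by (simp add: id_def)
next
  case (Node \<omega> ts)
  then obtain t where "t \<in> set ts" "j \<in> Lin t"
    by auto
  then obtain i where i: "i < length ts" "j \<in> Lin (ts ! i)"
    by (metis in_set_conv_nth)
  have "map (tree_eval f (\<rho>(j := z))) ts =
      (map (tree_eval f \<rho>) ts)[i := tree_eval f (\<rho>(j := z)) (ts ! i)]" (is "?l = ?r") for z
  proof (rule nth_equalityI)
    fix k assume "k < length ?l"
    moreover have "j \<notin> Lin (ts ! k)" if "k \<noteq> i" "k < length ts"
      using disjoint_Lin_children[OF Node.prems(2) that(2) i(1) that(1)] i(2) by auto
    ultimately show "?l ! k = ?r ! k"
      by (cases "k = i") (auto intro: tree_eval_cong)
  qed simp
  moreover have "Vector_Spaces.linear s s (\<lambda>y. f \<omega> ((map (tree_eval f \<rho>) ts)[i := y]))"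
    using Node.prems i by (intro multilinear_map_update[OF f]) auto
  moreover have "Vector_Spaces.linear s s (\<lambda>z. tree_eval f (\<rho>(j := z)) (ts ! i))"
    using Node.prems i by (intro Node.IH) (auto intro: distinct_leaves_child)
  ultimately show ?case
    unfolding tree_eval.simps by (auto dest: Vector_Spaces.linear_compose simp: comp_def)
qed

section \<open>The operad of decorated trees\<close>

definition op_tree :: "'v basis \<Rightarrow> nat \<Rightarrow> 'v tree \<Rightarrow> bool" where
  "op_tree V n t \<longleftrightarrow> labeled_tree t \<and> decorated_by V t \<and> Lin t = {1..n}"

lemma mem_tree_operad_iff:
  "p \<in> ospace (tree_operad V) n \<longleftrightarrow> (\<forall>t\<in>Poly_Mapping.keys p. op_tree V n t)"
  by (simp add: tree_operad_def op_tree_def)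

lemma leaves_relabel: "leaves (relabel f t) = map f (leaves t)"
  by (simp add: leaves_graft)

lemma op_tree_relabel:
  assumes "labeled_tree t" "decorated_by V t" "bij_betw f (Lin t) {1..n}"
  shows "op_tree V n (relabel f t)"
proof -
  have img: "f ` Lin t = {1..n}" and inj: "inj_on f (Lin t)"
    using assms(3) by (auto simp: bij_betw_def)
  then have "distinct (leaves (relabel f t))"
    using assms(1) by (simp add: leaves_relabel distinct_map labeled_tree_def)
  moreover have "0 \<notin> Lin (relabel f t)"
    using img by (simp add: Lin_relabel)
  ultimately show ?thesis
    using assms img
    by (auto simp: op_tree_def labeled_tree_def Lin_relabel intro!: reduced_graft decorated_graft)
qed

lemma op_tree_permutes:
  "op_tree V n t \<Longrightarrow> \<sigma> permutes {1..n} \<Longrightarrow> op_tree V n (relabel \<sigma> t)"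
  by (rule op_tree_relabel) (auto simp: op_tree_def dest: permutes_imp_bij)

lemma op_tree_pos: "op_tree V n t \<Longrightarrow> 1 \<le> n"
  using reduced_Lin_nonempty[of t] by (cases n) (auto simp: op_tree_def labeled_tree_def)

text \<open>Labels below i stay, i is replaced by the block i, ..., i + n - 1, and labels above i
  move up by n - 1; these sets partition 1, ..., m + n - 1.\<close>

lemma op_tree_comp:
  assumes i: "i \<in> {1..m}" and t: "op_tree V m t" and t': "op_tree V n t'"
  shows "op_tree V (m + n - 1) (tree_comp n i t t')"
proof -
  define g where "g j = (if j < i then Leaf j else if j = i then relabel (\<lambda>l. l + i - 1) t'
    else Leaf (j + n - 1))" for j
  \<comment> \<open>A reduced tree has a leaf. With n positive, the truncated subtraction in j + n -
    1 is harmless.\<close>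
  have n: "1 \<le> n"
    using t' by (rule op_tree_pos)
  have "x \<in> (\<lambda>l. l + i - 1) ` {1..n} \<longleftrightarrow> x \<in> {i..i + n - 1}" for x
    using i n by (auto simp: image_iff intro!: bexI[of _ "x + 1 - i"])
  then have Lin_g: "Lin (g j) = (if j < i then {j} else if j = i then {i..i + n - 1} else {j + n - 1})" for j
    using t' by (auto simp: g_def Lin_relabel op_tree_def)
  have "distinct (leaves (relabel (\<lambda>l. l + i - 1) t'))"
    using t' i by (auto simp: leaves_relabel distinct_map inj_on_def op_tree_def labeled_tree_def)
  then have "distinct (leaves (g j))" for j
    by (simp add: g_def)
  moreover have "Lin (g j) \<inter> Lin (g j') = {}" if "j \<noteq> j'" for j j'
    using that n by (auto simp: Lin_g)
  ultimately have "distinct (leaves (graft g t))"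
    using t unfolding leaves_graft
    by (intro distinct_concat_map) (auto simp: op_tree_def labeled_tree_def)
  moreover have "Lin (graft g t) = {1..m + n - 1}"
  proof -
    have "x \<in> (\<Union>j\<in>{1..m}. Lin (g j)) \<longleftrightarrow> x \<in> {1..m + n - 1}" for x
    proof
      assume "x \<in> (\<Union>j\<in>{1..m}. Lin (g j))"
      then show "x \<in> {1..m + n - 1}"
        using i n by (auto simp: Lin_g split: if_splits)
    next
      assume x: "x \<in> {1..m + n - 1}"
      \<comment> \<open>The conditional names the leaf of \<open>t\<close> from which the label x
        arises.\<close>
      have "x \<in> Lin (g (if x < i then x else if x < i + n then i else x + 1 - n))"
        and "(if x < i then x else if x < i + n then i else x + 1 - n) \<in> {1..m}"
        using x i n by (auto simp: Lin_g)
      then show "x \<in> (\<Union>j\<in>{1..m}. Lin (g j))"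
        by blast
    qed
    moreover have "Lin (graft g t) = (\<Union>j\<in>{1..m}. Lin (g j))"
      using t by (simp add: Lin_graft op_tree_def)
    ultimately show ?thesis
      by blast
  qed
  moreover have "reduced (graft g t)" "decorated_by V (graft g t)"
    using t t' by (auto simp: g_def op_tree_def labeled_tree_def intro!: reduced_graft decorated_graft)
  ultimately show ?thesis
    by (simp add: op_tree_def labeled_tree_def tree_comp_def g_def[abs_def])
qed

lemma tree_operad_simps:
  "oadd (tree_operad V) n p q = p + q"
  "ozero (tree_operad V) n = 0"
  "oscale (tree_operad V) n c p = Poly_Mapping.map ((*) c) p"
  "oact (tree_operad V) n \<sigma> p = lin_extend (\<lambda>t. btree (relabel \<sigma> t)) p"
  "ounit (tree_operad V) = btree (Leaf 1)"
  "ocomp (tree_operad V) m n i p q = lin_extend (\<lambda>t. lin_extend (\<lambda>t'. btree (tree_comp n i t t')) q) p"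
  by (simp_all add: tree_operad_def)

lemma linear_operad_tree_operad: "linear_operad (tree_operad V :: ('k::field, _) operad)"
proof unfold_locales
  let ?P = "tree_operad V :: ('k::field, _) operad"
  fix p q r p' q' :: "'a tree \<Rightarrow>\<^sub>0 'k" and m n i :: nat and \<sigma> :: "nat \<Rightarrow> nat" and c :: 'k
  interpret PM: vector_space "\<lambda>(c::'k) (p :: 'a tree \<Rightarrow>\<^sub>0 'k). Poly_Mapping.map ((*) c) p"
    by (rule vector_space_poly_mapping)
  show "oadd ?P n p q \<in> ospace ?P n" if "p \<in> ospace ?P n" "q \<in> ospace ?P n"
    using that keys_add[of p q] by (auto simp: mem_tree_operad_iff tree_operad_simps)
  show "ozero ?P n \<in> ospace ?P n"
    by (simp add: mem_tree_operad_iff tree_operad_simps)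
  show "oscale ?P n c p \<in> ospace ?P n" if "p \<in> ospace ?P n"
    using that by (auto simp: mem_tree_operad_iff tree_operad_simps in_keys_iff)
  show "oact ?P n \<sigma> p \<in> ospace ?P n" if "\<sigma> permutes {1..n}" "p \<in> ospace ?P n"
    using that by (auto simp: mem_tree_operad_iff tree_operad_simps op_tree_permutes elim!: keys_lin_extend)
  show "ounit ?P \<in> ospace ?P 1"
    by (simp add: mem_tree_operad_iff tree_operad_simps op_tree_def labeled_tree_def)
  show "ocomp ?P m n i p q \<in> ospace ?P (m + n - 1)"
    if "i \<in> {1..m}" "p \<in> ospace ?P m" "q \<in> ospace ?P n"
    using that
    by (auto simp: mem_tree_operad_iff tree_operad_simps elim!: keys_lin_extend
        intro!: op_tree_comp[unfolded One_nat_def])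
  show "oadd ?P n (oadd ?P n p q) r = oadd ?P n p (oadd ?P n q r)"
    by (simp add: tree_operad_simps add.assoc)
  show "oadd ?P n p q = oadd ?P n q p"
    by (simp add: tree_operad_simps add.commute)
  show "oadd ?P n p (ozero ?P n) = p"
    by (simp add: tree_operad_simps)
  show "oadd ?P n p (oscale ?P n (-1) p) = ozero ?P n"
    unfolding tree_operad_simps PM.scale_minus_left PM.scale_one by simp
  show "oscale ?P n c (oadd ?P n p q) = oadd ?P n (oscale ?P n c p) (oscale ?P n c q)"
    unfolding tree_operad_simps PM.scale_right_distrib by simp
  show "oact ?P n \<sigma> (oadd ?P n p q) = oadd ?P n (oact ?P n \<sigma> p) (oact ?P n \<sigma> q)"
    by (simp add: tree_operad_simps lin_extend_add)
  show "ocomp ?P m n i (oadd ?P m p p') q =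
      oadd ?P (m + n - 1) (ocomp ?P m n i p q) (ocomp ?P m n i p' q)"
    by (simp add: tree_operad_simps lin_extend_add)
  show "ocomp ?P m n i p (oadd ?P n q q') =
      oadd ?P (m + n - 1) (ocomp ?P m n i p q) (ocomp ?P m n i p q')"
    by (simp add: tree_operad_simps lin_extend_add lin_extend_add_fun)
qed

text \<open>The arguments of the outer operation in a partial composite, sorted by the case
  distinction of \<open>tree_comp\<close>. In the last case the label j + n - 1 is read at list
  position j + n - 1 - 1.\<close>

lemma nth_comp_args:
  assumes "i \<in> {1..m}" "j \<in> {1..m}" "length xs = m + n - 1"
  shows "(take (i - 1) xs @ [v] @ drop (i - 1 + n) xs) ! (j - 1) =
    (if j < i then xs ! (j - 1) else if j = i then v else xs ! (j + n - 1 - 1))"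
  using assms by (auto simp: nth_append nth_Cons' add.commute[of n] numeral_2_eq_2)

lemma tree_eval_tree_comp:
  assumes i: "i \<in> {1..m}" and t: "op_tree V m t" and t': "op_tree V n t'"
    and xs: "length xs = m + n - 1"
  shows "tree_eval f (\<lambda>j. xs ! (j - 1)) (tree_comp n i t t') =
    tree_eval f (\<lambda>j. (take (i - 1) xs @
      [tree_eval f (\<lambda>l. take n (drop (i - 1) xs) ! (l - 1)) t'] @ drop (i - 1 + n) xs) ! (j - 1)) t"
proof -
  have "tree_eval f (\<lambda>l. xs ! (l + i - 1 - 1)) t' =
      tree_eval f (\<lambda>l. take n (drop (i - 1) xs) ! (l - 1)) t'"
  proof (rule tree_eval_cong)
    fix l assume "l \<in> Lin t'"
    then show "xs ! (l + i - 1 - 1) = take n (drop (i - 1) xs) ! (l - 1)"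
      using i t' xs by (auto simp: op_tree_def intro!: arg_cong[of _ _ "(!) xs"])
  qed
  then show ?thesis
    unfolding tree_comp_def tree_eval_graft
    using t nth_comp_args[OF i _ xs]
    by (intro tree_eval_cong)
      (simp add: op_tree_def tree_eval_relabel tree_eval_graft comp_def del: append.simps)
qed

text \<open>Restriction to \<open>tuples n\<close> yields the extensional function that
  \<open>End_operad\<close> expects.\<close>

definition eval_morphism ::
  "('k::field \<Rightarrow> 'a::ab_group_add \<Rightarrow> 'a) \<Rightarrow> ('v \<Rightarrow> 'a list \<Rightarrow> 'a) \<Rightarrow>
    nat \<Rightarrow> ('v tree \<Rightarrow>\<^sub>0 'k) \<Rightarrow> 'a list \<Rightarrow> 'a" where
  "eval_morphism s f n p =
    restrict (\<lambda>xs. lin_eval s (tree_eval f (\<lambda>j. xs ! (j - 1))) p) (tuples n)"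

lemma linear_lin_eval_fun:
  assumes s: "vector_space s"
    and g: "\<And>t. t \<in> Poly_Mapping.keys p \<Longrightarrow> Vector_Spaces.linear s s (\<lambda>z. g z t)"
  shows "Vector_Spaces.linear s s (\<lambda>z. lin_eval s (g z) p)"
proof -
  interpret vector_space s by (rule s)
  interpret vector_space_pair s s by unfold_locales
  show ?thesis
    unfolding lin_eval_def by (intro linear_compose_sum ballI linear_compose_scale_right g)
qed

text \<open>In \<open>tree_operad V\<close> a vertex \<omega> and its permuted versions are still
  unrelated decorations, so every family of multilinear operations extends to a morphism.
  Compatibility with the action on generators enters with the quotient.\<close>

lemma operad_morphism_eval_morphism:
  assumes s: "vector_space s"
    and f: "\<And>\<omega>. \<omega> \<in> gens V \<Longrightarrow> multilinear_map s s (arity V \<omega>) (f \<omega>)"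
  shows "operad_morphism (tree_operad V) (End_operad s) (eval_morphism s f)"
proof -
  interpret vector_space s by (rule s)
  let ?P = "tree_operad V" and ?E = "End_operad s" and ?\<Phi> = "eval_morphism s f"
  have lin: "Vector_Spaces.linear s s (\<lambda>z. tree_eval f (\<rho>(j := z)) t)"
    if "op_tree V n t" "j \<in> {1..n}" for n t j \<rho>
    using that by (intro tree_eval_linear[OF s f]) (auto simp: op_tree_def labeled_tree_def)
  have "?\<Phi> n p \<in> ospace ?E n" if p: "p \<in> ospace ?P n" for n p
  proof -
    have "Vector_Spaces.linear s s (\<lambda>z. ?\<Phi> n p (xs[i := z]))"
      if xs: "length xs = n" and i: "i < n" for xs i
    proof -
      have "tree_eval f (\<lambda>j. xs[i := z] ! (j - 1)) t =
          tree_eval f ((\<lambda>j. xs ! (j - 1))(Suc i := z)) t" if "op_tree V n t" for z t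
        using that xs i by (intro tree_eval_cong) (auto simp: op_tree_def nth_list_update)
      then have "?\<Phi> n p (xs[i := z]) =
          lin_eval s (tree_eval f ((\<lambda>j. xs ! (j - 1))(Suc i := z))) p" for z
        using p xs by (auto simp: eval_morphism_def tuples_def mem_tree_operad_iff intro!: lin_eval_cong)
      moreover have "Vector_Spaces.linear s s
          (\<lambda>z. lin_eval s (tree_eval f ((\<lambda>j. xs ! (j - 1))(Suc i := z))) p)"
        using p i by (intro linear_lin_eval_fun[OF s] lin[of n]) (auto simp: mem_tree_operad_iff)
      ultimately show ?thesis by simp
    qed
    then show ?thesis
      by (auto simp: mem_End_operad_iff multilinear_map_def tuples_def eval_morphism_def)
  qed
  moreover have "?\<Phi> n (oadd ?P n p q) = oadd ?E n (?\<Phi> n p) (?\<Phi> n q)" for n p q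
    by (auto simp: tree_operad_simps End_operad_def eval_morphism_def lin_eval_add)
  moreover have "?\<Phi> n (oscale ?P n c p) = oscale ?E n c (?\<Phi> n p)" for n c p
    by (auto simp: tree_operad_simps End_operad_def eval_morphism_def lin_eval_scale)
  moreover have "?\<Phi> n (oact ?P n \<sigma> p) = oact ?E n \<sigma> (?\<Phi> n p)"
    if \<sigma>: "\<sigma> permutes {1..n}" and p: "p \<in> ospace ?P n" for n \<sigma> p
  proof
    fix xs
    have "tree_eval f (\<lambda>j. xs ! (j - 1)) (relabel \<sigma> t) =
        tree_eval f (\<lambda>j. map (\<lambda>j. xs ! (\<sigma> j - 1)) [1..<Suc n] ! (j - 1)) t"
      if "op_tree V n t" for t
      unfolding tree_eval_relabel comp_def
      using that by (intro tree_eval_cong) (auto simp: op_tree_def simp del: upt_Suc)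
    then show "?\<Phi> n (oact ?P n \<sigma> p) xs = oact ?E n \<sigma> (?\<Phi> n p) xs"
      using p by (auto simp: tree_operad_simps End_operad_def eval_morphism_def lin_eval_lin_extend
          tuples_def mem_tree_operad_iff simp del: upt_Suc intro!: lin_eval_cong)
  qed
  moreover have "?\<Phi> 1 (ounit ?P) = ounit ?E"
    by (auto simp: tree_operad_simps End_operad_def eval_morphism_def tuples_def length_Suc_conv
        intro!: restrict_ext)
  moreover have "?\<Phi> (m + n - 1) (ocomp ?P m n i p q) = ocomp ?E m n i (?\<Phi> m p) (?\<Phi> n q)"
    if i: "i \<in> {1..m}" and p: "p \<in> ospace ?P m" and q: "q \<in> ospace ?P n" for m n i p q
  proof
    fix xs
    show "?\<Phi> (m + n - 1) (ocomp ?P m n i p q) xs = ocomp ?E m n i (?\<Phi> m p) (?\<Phi> n q) xs"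
    proof (cases "length xs = m + n - 1")
      case xs: True
      define ys where "ys v = take (i - 1) xs @ [v] @ drop (i - 1 + n) xs" for v
      \<comment> \<open>The 0 is a placeholder: \<rho> is always updated at i before it is
        used.\<close>
      define \<rho> where "\<rho> j = ys 0 ! (j - 1)" for j
      define E where "E = tree_eval f (\<lambda>l. take n (drop (i - 1) xs) ! (l - 1))"
      have ys: "tree_eval f (\<lambda>j. ys v ! (j - 1)) t = tree_eval f (\<rho>(i := v)) t"
        if "op_tree V m t" for t v
        unfolding \<rho>_def ys_def using that nth_comp_args[OF i _ xs]
        by (intro tree_eval_cong) (simp add: op_tree_def del: append.simps)
      have comp: "tree_eval f (\<lambda>j. xs ! (j - 1)) (tree_comp n i t t') = tree_eval f (\<rho>(i := E t')) t"
        if "op_tree V m t" "op_tree V n t'" for t t'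
        unfolding ys[OF that(1), symmetric] ys_def E_def by (rule tree_eval_tree_comp[OF i that xs])
      \<comment> \<open>Linearity in the leaf i moves the combination \<open>q\<close> from outside
        the evaluation of \<open>t\<close> into its slot i.\<close>
      have slot: "lin_eval s (\<lambda>t'. tree_eval f (\<rho>(i := E t')) t) q =
          tree_eval f (\<rho>(i := lin_eval s E q)) t" if "op_tree V m t" for t
        by (rule linear_lin_eval[OF lin[OF that i], symmetric])
      have "?\<Phi> (m + n - 1) (ocomp ?P m n i p q) xs = lin_eval s (\<lambda>t. lin_eval s
          (\<lambda>t'. tree_eval f (\<lambda>j. xs ! (j - 1)) (tree_comp n i t t')) q) p"
        using xs by (simp add: eval_morphism_def tuples_def tree_operad_simps lin_eval_lin_extend)
      also have "\<dots> = lin_eval s (\<lambda>t. lin_eval s (\<lambda>t'. tree_eval f (\<rho>(i := E t')) t) q) p"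
        using p q comp by (intro lin_eval_cong) (simp add: mem_tree_operad_iff)
      also have "\<dots> = lin_eval s (\<lambda>t. tree_eval f (\<rho>(i := lin_eval s E q)) t) p"
        using p slot by (intro lin_eval_cong) (simp add: mem_tree_operad_iff)
      also have "\<dots> = lin_eval s (tree_eval f (\<lambda>j. ys (lin_eval s E q) ! (j - 1))) p"
        using p ys by (intro lin_eval_cong) (simp add: mem_tree_operad_iff)
      also have "\<dots> = ?\<Phi> m p (ys (?\<Phi> n q (take n (drop (i - 1) xs))))"
        using xs i by (auto simp: eval_morphism_def tuples_def ys_def E_def)
      also have "\<dots> = ocomp ?E m n i (?\<Phi> m p) (?\<Phi> n q) xs"
        using xs by (simp add: End_operad_def tuples_def ys_def)
      finally show ?thesis .
    qed (simp add: eval_morphism_def End_operad_def tuples_def)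
  qed
  ultimately show ?thesis
    unfolding operad_morphism_def by blast
qed

section \<open>Relations\<close>

text \<open>Formulated for a single relation, so that it can be verified separately for each split
  relation.\<close>

definition tree_relation :: "'v basis \<Rightarrow> ('v tree \<Rightarrow>\<^sub>0 'k::field) \<Rightarrow> bool" where
  "tree_relation V r \<longleftrightarrow>
    (\<forall>t\<in>Poly_Mapping.keys r. labeled_tree t \<and> decorated_by V t \<and> Lin t = rel_Lin r)"

lemma locally_homogeneous_tree_relation:
  "locally_homogeneous V R \<Longrightarrow> r \<in> R \<Longrightarrow> tree_relation V r"
  by (simp add: locally_homogeneous_def tree_relation_def)

lemma finite_rel_Lin: "finite (rel_Lin r)"
  by (simp add: rel_Lin_def)

text \<open>The rank is strictly increasing on \<open>X\<close>, hence injective there, and its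
  values lie in a set of the same cardinality as \<open>X\<close>.\<close>

lemma bij_betw_label_rank:
  assumes "finite X"
  shows "bij_betw (label_rank X) X {1..card X}"
proof -
  have less: "label_rank X j < label_rank X k" if "j < k" "k \<in> X" for j k
  proof -
    have "k \<in> {x \<in> X. x \<le> k} - {x \<in> X. x \<le> j}"
      using that by simp
    moreover have "{x \<in> X. x \<le> j} \<subseteq> {x \<in> X. x \<le> k}"
      using \<open>j < k\<close> by auto
    ultimately have "{x \<in> X. x \<le> j} \<subset> {x \<in> X. x \<le> k}"
      by blast
    then show ?thesis
      unfolding label_rank_def using assms by (simp add: psubset_card_mono)
  qed
  have inj: "inj_on (label_rank X) X"
    by (rule inj_onI) (metis less less_irrefl linorder_neqE_nat)
  have "label_rank X j \<in> {1..card X}" if "j \<in> X" for j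
    unfolding label_rank_def using assms that
    by (auto simp: Suc_le_eq card_gt_0_iff intro!: card_mono)
  then have "label_rank X ` X = {1..card X}"
    using card_image[OF inj] by (intro card_subset_eq) auto
  with inj show ?thesis
    by (simp add: bij_betw_def)
qed

lemma standardize_mem:
  assumes "tree_relation V r"
  shows "standardize r \<in> ospace (tree_operad V) (card (rel_Lin r))"
  using assms bij_betw_label_rank[OF finite_rel_Lin, of r]
  by (auto simp: standardize_def mem_tree_operad_iff tree_relation_def intro!: op_tree_relabel
      elim!: keys_lin_extend)

lemma lin_eval_standardize:
  assumes "vector_space s"
  shows "lin_eval s (tree_eval f \<rho>) (standardize r) =
    lin_eval s (tree_eval f (\<rho> \<circ> label_rank (rel_Lin r))) r"
proof -
  interpret vector_space s by (rule assms)
  show ?thesis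
    by (simp add: standardize_def lin_eval_lin_extend tree_eval_relabel)
qed

text \<open>The operad sees only the standardized relation, evaluated at tuples. Every assignment to
  the original labels agrees on \<open>rel_Lin r\<close> with one that comes from a tuple through
  the ranks.\<close>

lemma lin_eval_relation_eq_0:
  assumes s: "vector_space s" and r: "tree_relation V r"
    and eq0: "\<And>xs. length xs = card (rel_Lin r) \<Longrightarrow>
      lin_eval s (tree_eval f (\<lambda>j. xs ! (j - 1))) (standardize r) = 0"
  shows "lin_eval s (tree_eval f \<rho>) r = 0"
proof -
  interpret vector_space s by (rule s)
  let ?X = "rel_Lin r" and ?n = "card (rel_Lin r)"
  \<comment> \<open>Lists the values of \<rho> by increasing label: position j, counted from 0,
    belongs to the label of rank j + 1.\<close>
  define xs where "xs = map (\<lambda>j. \<rho> (inv_into ?X (label_rank ?X) (Suc j))) [0..<?n]"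
  have "xs ! (label_rank ?X j - 1) = \<rho> j" if "j \<in> ?X" for j
  proof -
    have "label_rank ?X j \<in> {1..?n}" "inv_into ?X (label_rank ?X) (label_rank ?X j) = j"
      using bij_betw_label_rank[OF finite_rel_Lin, of r] that
      by (auto simp: bij_betw_def)
    then show ?thesis
      by (auto simp: xs_def)
  qed
  then have "lin_eval s (tree_eval f \<rho>) r =
      lin_eval s (tree_eval f ((\<lambda>j. xs ! (j - 1)) \<circ> label_rank ?X)) r"
    using r by (intro lin_eval_cong tree_eval_cong) (auto simp: tree_relation_def)
  also have "\<dots> = 0"
    using eq0[of xs] lin_eval_standardize[OF s, of f] by (simp add: xs_def)
  finally show ?thesis .
qed

section \<open>Algebras over presented operads\<close>

lemma op_tree_corolla:
  assumes "\<omega> \<in> gens V" "1 \<le> arity V \<omega>"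
  shows "op_tree V (arity V \<omega>) (corolla V \<omega>)"
  using assms
  by (auto simp: op_tree_def labeled_tree_def corolla_def comp_def)

lemma tree_eval_corolla:
  "tree_eval f \<rho> (corolla V \<omega>) = f \<omega> (map \<rho> [1..<Suc (arity V \<omega>)])"
  by (simp add: corolla_def comp_def del: upt_Suc)

lemma map_nth_upt: "length xs = n \<Longrightarrow> map (\<lambda>j. xs ! (j - 1)) [1..<Suc n] = xs"
  by (rule nth_equalityI) (auto simp del: upt_Suc)

lemma equivariance_subset:
  assumes V: "S_module_basis V"
  shows "equivariance V n \<subseteq> ospace (tree_operad V) n"
proof
  fix p assume "p \<in> equivariance V n"
  then obtain \<omega> \<sigma> where p: "p = btree (corolla V (act V \<sigma> \<omega>)) - btree (relabel \<sigma> (corolla V \<omega>))"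
    and \<omega>: "\<omega> \<in> gens V" "arity V \<omega> = n" and \<sigma>: "\<sigma> permutes {1..n}"
    unfolding equivariance_def by blast
  then have "act V \<sigma> \<omega> \<in> gens V" "arity V (act V \<sigma> \<omega>) = n" "1 \<le> n"
    using V unfolding S_module_basis_def by blast+
  then have "op_tree V n (corolla V (act V \<sigma> \<omega>))" "op_tree V n (relabel \<sigma> (corolla V \<omega>))"
    using \<omega> \<sigma> op_tree_corolla[of \<omega> V] op_tree_corolla[of "act V \<sigma> \<omega>" V]
    by (auto intro: op_tree_permutes)
  moreover have "Poly_Mapping.keys p \<subseteq> {corolla V (act V \<sigma> \<omega>), relabel \<sigma> (corolla V \<omega>)}"
    unfolding p by (auto simp: in_keys_iff lookup_minus lookup_single when_def split: if_splits)
  ultimately show "p \<in> ospace (tree_operad V) n"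
    by (auto simp: mem_tree_operad_iff)
qed

definition presented_class ::
  "'v basis \<Rightarrow> ('v tree \<Rightarrow>\<^sub>0 'k::field) set \<Rightarrow> nat \<Rightarrow> ('v tree \<Rightarrow>\<^sub>0 'k) \<Rightarrow> ('v tree \<Rightarrow>\<^sub>0 'k) set set" where
  "presented_class V R n p = ocoset (free_operad V) (relation_ideal V R) n (free_class V n p)"

text \<open>Used for \<open>V\<close> and \<open>R\<close> as well as for the split basis with the
  split relations.\<close>

locale presentation =
  fixes V :: "'v basis" and R :: "('v tree \<Rightarrow>\<^sub>0 'k::field) set"
  assumes basis: "S_module_basis V"
    and rel: "\<And>r. r \<in> R \<Longrightarrow> tree_relation V r"
begin

sublocale T: linear_operad "tree_operad V :: ('k, _) operad"
  by (rule linear_operad_tree_operad)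

sublocale E: operad_quotient "tree_operad V :: ('k, _) operad" "equivariance_ideal V"
  by unfold_locales
    (simp add: equivariance_ideal_def T.operad_ideal_ideal_gen equivariance_subset[OF basis])

sublocale F: linear_operad "free_operad V :: ('k, _) operad"
  unfolding free_operad_def by (rule E.linear_operad_quot)

lemma relation_classes_subset:
  "{free_class V n (standardize r) | r. r \<in> R \<and> card (rel_Lin r) = n} \<subseteq> ospace (free_operad V) n"
  using standardize_mem[OF rel] by (auto simp: free_operad_def E.quot_simps free_class_def)

sublocale Q: operad_quotient "free_operad V :: ('k, _) operad" "relation_ideal V R"
  by unfold_locales
    (unfold relation_ideal_def, rule F.operad_ideal_ideal_gen[OF relation_classes_subset])

lemma generator_arity: "\<omega> \<in> gens V \<Longrightarrow> 1 \<le> arity V \<omega>"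
  using basis by (simp add: S_module_basis_def)

lemma corolla_mem: "\<omega> \<in> gens V \<Longrightarrow> btree (corolla V \<omega>) \<in> ospace (tree_operad V :: ('k, _) operad) (arity V \<omega>)"
  using op_tree_corolla[OF _ generator_arity] by (simp add: mem_tree_operad_iff)

text \<open>Existence: tree evaluation is lifted through both quotients. On a generator of the
  equivariance ideal it gives the difference of the two sides of \<open>equiv\<close>, and on a
  standardized relation an instance of \<open>relations\<close>.\<close>

lemma presented_algebraI:
  assumes s: "vector_space s"
    and f: "\<And>\<omega>. \<omega> \<in> gens V \<Longrightarrow> multilinear_map s s (arity V \<omega>) (f \<omega>)"
    and equiv: "\<And>\<omega> \<sigma> xs. \<omega> \<in> gens V \<Longrightarrow> \<sigma> permutes {1..arity V \<omega>} \<Longrightarrow> length xs = arity V \<omega> \<Longrightarrow>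
      f (act V \<sigma> \<omega>) xs = f \<omega> (map (\<lambda>j. xs ! (\<sigma> j - 1)) [1..<Suc (arity V \<omega>)])"
    and relations: "\<And>r \<rho>. r \<in> R \<Longrightarrow> lin_eval s (tree_eval f \<rho>) r = 0"
  obtains \<phi> where "presented_algebra V R s \<phi> f"
proof -
  interpret vector_space s by (rule s)
  let ?\<Phi> = "eval_morphism s f"
  have \<Phi>: "operad_morphism (tree_operad V) (End_operad s) ?\<Phi>"
    by (rule operad_morphism_eval_morphism[OF s f])
  have "?\<Phi> n p = ozero (End_operad s) n" if "p \<in> equivariance V n" for n p
  proof -
    obtain \<omega> \<sigma> where "p = btree (corolla V (act V \<sigma> \<omega>)) - btree (relabel \<sigma> (corolla V \<omega>))"
      and "\<omega> \<in> gens V" "arity V \<omega> = n" "\<sigma> permutes {1..n}"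
      using \<open>p \<in> equivariance V n\<close> unfolding equivariance_def by blast
    moreover from this have "arity V (act V \<sigma> \<omega>) = n"
      using basis unfolding S_module_basis_def by blast
    ultimately show ?thesis
      using equiv by (auto simp: eval_morphism_def End_operad_def tuples_def lin_eval_diff
          tree_eval_corolla tree_eval_relabel map_nth_upt[unfolded One_nat_def] comp_def simp del: upt_Suc
          intro!: restrict_ext)
  qed
  note lift = operad_morphism_ideal_gen_lift[OF linear_operad_tree_operad \<Phi> s
      equivariance_subset[OF basis] this, folded equivariance_ideal_def,
      folded free_operad_def free_class_def]
  obtain \<Psi> where \<Psi>: "operad_morphism (free_operad V) (End_operad s) \<Psi>"
    and \<Psi>_eq: "\<And>n p. p \<in> ospace (tree_operad V) n \<Longrightarrow> \<Psi> n (free_class V n p) = ?\<Phi> n p"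
    by (rule lift) (assumption | rule that)+
  have "\<Psi> n p = ozero (End_operad s) n"
    if "p \<in> {free_class V n (standardize r) | r. r \<in> R \<and> card (rel_Lin r) = n}" for n p
    using that standardize_mem[OF rel]
    by (auto simp: \<Psi>_eq eval_morphism_def End_operad_def lin_eval_standardize[OF s] relations)
  note lift = operad_morphism_ideal_gen_lift[OF F.linear_operad_axioms \<Psi> s
      relation_classes_subset this, folded relation_ideal_def, folded presented_operad_def]
  obtain \<phi> where \<phi>: "operad_morphism (presented_operad V R) (End_operad s) \<phi>"
    and \<phi>_eq: "\<And>n p. p \<in> ospace (free_operad V) n \<Longrightarrow>
      \<phi> n (ocoset (free_operad V) (relation_ideal V R) n p) = \<Psi> n p"
    by (rule lift) (assumption | rule that)+
  have "\<phi> (arity V \<omega>) (gen_class V R \<omega>) xs = f \<omega> xs"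
    if "\<omega> \<in> gens V" "xs \<in> tuples (arity V \<omega>)" for \<omega> xs
  proof -
    have "free_class V (arity V \<omega>) (btree (corolla V \<omega>)) \<in>
        ospace (free_operad V :: ('k, _) operad) (arity V \<omega>)"
      using corolla_mem[OF that(1)] by (auto simp: free_operad_def E.quot_simps free_class_def)
    with that corolla_mem show ?thesis
      by (simp add: gen_class_def \<phi>_eq \<Psi>_eq eval_morphism_def tree_eval_corolla tuples_def
          map_nth_upt[unfolded One_nat_def] del: upt_Suc)
  qed
  with \<phi> s have "presented_algebra V R s \<phi> f"
    by (simp add: presented_algebra_def operad_algebra_def)
  then show ?thesis
    by (rule that)
qed

end

section \<open>A morphism from the tree operad is determined by its values on corollas\<close>

lemma graft_graft: "graft f (graft g t) = graft (\<lambda>j. graft f (g j)) t"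
  by (induction t) auto

lemma graft_cong: "(\<And>j. j \<in> Lin t \<Longrightarrow> f j = g j) \<Longrightarrow> graft f t = graft g t"
  by (induction t) auto

lemma graft_Leaf [simp]: "graft Leaf t = t"
  by (induction t) (auto intro: map_idI)

text \<open>Provides distinct placeholder labels, one taken from each child of a vertex.\<close>

lemma distinct_map_hd:
  "distinct (concat xss) \<Longrightarrow> [] \<notin> set xss \<Longrightarrow> distinct (map hd xss)"
proof (induction xss)
  case (Cons xs xss)
  have hd: "hd ys \<in> set ys" if "ys \<in> set (xs # xss)" for ys
    using Cons.prems(2) that by (intro hd_in_set) auto
  have "hd xs \<noteq> hd ys" if "ys \<in> set xss" for ys
    using Cons.prems(1) that hd[of xs] hd[of ys] by auto
  then have "hd xs \<notin> hd ` set xss"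
    by blast
  with Cons show ?case by simp
qed simp

text \<open>An arbitrary morphism \<Phi> that is prescribed on corollas only; the aim is
  \<open>\<Phi>_eval\<close>, which identifies it with tree evaluation.\<close>

locale tree_algebra =
  fixes V :: "'v basis" and s :: "'k::field \<Rightarrow> 'a::ab_group_add \<Rightarrow> 'a"
    and \<Phi> :: "nat \<Rightarrow> ('v tree \<Rightarrow>\<^sub>0 'k) \<Rightarrow> 'a list \<Rightarrow> 'a" and f :: "'v \<Rightarrow> 'a list \<Rightarrow> 'a"
  assumes space: "vector_space s"
    and \<Phi>: "operad_morphism (tree_operad V) (End_operad s) \<Phi>"
    and arity_pos: "\<omega> \<in> gens V \<Longrightarrow> 1 \<le> arity V \<omega>"
    and \<Phi>_corolla: "\<omega> \<in> gens V \<Longrightarrow> length xs = arity V \<omega> \<Longrightarrow>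
      \<Phi> (arity V \<omega>) (btree (corolla V \<omega>)) xs = f \<omega> xs"
begin

definition good :: "nat \<Rightarrow> 'v tree \<Rightarrow> bool" where
  "good n t \<longleftrightarrow> op_tree V n t \<and>
    (\<forall>xs. length xs = n \<longrightarrow> \<Phi> n (btree t) xs = tree_eval f (\<lambda>j. xs ! (j - 1)) t)"

lemma btree_mem: "op_tree V n t \<Longrightarrow> btree t \<in> ospace (tree_operad V :: ('k, _) operad) n"
  by (simp add: mem_tree_operad_iff)

lemma good_Leaf: "good 1 (Leaf 1)"
proof -
  have "\<Phi> 1 (btree (Leaf 1)) = restrict hd (tuples 1)"
    using \<Phi> unfolding operad_morphism_def by (simp add: tree_operad_simps End_operad_def)
  then show ?thesis
    by (auto simp: good_def op_tree_def labeled_tree_def tuples_def length_Suc_conv)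
qed

lemma good_corolla: "\<omega> \<in> gens V \<Longrightarrow> good (arity V \<omega>) (corolla V \<omega>)"
  using op_tree_corolla[OF _ arity_pos]
  by (simp add: good_def \<Phi>_corolla tree_eval_corolla map_nth_upt[unfolded One_nat_def] del: upt_Suc)

lemma good_permutes:
  assumes t: "good n t" and \<sigma>: "\<sigma> permutes {1..n}"
  shows "good n (relabel \<sigma> t)"
proof -
  have op: "op_tree V n t"
    using t by (simp add: good_def)
  have "\<Phi> n (oact (tree_operad V) n \<sigma> (btree t)) = oact (End_operad s) n \<sigma> (\<Phi> n (btree t))"
    using \<Phi> \<sigma> btree_mem[OF op] unfolding operad_morphism_def by blast
  then have act: "\<Phi> n (btree (relabel \<sigma> t)) = oact (End_operad s) n \<sigma> (\<Phi> n (btree t))"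
    by (simp add: tree_operad_simps)
  have "\<Phi> n (btree (relabel \<sigma> t)) xs = tree_eval f (\<lambda>j. xs ! (j - 1)) (relabel \<sigma> t)"
    if "length xs = n" for xs
  proof -
    let ?ys = "map (\<lambda>j. xs ! (\<sigma> j - 1)) [1..<Suc n]"
    have "\<Phi> n (btree (relabel \<sigma> t)) xs = \<Phi> n (btree t) ?ys"
      using that unfolding act by (simp add: End_operad_def tuples_def del: upt_Suc)
    also have "\<dots> = tree_eval f (\<lambda>j. ?ys ! (j - 1)) t"
      using t unfolding good_def by simp
    also have "\<dots> = tree_eval f (\<lambda>j. xs ! (j - 1)) (relabel \<sigma> t)"
      unfolding tree_eval_relabel comp_def
      using op by (intro tree_eval_cong) (auto simp: op_tree_def simp del: upt_Suc)
    finally show ?thesis .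
  qed
  then show ?thesis
    unfolding good_def using op \<sigma> op_tree_permutes by blast
qed

lemma good_comp:
  assumes i: "i \<in> {1..m}" and t: "good m t" and t': "good n t'"
  shows "good (m + n - 1) (tree_comp n i t t')"
proof -
  have op: "op_tree V m t" "op_tree V n t'"
    using t t' by (auto simp: good_def)
  have "\<Phi> (m + n - 1) (ocomp (tree_operad V) m n i (btree t) (btree t')) =
      ocomp (End_operad s) m n i (\<Phi> m (btree t)) (\<Phi> n (btree t'))"
    using \<Phi> i btree_mem[OF op(1)] btree_mem[OF op(2)] unfolding operad_morphism_def by blast
  then have comp: "\<Phi> (m + n - 1) (btree (tree_comp n i t t')) =
      ocomp (End_operad s) m n i (\<Phi> m (btree t)) (\<Phi> n (btree t'))"
    by (simp add: tree_operad_simps)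
  have "\<Phi> (m + n - 1) (btree (tree_comp n i t t')) xs =
      tree_eval f (\<lambda>j. xs ! (j - 1)) (tree_comp n i t t')"
    if xs: "length xs = m + n - 1" for xs
  proof -
    have "\<Phi> (m + n - 1) (btree (tree_comp n i t t')) xs = \<Phi> m (btree t) (take (i - 1) xs @
        [\<Phi> n (btree t') (take n (drop (i - 1) xs))] @ drop (i - 1 + n) xs)"
      using xs unfolding comp by (simp add: End_operad_def tuples_def)
    also have "\<Phi> n (btree t') (take n (drop (i - 1) xs)) =
        tree_eval f (\<lambda>l. take n (drop (i - 1) xs) ! (l - 1)) t'"
      using t' i xs unfolding good_def by auto
    also have "\<Phi> m (btree t) (take (i - 1) xs @
          [tree_eval f (\<lambda>l. take n (drop (i - 1) xs) ! (l - 1)) t'] @ drop (i - 1 + n) xs) =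
        tree_eval f (\<lambda>j. xs ! (j - 1)) (tree_comp n i t t')"
      unfolding tree_eval_tree_comp[OF i op xs] using t i xs unfolding good_def by auto
    finally show ?thesis .
  qed
  then show ?thesis
    unfolding good_def using op_tree_comp[OF i op] by blast
qed

text \<open>Goodness up to renumbering. The children of a vertex do not carry the labels 1, ..., n,
  so structural induction needs a property that makes sense for arbitrary labels.\<close>

definition reachable :: "'v tree \<Rightarrow> bool" where
  "reachable t \<longleftrightarrow> (\<exists>n g. bij_betw g (Lin t) {1..n} \<and> good n (relabel g t))"

text \<open>If the labels are already 1, ..., n, then any numbering of them is a permutation, which
  the action of its inverse undoes.\<close>

lemma good_if_reachable:
  assumes t: "op_tree V n t" and "reachable t"
  shows "good n t"
proof -
  obtain m g where g: "bij_betw g (Lin t) {1..m}" "good m (relabel g t)"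
    using assms(2) by (auto simp: reachable_def)
  have "m = n"
    using bij_betw_same_card[OF g(1)] t by (simp add: op_tree_def)
  \<comment> \<open>Extended by the identity, as \<open>permutes\<close> requires.\<close>
  define \<sigma> where "\<sigma> j = (if j \<in> {1..n} then g j else j)" for j
  have "bij_betw \<sigma> {1..n} {1..n}"
  proof (subst bij_betw_cong)
    show "bij_betw g {1..n} {1..n}"
      using g(1) t unfolding \<open>m = n\<close> by (simp add: op_tree_def)
  qed (simp add: \<sigma>_def)
  then have \<sigma>: "\<sigma> permutes {1..n}"
    by (rule bij_imp_permutes) (auto simp: \<sigma>_def)
  have "relabel (inv \<sigma>) (relabel g t) = relabel (\<lambda>j. j) t"
    unfolding graft_graft graft.simps
  proof (rule graft_cong)
    fix j assume "j \<in> Lin t"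
    then have "g j = \<sigma> j"
      using t by (simp add: \<sigma>_def op_tree_def)
    then show "Leaf (inv \<sigma> (g j)) = Leaf j"
      by (simp add: permutes_inverses[OF \<sigma>])
  qed
  then show ?thesis
    using good_permutes[OF _ permutes_inv[OF \<sigma>]] g(2) \<open>m = n\<close> by fastforce
qed

lemma reachable_Leaf: "reachable (Leaf j)"
  unfolding reachable_def using good_Leaf
  by (intro exI[of _ 1] exI[of _ "\<lambda>_. 1"]) (auto simp: bij_betw_def)

lemma reachable_corolla:
  assumes \<omega>: "\<omega> \<in> gens V" and ks: "distinct ks" "length ks = arity V \<omega>"
  shows "reachable (Node \<omega> (map Leaf ks))"
proof -
  let ?n = "arity V \<omega>" and ?k = "\<lambda>j. ks ! (j - 1)"
  have bij: "bij_betw ?k {1..?n} (set ks)"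
  proof -
    have "bij_betw (\<lambda>j. j - 1) {1..?n} {..<?n}"
      by (rule bij_betw_byWitness[where f' = Suc]) auto
    moreover have "bij_betw ((!) ks) {..<?n} (set ks)"
      using bij_betw_nth[OF ks(1)] ks(2) by simp
    ultimately show ?thesis
      using bij_betw_trans by (fastforce simp: comp_def)
  qed
  \<comment> \<open>Inverts the map from positions to labels, so that relabelling along
    \<open>g\<close> produces the standard corolla.\<close>
  define g where "g = the_inv_into {1..?n} ?k"
  have "bij_betw g (set ks) {1..?n}"
    unfolding g_def by (rule bij_betw_the_inv_into[OF bij])
  moreover have "g (ks ! j) = Suc j" if "j < ?n" for j
    using the_inv_into_f_f[of ?k "{1..?n}" "Suc j"] bij that by (simp add: g_def bij_betw_def)
  then have "relabel g (Node \<omega> (map Leaf ks)) = corolla V \<omega>"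
    using ks(2) by (auto simp: corolla_def intro!: nth_equalityI simp del: upt_Suc)
  ultimately show ?thesis
    unfolding reachable_def using good_corolla[OF \<omega>]
    by (intro exI[of _ ?n] exI[of _ g]) (simp add: comp_def del: graft.simps)
qed

text \<open>Replacing the placeholder leaf x by \<open>t\<close> is a partial composition at the
  input g x. Taking x among the labels of \<open>t\<close> lets disjointness from the other children
  protect the placeholder as well. The map \<open>h\<close> is the numbering that the composite
  induces.\<close>

lemma reachable_subst:
  assumes base: "reachable (Node \<omega> (us @ Leaf x # vs))" and t: "reachable t" and x: "x \<in> Lin t"
    and disj: "\<And>u. u \<in> set us \<union> set vs \<Longrightarrow> Lin u \<inter> Lin t = {}"
  shows "reachable (Node \<omega> (us @ t # vs))"
proof -
  let ?N = "Node \<omega> (us @ Leaf x # vs)" and ?M = "Node \<omega> (us @ t # vs)"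
  obtain m g where g: "bij_betw g (Lin ?N) {1..m}" "good m (relabel g ?N)"
    using base by (auto simp: reachable_def)
  obtain n g' where g': "bij_betw g' (Lin t) {1..n}" "good n (relabel g' t)"
    using t by (auto simp: reachable_def)
  define i where "i = g x"
  have i: "i \<in> {1..m}"
    using bij_betwE[OF g(1)] by (simp add: i_def)
  define k where "k j = (if j < i then Leaf j
    else if j = i then relabel (\<lambda>l. l + i - 1) (relabel g' t) else Leaf (j + n - 1))" for j
  define h where "h y = (if y \<in> Lin t then g' y + i - 1
    else if g y < i then g y else g y + n - 1)" for y
  have "graft k (relabel g u) = relabel h u" if u: "u \<in> set us \<union> set vs" for u
    unfolding graft_graft graft.simps
  proof (rule graft_cong)
    fix y assume y: "y \<in> Lin u"
    then have "y \<notin> Lin t"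
      using disj[OF u] by auto
    moreover from this have "y \<noteq> x"
      using x by auto
    then have "g y \<noteq> i"
      using u y bij_betw_imp_inj_on[OF g(1)] by (auto simp: i_def inj_on_def)
    ultimately show "k (g y) = Leaf (h y)"
      by (simp add: k_def h_def)
  qed
  moreover have "graft k (relabel g (Leaf x)) = relabel h t"
    by (auto simp: k_def i_def[symmetric] graft_graft h_def intro!: graft_cong)
  ultimately have "graft k (relabel g ?N) = relabel h ?M"
    by simp
  then have good: "good (m + n - 1) (relabel h ?M)"
    using good_comp[OF i g(2) g'(2)] by (simp add: tree_comp_def k_def[abs_def] del: graft.simps)
  \<comment> \<open>Bijectivity of \<open>h\<close> needs no separate computation: the composite is
    a tree whose leaves are labelled 1, ..., m + n - 1 without repetition.\<close>
  then have "distinct (map h (leaves ?M))" "h ` Lin ?M = {1..m + n - 1}"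
    unfolding good_def op_tree_def labeled_tree_def leaves_relabel set_map by blast+
  then have "bij_betw h (Lin ?M) {1..m + n - 1}"
    unfolding distinct_map bij_betw_def by auto
  with good show ?thesis
    unfolding reachable_def by blast
qed

text \<open>Placeholders are replaced from left to right; \<open>us\<close> holds the children
  already grafted, \<open>vs\<close> those still represented by one of their leaves.\<close>

lemma reachable_Node:
  assumes \<omega>: "\<omega> \<in> gens V" "arity V \<omega> = length us + length vs"
    and distinct: "distinct (concat (map leaves (us @ vs)))"
    and vs: "\<And>t. t \<in> set vs \<Longrightarrow> reachable t \<and> leaves t \<noteq> []"
    and base: "reachable (Node \<omega> (us @ map (\<lambda>t. Leaf (hd (leaves t))) vs))"
  shows "reachable (Node \<omega> (us @ vs))"
  using assms
proof (induction vs arbitrary: us)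
  case (Cons t vs)
  have hd: "hd (leaves t) \<in> Lin t" if "t \<in> set vs" for t
    using Cons.prems(4)[of t] that by simp
  have "reachable (Node \<omega> (us @ t # map (\<lambda>t. Leaf (hd (leaves t))) vs))"
  proof (rule reachable_subst)
    show "reachable (Node \<omega> (us @ Leaf (hd (leaves t)) # map (\<lambda>t. Leaf (hd (leaves t))) vs))"
      using Cons.prems(5) by simp
    show "reachable t" "hd (leaves t) \<in> Lin t"
      using Cons.prems(4)[of t] by auto
    fix u assume "u \<in> set us \<union> set (map (\<lambda>t. Leaf (hd (leaves t))) vs)"
    then show "Lin u \<inter> Lin t = {}"
      using Cons.prems(3) hd by fastforce
  qed
  then have "reachable (Node \<omega> ((us @ [t]) @ vs))"
    using Cons.prems by (intro Cons.IH) auto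
  then show ?case by simp
qed simp

lemma reachable_tree:
  "reduced t \<Longrightarrow> distinct (leaves t) \<Longrightarrow> decorated_by V t \<Longrightarrow> reachable t"
proof (induction t)
  case (Node \<omega> ts)
  have ne: "leaves t \<noteq> []" if "t \<in> set ts" for t
    using Node.prems(1) that reduced_Lin_nonempty[of t] by auto
  have "distinct (map hd (map leaves ts))"
    using Node.prems(2) ne by (intro distinct_map_hd) force+
  then have "distinct (map (hd \<circ> leaves) ts)"
    by simp
  then have "reachable (Node \<omega> (map Leaf (map (hd \<circ> leaves) ts)))"
    using Node.prems by (intro reachable_corolla) auto
  then have base: "reachable (Node \<omega> ([] @ map (\<lambda>t. Leaf (hd (leaves t))) ts))"
    by (simp add: comp_def)
  have sub: "reachable t" if "t \<in> set ts" for t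
    using Node.prems that distinct_leaves_child[OF Node.prems(2) that] by (intro Node.IH) auto
  have "reachable (Node \<omega> ([] @ ts))"
    using Node.prems ne sub by (rule_tac reachable_Node[OF _ _ _ _ base]) simp_all
  then show ?case by simp
qed (simp add: reachable_Leaf)

lemma \<Phi>_btree:
  "op_tree V n t \<Longrightarrow> length xs = n \<Longrightarrow> \<Phi> n (btree t) xs = tree_eval f (\<lambda>j. xs ! (j - 1)) t"
  using good_if_reachable[OF _ reachable_tree, of n t]
  by (auto simp: op_tree_def labeled_tree_def good_def)

text \<open>Extends the result from single trees by induction on the support. Additivity of \<Phi>
  is available only for members of the operad space, so membership of the partial sums is carried
  along.\<close>

lemma \<Phi>_eval:
  assumes p: "p \<in> ospace (tree_operad V) n" and xs: "length xs = n"
  shows "\<Phi> n p xs = lin_eval s (tree_eval f (\<lambda>j. xs ! (j - 1))) p"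
proof -
  interpret vector_space s by (rule space)
  interpret linear_operad "tree_operad V :: ('k, _) operad"
    by (rule linear_operad_tree_operad)
  let ?q = "\<lambda>t. Poly_Mapping.map ((*) (Poly_Mapping.lookup p t)) (btree t)"
  have mem: "?q t \<in> ospace (tree_operad V) n"
    and val: "\<Phi> n (?q t) xs = lin_eval s (tree_eval f (\<lambda>j. xs ! (j - 1))) (?q t)"
    if "t \<in> Poly_Mapping.keys p" for t
  proof -
    have t: "op_tree V n t"
      using p that by (simp add: mem_tree_operad_iff)
    show "?q t \<in> ospace (tree_operad V) n"
      using scale_closed[OF btree_mem[OF t]] by (simp add: tree_operad_simps)
    have "\<Phi> n (oscale (tree_operad V) n (Poly_Mapping.lookup p t) (btree t)) =
        oscale (End_operad s) n (Poly_Mapping.lookup p t) (\<Phi> n (btree t))"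
      using \<Phi> btree_mem[OF t] unfolding operad_morphism_def by blast
    then show "\<Phi> n (?q t) xs = lin_eval s (tree_eval f (\<lambda>j. xs ! (j - 1))) (?q t)"
      using xs \<Phi>_btree[OF t xs]
      by (simp add: tree_operad_simps lin_eval_scale End_operad_def tuples_def del: map_single)
  qed
  have "(\<Sum>t\<in>A. ?q t) \<in> ospace (tree_operad V) n \<and>
      \<Phi> n (\<Sum>t\<in>A. ?q t) xs = lin_eval s (tree_eval f (\<lambda>j. xs ! (j - 1))) (\<Sum>t\<in>A. ?q t)"
    if "finite A" "A \<subseteq> Poly_Mapping.keys p" for A
    using that
  proof (induction A rule: finite_induct)
    case empty
    have "\<Phi> n 0 = ozero (End_operad s) n"
      using operad_morphism_End_zero[OF linear_operad_tree_operad \<Phi>, of n]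
      by (simp add: tree_operad_simps)
    then show ?case
      using xs by (simp add: mem_tree_operad_iff End_operad_def tuples_def)
  next
    case (insert t A)
    let ?r = "\<Sum>t\<in>A. ?q t"
    have t: "?q t \<in> ospace (tree_operad V) n" and r: "?r \<in> ospace (tree_operad V) n"
      using insert mem by auto
    have "\<Phi> n (oadd (tree_operad V) n (?q t) ?r) = oadd (End_operad s) n (\<Phi> n (?q t)) (\<Phi> n ?r)"
      using \<Phi> t r unfolding operad_morphism_def by blast
    moreover have "oadd (tree_operad V) n (?q t) ?r \<in> ospace (tree_operad V) n"
      by (rule add_closed[OF t r])
    ultimately show ?case
      using insert xs val[of t]
      by (simp add: tree_operad_simps lin_eval_add End_operad_def tuples_def del: map_single)
  qed
  from this[OF finite_keys subset_refl] show ?thesis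
    unfolding poly_mapping_sum_single[of p, symmetric] by simp
qed

end

section \<open>Evaluation, relations and equivariance in a given presented algebra\<close>

context presentation
begin

lemma presented_class_mem:
  "p \<in> ospace (tree_operad V) n \<Longrightarrow> presented_class V R n p \<in> ospace (presented_operad V R) n"
  by (auto simp: presented_class_def presented_operad_def free_operad_def free_class_def
      Q.quot_simps[unfolded free_operad_def] E.quot_simps)

lemma presented_class_cases:
  assumes "P \<in> ospace (presented_operad V R) n"
  obtains p where "p \<in> ospace (tree_operad V) n" "P = presented_class V R n p"
  using assms by (auto simp: presented_class_def presented_operad_def free_operad_def free_class_def
      Q.quot_simps[unfolded free_operad_def] E.quot_simps)

lemma operad_morphism_presented_class:
  "operad_morphism (tree_operad V) (presented_operad V R) (presented_class V R)"
proof -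
  have "operad_morphism (tree_operad V) (free_operad V) (free_class V :: nat \<Rightarrow> (_ \<Rightarrow>\<^sub>0 'k) \<Rightarrow> _)"
    using E.operad_morphism_coset by (simp add: free_operad_def free_class_def[abs_def])
  from operad_morphism_compose[OF this Q.operad_morphism_coset] show ?thesis
    by (simp add: presented_operad_def presented_class_def[abs_def])
qed

context
  fixes s :: "'k \<Rightarrow> 'a::ab_group_add \<Rightarrow> 'a" and \<phi> f
  assumes alg: "presented_algebra V R s \<phi> f"
begin

lemma presented_algebra_space: "vector_space s"
  using alg by (simp add: presented_algebra_def operad_algebra_def)

lemma presented_algebra_morphism: "operad_morphism (presented_operad V R) (End_operad s) \<phi>"
  using alg by (simp add: presented_algebra_def operad_algebra_def)

text \<open>Precomposing \<phi> with both quotient maps gives a morphism from the tree operad that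
  is prescribed on corollas, hence tree evaluation.\<close>

lemma presented_algebra_eval:
  assumes "p \<in> ospace (tree_operad V) n" "length xs = n"
  shows "\<phi> n (presented_class V R n p) xs = lin_eval s (tree_eval f (\<lambda>j. xs ! (j - 1))) p"
proof -
  interpret tree_algebra V s "\<lambda>n p. \<phi> n (presented_class V R n p)" f
  proof (rule tree_algebra.intro)
    show "vector_space s"
      by (rule presented_algebra_space)
    show "operad_morphism (tree_operad V) (End_operad s) (\<lambda>n p. \<phi> n (presented_class V R n p))"
      by (rule operad_morphism_compose[OF operad_morphism_presented_class presented_algebra_morphism])
    show "\<phi> (arity V \<omega>) (presented_class V R (arity V \<omega>) (btree (corolla V \<omega>))) xs = f \<omega> xs"
      if "\<omega> \<in> gens V" "length xs = arity V \<omega>" for \<omega> xs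
      using alg that by (simp add: presented_algebra_def gen_class_def presented_class_def tuples_def)
    show "1 \<le> arity V \<omega>" if "\<omega> \<in> gens V" for \<omega>
      using that by (rule generator_arity)
  qed
  show ?thesis
    using assms by (rule \<Phi>_eval)
qed

lemma presented_algebra_vanish:
  assumes "presented_class V R n p = presented_class V R n 0" "p \<in> ospace (tree_operad V) n"
    and "length xs = n"
  shows "lin_eval s (tree_eval f (\<lambda>j. xs ! (j - 1))) p = 0"
proof -
  interpret vector_space s by (rule presented_algebra_space)
  have "0 \<in> ospace (tree_operad V :: ('k, _) operad) n"
    by (simp add: mem_tree_operad_iff)
  from presented_algebra_eval[OF this assms(3)] presented_algebra_eval[OF assms(2,3)] assms(1)
  show ?thesis
    by simp
qed

text \<open>The standardized relation and 0 have the same class, so they evaluate equally at every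
  tuple; \<open>lin_eval_relation_eq_0\<close> passes from tuples to arbitrary assignments of
  labels.\<close>

lemma presented_algebra_relation:
  assumes r: "r \<in> R"
  shows "lin_eval s (tree_eval f \<rho>) r = 0"
proof (rule lin_eval_relation_eq_0[OF presented_algebra_space rel[OF r]])
  fix xs :: "'a list" assume xs: "length xs = card (rel_Lin r)"
  let ?n = "card (rel_Lin r)"
  have "free_class V ?n (standardize r) \<in> relation_ideal V R ?n"
    unfolding relation_ideal_def by (rule subsetD[OF ideal_gen_superset]) (use r in blast)
  moreover have "ozero (free_operad V) ?n = free_class V ?n (0 :: _ \<Rightarrow>\<^sub>0 'k)"
    by (simp add: free_operad_def E.quot_simps free_class_def tree_operad_simps)
  ultimately have "presented_class V R ?n (standardize r) = presented_class V R ?n 0"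
    unfolding presented_class_def by (simp add: Q.coset_ideal)
  then show "lin_eval s (tree_eval f (\<lambda>j. xs ! (j - 1))) (standardize r) = 0"
    using standardize_mem[OF rel[OF r]] xs by (rule presented_algebra_vanish)
qed

lemma presented_algebra_equivariant:
  assumes \<omega>: "\<omega> \<in> gens V" and \<sigma>: "\<sigma> permutes {1..arity V \<omega>}" and xs: "length xs = arity V \<omega>"
  shows "f (act V \<sigma> \<omega>) xs = f \<omega> (map (\<lambda>j. xs ! (\<sigma> j - 1)) [1..<Suc (arity V \<omega>)])"
proof -
  interpret vector_space s by (rule presented_algebra_space)
  let ?n = "arity V \<omega>"
  let ?e = "btree (corolla V (act V \<sigma> \<omega>)) - btree (relabel \<sigma> (corolla V \<omega>)) :: _ \<Rightarrow>\<^sub>0 'k"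
  have e: "?e \<in> equivariance V ?n"
    using \<omega> \<sigma> unfolding equivariance_def by blast
  then have "?e \<in> equivariance_ideal V ?n"
    unfolding equivariance_ideal_def by (rule subsetD[OF ideal_gen_superset])
  then have "presented_class V R ?n ?e = presented_class V R ?n 0"
    unfolding presented_class_def free_class_def
    by (simp add: E.coset_ideal tree_operad_simps)
  then have "lin_eval s (tree_eval f (\<lambda>j. xs ! (j - 1))) ?e = 0"
    using equivariance_subset[OF basis, of ?n] e xs by (intro presented_algebra_vanish) auto
  moreover have "arity V (act V \<sigma> \<omega>) = ?n"
    using basis \<omega> \<sigma> unfolding S_module_basis_def by blast
  moreover have "map (\<lambda>j. xs ! (j - 1)) [1..<Suc ?n] = xs"
    by (rule map_nth_upt[OF xs])
  ultimately show ?thesis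
    by (simp add: lin_eval_diff tree_eval_relabel tree_eval_corolla comp_def del: upt_Suc)
qed

end

end

section \<open>Multilinear expansion\<close>

lemma set_Cons_eq_image: "set_Cons A B = (\<lambda>(x, xs). x # xs) ` (A \<times> B)"
  by (auto simp: set_Cons_def)

lemma sum_set_Cons: "sum g (set_Cons A B) = (\<Sum>x\<in>A. \<Sum>xs\<in>B. g (x # xs))"
proof -
  have "inj_on (\<lambda>(x, xs). x # xs) (A \<times> B)"
    by (auto simp: inj_on_def)
  then show ?thesis
    by (simp add: set_Cons_eq_image sum.reindex sum.cartesian_product case_prod_unfold)
qed

lemma mem_listset_iff: "xs \<in> listset As \<longleftrightarrow> list_all2 (\<in>) xs As"
  by (induction As arbitrary: xs) (auto simp: set_Cons_def list_all2_Cons2)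

lemma linear_sum_fun:
  assumes "Vector_Spaces.linear s1 s2 f"
  shows "f (\<Sum>x\<in>A. g x) = (\<Sum>x\<in>A. f (g x))"
proof -
  interpret Vector_Spaces.linear s1 s2 f by (rule assms)
  show ?thesis by (rule sum)
qed

lemma linear_scale_fun: "Vector_Spaces.linear s1 s2 f \<Longrightarrow> f (s1 c x) = s2 c (f x)"
  by (rule module_hom.scale[OF Vector_Spaces.linear.axioms(3)])

lemma multilinear_map_slot:
  assumes "multilinear_map s1 s2 n f" "length us + Suc (length vs) = n"
  shows "Vector_Spaces.linear s1 s2 (\<lambda>z. f (us @ z # vs))"
  using multilinear_map_update[OF assms(1), of "us @ undefined # vs" "length us"] assms(2) by simp

text \<open>The prefix \<open>us\<close> contains the slots already expanded and makes the induction
  possible. Summands depend on p as well as on x: in \<open>snd_tree_eval\<close>, p is a subtree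
  and x a set of its leaf labels.\<close>

lemma multilinear_map_sum_prefix:
  assumes f: "multilinear_map s1 s2 n f" and "length us + length ps = n"
  shows "f (us @ map (\<lambda>p. \<Sum>x\<in>X p. h p x) ps) =
    (\<Sum>xs\<in>listset (map X ps). f (us @ map2 h ps xs))"
  using assms(2)
proof (induction ps arbitrary: us)
  case (Cons p ps)
  let ?vs = "map (\<lambda>p. \<Sum>x\<in>X p. h p x) ps"
  have "f (us @ (\<Sum>x\<in>X p. h p x) # ?vs) = (\<Sum>x\<in>X p. f (us @ h p x # ?vs))"
    using Cons.prems by (intro linear_sum_fun[OF multilinear_map_slot[OF f]]) simp
  also have "\<dots> = (\<Sum>x\<in>X p. \<Sum>xs\<in>listset (map X ps). f (us @ h p x # map2 h ps xs))"
    using Cons.IH[of "us @ [h p x]" for x] Cons.prems by (intro sum.cong refl) simp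
  finally show ?case
    by (simp add: sum_set_Cons)
qed simp

lemmas multilinear_map_sum = multilinear_map_sum_prefix[where us = "[]", simplified]

lemma multilinear_map_scale_prefix:
  assumes f: "multilinear_map s1 s2 n f" and s2: "vector_space s2"
    and "length us + length ps = n" "length xs = length ps"
  shows "f (us @ map2 (\<lambda>p x. s1 (c p x) (g x)) ps xs) =
    s2 (\<Prod>i<length ps. c (ps ! i) (xs ! i)) (f (us @ map g xs))"
  using assms(4,3)
proof (induction xs ps arbitrary: us rule: list_induct2)
  case Nil
  interpret vector_space s2 by (rule s2)
  show ?case by simp
next
  case (Cons x xs p ps)
  interpret vector_space s2 by (rule s2)
  let ?vs = "map2 (\<lambda>p x. s1 (c p x) (g x)) ps xs"
  have "f (us @ s1 (c p x) (g x) # ?vs) = s2 (c p x) (f (us @ g x # ?vs))"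
    using Cons.prems Cons.hyps by (intro linear_scale_fun[OF multilinear_map_slot[OF f]]) simp
  also have "f (us @ g x # ?vs) =
      s2 (\<Prod>i<length ps. c (ps ! i) (xs ! i)) (f (us @ g x # map g xs))"
    using Cons.IH[of "us @ [g x]"] Cons.prems by simp
  finally show ?case
    by (simp add: prod.lessThan_Suc_shift del: prod.lessThan_Suc)
qed

lemmas multilinear_map_scale = multilinear_map_scale_prefix[where us = "[]", simplified]

text \<open>\<open>graft_node\<close> is the multilinear extension of grafting, so expanding a
  multilinear operation at the root gives the same sum.\<close>

lemma lin_eval_graft_node:
  assumes s: "vector_space s" and f: "multilinear_map s s (length ps) (f v)"
  shows "lin_eval s (tree_eval f \<rho>) (graft_node v ps) = f v (map (lin_eval s (tree_eval f \<rho>)) ps)"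
proof -
  interpret vector_space s by (rule s)
  have "f v (map (lin_eval s (tree_eval f \<rho>)) ps) = (\<Sum>ts\<in>listset (map Poly_Mapping.keys ps).
      f v (map2 (\<lambda>p t. s (Poly_Mapping.lookup p t) (tree_eval f \<rho> t)) ps ts))"
    unfolding lin_eval_def by (rule multilinear_map_sum[OF f]) simp
  also have "\<dots> = (\<Sum>ts\<in>listset (map Poly_Mapping.keys ps).
      s (\<Prod>i<length ps. Poly_Mapping.lookup (ps ! i) (ts ! i)) (f v (map (tree_eval f \<rho>) ts)))"
    by (intro sum.cong refl multilinear_map_scale[OF f s])
      (auto simp: mem_listset_iff dest: list_all2_lengthD)
  finally show ?thesis
    unfolding graft_node_def lin_eval_sum by simp
qed

lemma keys_graft_node:
  assumes "t \<in> Poly_Mapping.keys (graft_node v ps)"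
  obtains ts where "t = Node v ts" "list_all2 (\<lambda>t p. t \<in> Poly_Mapping.keys p) ts ps"
proof -
  have "(\<Sum>ts \<in> listset (map Poly_Mapping.keys ps). Poly_Mapping.lookup
     (Poly_Mapping.single (Node v ts) (\<Prod>i<length ps. Poly_Mapping.lookup (ps ! i) (ts ! i))) t) \<noteq> 0"
    using assms by (simp add: graft_node_def in_keys_iff lookup_sum)
  then obtain ts where "ts \<in> listset (map Poly_Mapping.keys ps)"
    and "Poly_Mapping.lookup (Poly_Mapping.single (Node v ts)
      (\<Prod>i<length ps. Poly_Mapping.lookup (ps ! i) (ts ! i))) t \<noteq> 0"
    by (rule sum.not_neutral_contains_not_neutral)
  then show ?thesis
    using that by (auto simp: mem_listset_iff list_all2_map2 lookup_single when_def split: if_splits)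
qed

section \<open>Selecting entries of a tuple\<close>

text \<open>The point is that the slot m does not depend on z: linearity in slot m of the selected
  tuple becomes linearity in entry i of the whole tuple.\<close>

lemma nths_list_update_mem:
  "i < length xs \<Longrightarrow> i \<in> A \<Longrightarrow>
    \<exists>m<length (nths xs A). \<forall>z. nths (xs[i := z]) A = (nths xs A)[m := z]"
proof (induction xs arbitrary: i A)
  case (Cons x xs)
  show ?case
  proof (cases i)
    case 0
    then show ?thesis
      using Cons.prems by (intro exI[of _ 0]) (auto simp: nths_Cons)
  next
    case (Suc j)
    then obtain m where "m < length (nths xs {j. Suc j \<in> A})"
      "\<forall>z. nths (xs[j := z]) {j. Suc j \<in> A} = (nths xs {j. Suc j \<in> A})[m := z]"
      using Cons.IH[of j "{j. Suc j \<in> A}"] Cons.prems by auto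
    then show ?thesis
      using Suc by (intro exI[of _ "if 0 \<in> A then Suc m else m"]) (auto simp: nths_Cons)
  qed
qed simp

lemma nths_list_update_notin: "i \<notin> A \<Longrightarrow> nths (xs[i := z]) A = nths xs A"
proof (induction xs arbitrary: i A)
  case (Cons x xs)
  then show ?case
    by (cases i) (auto simp: nths_Cons)
qed simp

lemma entries_at_map: "entries_at I (map f xs) = map f (entries_at I xs)"
  by (simp add: entries_at_def nths_map)

lemma entries_off_map: "entries_off I (map f xs) = map f (entries_off I xs)"
  by (simp add: entries_off_def nths_map)

lemma length_entries_at:
  assumes "I \<subseteq> {1..length xs}"
  shows "length (entries_at I xs) = card I"
proof -
  have "bij_betw Suc {k. k < length xs \<and> Suc k \<in> I} I"
    using assms by (intro bij_betw_byWitness[where f' = "\<lambda>i. i - 1"]) (auto simp: subset_iff)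
  then have "card {k. k < length xs \<and> Suc k \<in> I} = card I"
    by (rule bij_betw_same_card)
  then show ?thesis
    by (simp add: entries_at_def length_nths)
qed

lemma length_entries_off:
  assumes "I \<subseteq> {1..length xs}"
  shows "length (entries_off I xs) = length xs - card I"
proof -
  have fin: "finite {k. k < length xs \<and> Suc k \<in> I}"
    by simp
  have "{k. k < length xs \<and> Suc k \<notin> I} = {..<length xs} - {k. k < length xs \<and> Suc k \<in> I}"
    by auto
  then have "card {k. k < length xs \<and> Suc k \<notin> I} =
      length xs - card {k. k < length xs \<and> Suc k \<in> I}"
    using fin by (simp add: card_Diff_subset subset_iff)
  also have "card {k. k < length xs \<and> Suc k \<in> I} = card I"
    using length_entries_at[OF assms] by (simp add: entries_at_def length_nths)
  finally show ?thesis
    by (simp add: entries_off_def length_nths)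
qed

lemma set_entries_at: "set (entries_at I xs) = {xs ! i | i. i < length xs \<and> Suc i \<in> I}"
  by (auto simp: entries_at_def set_nths)

lemma distinct_concat_nths: "distinct (concat xss) \<Longrightarrow> distinct (concat (nths xss A))"
proof (induction xss arbitrary: A)
  case (Cons xs xss)
  have "set (nths xss B) \<subseteq> set xss" for B
    by (rule set_nths_subset)
  then have "set xs \<inter> (\<Union> (set ` set (nths xss B))) = {}" for B
    using Cons.prems by fastforce
  then show ?case
    using Cons.IH Cons.prems by (simp add: nths_Cons)
qed simp

text \<open>A set that meets every subtree amounts to an independent choice of a nonempty set of
  labels in each subtree; the inverse takes unions, since the label sets are disjoint.\<close>

lemma bij_betw_child_subsets:
  assumes "distinct (concat (map leaves ts))"
  shows "bij_betw (\<lambda>J. map (\<lambda>t. J \<inter> Lin t) ts)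
    {J. J \<subseteq> (\<Union>t\<in>set ts. Lin t) \<inter> K \<and> (\<forall>t\<in>set ts. J \<inter> Lin t \<noteq> {})}
    (listset (map (\<lambda>t. {J. J \<subseteq> Lin t \<inter> K \<and> J \<noteq> {}}) ts))"
    (is "bij_betw ?f ?D (listset (map ?S ts))")
proof (rule bij_betw_byWitness[where f' = "\<lambda>Js. \<Union> (set Js)"])
  have iff: "Js \<in> listset (map ?S ts) \<longleftrightarrow>
      length Js = length ts \<and> (\<forall>i<length ts. Js ! i \<in> ?S (ts ! i))" for Js
    unfolding mem_listset_iff list_all2_map2 by (auto simp: list_all2_conv_all_nth)
  have Js: "length Js = length ts" "\<And>i. i < length ts \<Longrightarrow> Js ! i \<subseteq> Lin (ts ! i) \<inter> K \<and> Js ! i \<noteq> {}"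
    if "Js \<in> listset (map ?S ts)" for Js
    using that unfolding iff by simp_all
  have restrict: "\<Union> (set Js) \<inter> Lin (ts ! i) = Js ! i"
    if "Js \<in> listset (map ?S ts)" "i < length ts" for Js i
  proof -
    \<comment> \<open>The root decoration is immaterial for disjointness of the children, hence
      \<open>undefined\<close>.\<close>
    have "Js ! j \<inter> Lin (ts ! i) = {}" if "j < length ts" "j \<noteq> i" for j
      using disjoint_Lin_children[of undefined ts j i] assms Js(2)[OF \<open>Js \<in> _\<close> that(1)] that
        \<open>i < length ts\<close> by auto
    then show ?thesis
      using Js[OF that(1)] that(2) by (fastforce simp: in_set_conv_nth)
  qed
  show "\<forall>J\<in>?D. \<Union> (set (?f J)) = J"
    by auto
  show "\<forall>Js\<in>listset (map ?S ts). ?f (\<Union> (set Js)) = Js"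
    using restrict Js(1) by (auto intro!: nth_equalityI)
  show "?f ` ?D \<subseteq> listset (map ?S ts)"
    by (auto simp: mem_listset_iff list_all2_conv_all_nth)
  show "(\<lambda>Js. \<Union> (set Js)) ` listset (map ?S ts) \<subseteq> ?D"
  proof safe
    fix Js J x assume *: "Js \<in> listset (map ?S ts)" "J \<in> set Js" "x \<in> J"
    then show "x \<in> (\<Union>t\<in>set ts. Lin t)" "x \<in> K"
      using Js[OF *(1)] by (fastforce simp: in_set_conv_nth)+
  next
    fix Js t assume *: "Js \<in> listset (map ?S ts)" "t \<in> set ts" "\<Union> (set Js) \<inter> Lin t = {}"
    then obtain i where "i < length ts" "t = ts ! i"
      by (auto simp: in_set_conv_nth)
    then show False
      using restrict[OF *(1)] Js(2)[OF *(1)] *(3) by auto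
  qed
qed

text \<open>Brings the sets J with prescribed hit set I into the form parametrized by
  \<open>bij_betw_child_subsets\<close>, applied to the children at the inputs in I.\<close>

lemma hit_inputs_eq_iff:
  assumes distinct: "distinct (concat (map leaves ts))" and I: "I \<subseteq> {1..length ts}"
  shows "{J. J \<subseteq> Lin (Node w ts) \<inter> K \<and> hit_inputs J ts = I} =
    {J. J \<subseteq> (\<Union>t\<in>set (entries_at I ts). Lin t) \<inter> K \<and> (\<forall>t\<in>set (entries_at I ts). J \<inter> Lin t \<noteq> {})}"
proof -
  have mem: "Suc i \<in> hit_inputs J ts \<longleftrightarrow> J \<inter> Lin (ts ! i) \<noteq> {}" if "i < length ts" for i J
    using that by (simp add: hit_inputs_def)
  show ?thesis
  proof (intro set_eqI iffI CollectI; elim CollectE conjE; intro conjI)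
    fix J assume J: "J \<subseteq> Lin (Node w ts) \<inter> K" and hit: "hit_inputs J ts = I"
    show "J \<subseteq> (\<Union>t\<in>set (entries_at I ts). Lin t) \<inter> K"
    proof
      fix x assume x: "x \<in> J"
      then obtain t where "t \<in> set ts" "x \<in> Lin t"
        using J by auto
      then obtain i where i: "i < length ts" "x \<in> Lin (ts ! i)"
        by (metis in_set_conv_nth)
      then have "Suc i \<in> I"
        using mem[OF i(1), of J] x hit by auto
      then show "x \<in> (\<Union>t\<in>set (entries_at I ts). Lin t) \<inter> K"
        using i J x by (auto simp: set_entries_at)
    qed
    show "\<forall>t\<in>set (entries_at I ts). J \<inter> Lin t \<noteq> {}"
      using mem[of _ J] hit by (auto simp: set_entries_at)
  next
    fix J assume J: "J \<subseteq> (\<Union>t\<in>set (entries_at I ts). Lin t) \<inter> K"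
      and ne: "\<forall>t\<in>set (entries_at I ts). J \<inter> Lin t \<noteq> {}"
    show "J \<subseteq> Lin (Node w ts) \<inter> K"
      using J by (force simp: set_entries_at)
    have "Suc i \<in> hit_inputs J ts \<longleftrightarrow> Suc i \<in> I" if i: "i < length ts" for i
    proof
      assume "Suc i \<in> hit_inputs J ts"
      then obtain x where x: "x \<in> J" "x \<in> Lin (ts ! i)"
        using mem[OF i] by auto
      then obtain k where k: "k < length ts" "Suc k \<in> I" "x \<in> Lin (ts ! k)"
        using J by (auto simp: set_entries_at)
      then have "i = k"
        using disjoint_Lin_children[of w ts i k] distinct i x by auto
      then show "Suc i \<in> I"
        using k by simp
    next
      assume "Suc i \<in> I"
      then show "Suc i \<in> hit_inputs J ts"
        using ne mem[OF i] i by (auto simp: set_entries_at)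
    qed
    then have "x \<in> hit_inputs J ts \<longleftrightarrow> x \<in> I" if "x \<in> {1..length ts}" for x
      using that by (cases x) auto
    moreover have "hit_inputs J ts \<subseteq> {1..length ts}"
      by (auto simp: hit_inputs_def)
    ultimately show "hit_inputs J ts = I"
      using I by blast
  qed
qed

section \<open>Configurations\<close>

text \<open>The closure condition of a configuration for one tree, with J given as a set of leaf
  labels instead of positions.\<close>

definition admissible :: "(nat \<Rightarrow> nat set set) \<Rightarrow> nat set \<Rightarrow> 'o tree \<Rightarrow> bool" where
  "admissible C J t \<longleftrightarrow> (\<forall>w ts. Node w ts \<in> subtrees t \<longrightarrow> hit_inputs J ts \<noteq> {} \<longrightarrow>
    hit_inputs J ts \<in> C (length ts))"

lemma Lin_subtrees: "s \<in> subtrees t \<Longrightarrow> Lin s \<subseteq> Lin t"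
  by (induction t) auto

text \<open>Vertices of \<open>t\<close> see only labels of \<open>t\<close>, so intersecting J with
  these labels leaves their hit sets unchanged.\<close>

lemma admissible_child:
  assumes "admissible C J (Node w ts)" "t \<in> set ts"
  shows "admissible C (J \<inter> Lin t) t"
  unfolding admissible_def
proof (intro allI impI)
  fix w' ts' assume sub: "Node w' ts' \<in> subtrees t" and ne: "hit_inputs (J \<inter> Lin t) ts' \<noteq> {}"
  have "Lin u \<subseteq> Lin t" if "u \<in> set ts'" for u
    using Lin_subtrees[OF sub] that by auto
  then have *: "J \<inter> Lin t \<inter> Lin u = J \<inter> Lin u" if "u \<in> set ts'" for u
    using that by blast
  have "J \<inter> Lin t \<inter> Lin (ts' ! (i - 1)) = J \<inter> Lin (ts' ! (i - 1))" if "i \<in> {1..length ts'}" for i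
    using that by (intro * nth_mem) auto
  then have "hit_inputs (J \<inter> Lin t) ts' = hit_inputs J ts'"
    unfolding hit_inputs_def by (intro Collect_cong conj_cong refl) simp
  then show "hit_inputs (J \<inter> Lin t) ts' \<in> C (length ts')"
    using assms sub ne by (auto simp: admissible_def)
qed

lemma hit_inputs_nonempty:
  assumes "J \<subseteq> Lin (Node w ts)" "J \<noteq> {}"
  shows "hit_inputs J ts \<noteq> {}"
proof -
  obtain x where "x \<in> J"
    using assms(2) by blast
  moreover from this obtain t where "t \<in> set ts" "x \<in> Lin t"
    using assms(1) by auto
  ultimately obtain i where "i < length ts" "x \<in> J \<inter> Lin (ts ! i)"
    by (metis IntI in_set_conv_nth)
  then have "Suc i \<in> hit_inputs J ts"
    by (auto simp: hit_inputs_def)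
  then show ?thesis by blast
qed

lemma leaves_map_tree: "leaves (map_tree f t) = leaves t"
  by (induction t) (auto simp: comp_def cong: map_cong)

lemma reduced_map_tree: "reduced (map_tree f t) \<longleftrightarrow> reduced t"
  by (induction t) auto

lemma subtrees_map_tree: "subtrees (map_tree f t) = map_tree f ` subtrees t"
  by (induction t) auto

lemma hit_inputs_map_tree: "hit_inputs J (map (map_tree f) ts) = hit_inputs J ts"
  by (auto simp: hit_inputs_def leaves_map_tree)

text \<open>J is a set of ranks, but the configuration axiom speaks of positions. The map \<sigma>
  from the position of a leaf to the rank of its label is a permutation; by symmetry the preimage of
  J under \<sigma> again belongs to C, and the axiom applies to this set of positions.\<close>

lemma admissible_rank:
  assumes C: "configuration C" "symmetric_config C" and t: "labeled_tree t"
    and J: "J \<in> C (card (Lin t))"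
  shows "admissible C {x \<in> Lin t. label_rank (Lin t) x \<in> J} t"
proof -
  let ?n = "card (Lin t)" and ?p = "\<lambda>j. leaves t ! (j - 1)" and ?rank = "label_rank (Lin t)"
  have n: "length (leaves t) = ?n"
    using t by (simp add: labeled_tree_def distinct_card)
  have p: "bij_betw ?p {1..?n} (Lin t)"
  proof -
    have "bij_betw (\<lambda>j. j - 1) {1..?n} {..<?n}"
      by (rule bij_betw_byWitness[where f' = Suc]) auto
    moreover have "bij_betw ((!) (leaves t)) {..<?n} (Lin t)"
      using bij_betw_nth[of "leaves t"] t n by (simp add: labeled_tree_def)
    ultimately show ?thesis
      using bij_betw_trans by (fastforce simp: comp_def)
  qed
  define \<sigma> where "\<sigma> j = (if j \<in> {1..?n} then ?rank (?p j) else j)" for j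
  have "bij_betw \<sigma> {1..?n} {1..?n}"
  proof (subst bij_betw_cong)
    show "bij_betw (?rank \<circ> ?p) {1..?n} {1..?n}"
      by (rule bij_betw_trans[OF p bij_betw_label_rank]) simp
  qed (simp add: \<sigma>_def)
  then have \<sigma>: "\<sigma> permutes {1..?n}"
    by (rule bij_imp_permutes) (auto simp: \<sigma>_def)
  define J' where "J' = inv \<sigma> ` J"
  have J': "J' \<in> C ?n"
    unfolding J'_def using C(2) permutes_inv[OF \<sigma>] J by (auto simp: symmetric_config_def)
  have sub: "J \<subseteq> {1..?n}"
    using C(1) J by (auto simp: configuration_def power_config_def)
  have mem: "j \<in> J' \<longleftrightarrow> \<sigma> j \<in> J" for j
    unfolding J'_def by (metis (no_types, lifting) \<sigma> image_iff permutes_inverses)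
  have J'_sub: "J' \<subseteq> {1..?n}"
    using sub mem permutes_in_image[OF \<sigma>] by blast
  have "?p ` J' = {x \<in> Lin t. ?rank x \<in> J}"
  proof (intro set_eqI iffI)
    fix x assume "x \<in> ?p ` J'"
    then obtain j where "j \<in> J'" "x = ?p j" by auto
    moreover from this have "j \<in> {1..?n}"
      using J'_sub by auto
    ultimately show "x \<in> {x \<in> Lin t. ?rank x \<in> J}"
      using bij_betwE[OF p] mem[of j] by (auto simp: \<sigma>_def)
  next
    fix x assume x: "x \<in> {x \<in> Lin t. ?rank x \<in> J}"
    then have "x \<in> ?p ` {1..?n}"
      using p by (simp add: bij_betw_def)
    then obtain j where "j \<in> {1..?n}" "x = ?p j"
      by blast
    then show "x \<in> ?p ` J'"
      using x mem[of j] by (auto simp: \<sigma>_def)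
  qed
  moreover have "admissible C (?p ` J') t"
    unfolding admissible_def
  proof (intro allI impI)
    fix w ts assume sub: "Node w ts \<in> subtrees t" and ne: "hit_inputs (?p ` J') ts \<noteq> {}"
    \<comment> \<open>\<open>configuration\<close> is stated for trees decorated by
      \<open>unit\<close>, so the decorations are erased; leaves and hit sets are
      unaffected.\<close>
    let ?u = "map_tree (\<lambda>_. ()) :: _ \<Rightarrow> unit tree"
    have "labeled_tree (?u t)"
      using t by (simp add: labeled_tree_def leaves_map_tree reduced_map_tree)
    moreover have "Node () (map ?u ts) \<in> subtrees (?u t)"
      using sub unfolding subtrees_map_tree by force
    moreover have "J' \<in> C (length (leaves (?u t)))"
      using J' n by (simp add: leaves_map_tree)
    ultimately have "hit_inputs ((\<lambda>j. leaves (?u t) ! (j - 1)) ` J') (map ?u ts) \<in> C (length (map ?u ts))"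
      if "hit_inputs ((\<lambda>j. leaves (?u t) ! (j - 1)) ` J') (map ?u ts) \<noteq> {}"
      using C(1) that unfolding configuration_def Let_def by blast
    then show "hit_inputs (?p ` J') ts \<in> C (length ts)"
      using ne by (simp add: leaves_map_tree hit_inputs_map_tree)
  qed
  ultimately show ?thesis by simp
qed

text \<open>Splitting changes decorations only. The new second components lie in C: by admissibility
  if J is nonempty, and because the sum ranges over C if J is empty.\<close>

lemma keys_csp_tree:
  assumes "t' \<in> Poly_Mapping.keys (csp_tree C J t :: _ \<Rightarrow>\<^sub>0 'k::field)"
    and "decorated_by V t" "admissible C J t" "J \<subseteq> Lin t"
  shows "leaves t' = leaves t \<and> (reduced t \<longrightarrow> reduced t') \<and> decorated_by (csp_basis C V) t'"
  using assms
proof (induction t arbitrary: J t')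
  case (Node \<omega> ts)
  let ?Is = "if J = {} then C (length ts) else {hit_inputs J ts}"
  let ?q = "\<lambda>t. csp_tree C (J \<inter> Lin t) t :: _ \<Rightarrow>\<^sub>0 'k"
  have "(\<Sum>I\<in>?Is. Poly_Mapping.lookup (graft_node (\<omega>, I) (map ?q ts)) t') \<noteq> 0"
    using Node.prems(1) by (simp add: in_keys_iff lookup_sum split: if_splits)
  then obtain I where I: "I \<in> ?Is" "t' \<in> Poly_Mapping.keys (graft_node (\<omega>, I) (map ?q ts))"
    unfolding in_keys_iff by (rule sum.not_neutral_contains_not_neutral)
  then obtain ts' where ts': "t' = Node (\<omega>, I) ts'"
    "list_all2 (\<lambda>t p. t \<in> Poly_Mapping.keys p) ts' (map ?q ts)"
    by (elim keys_graft_node)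
  have "I \<in> C (length ts)"
  proof (cases "J = {}")
    case False
    then show ?thesis
      using I(1) Node.prems(3) hit_inputs_nonempty[OF Node.prems(4) False]
      by (auto simp: admissible_def)
  qed (use I(1) in simp)
  moreover have len: "length ts' = length ts"
    using ts'(2) by (simp add: list_all2_lengthD)
  moreover have child: "leaves (ts' ! i) = leaves (ts ! i) \<and> (reduced (ts ! i) \<longrightarrow> reduced (ts' ! i)) \<and>
      decorated_by (csp_basis C V) (ts' ! i)" if "i < length ts" for i
    using that ts'(2) Node.prems admissible_child[OF Node.prems(3)]
    by (intro Node.IH) (auto simp: list_all2_conv_all_nth)
  moreover have "map leaves ts' = map leaves ts"
    using len child by (intro nth_equalityI) auto
  moreover have "\<forall>u\<in>set ts'. decorated_by (csp_basis C V) u"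
    using child len by (auto simp: in_set_conv_nth)
  moreover have "reduced u" if red: "\<forall>t\<in>set ts. reduced t" and u: "u \<in> set ts'" for u
  proof -
    obtain i where "i < length ts" "u = ts' ! i"
      using u len by (auto simp: in_set_conv_nth)
    then show ?thesis
      using child red by simp
  qed
  ultimately show ?case
    using Node.prems(2) ts'(1) by (auto simp: csp_basis_def)
qed simp

section \<open>Modules and Rota-Baxter operators\<close>

text \<open>The term M_J of the overview. It is 0 if a hit set lies outside C, since the module then
  has no matching operation. Terms of children missed by J are formed but discarded by
  \<open>entries_at\<close>, so the leaf clause matters only when J consists of that leaf.\<close>

fun module_term ::
  "(nat \<Rightarrow> nat set set) \<Rightarrow> ('v \<Rightarrow> 'a list \<Rightarrow> 'a) \<Rightarrow> ('v \<Rightarrow> nat set \<Rightarrow> 'a list \<Rightarrow> 'u list \<Rightarrow> 'u::zero) \<Rightarrow>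
    (nat \<Rightarrow> 'a) \<Rightarrow> (nat \<Rightarrow> 'u) \<Rightarrow> nat set \<Rightarrow> 'v tree \<Rightarrow> 'u" where
  "module_term C opA l a u J (Leaf j) = u j"
| "module_term C opA l a u J (Node \<omega> ts) =
    (if hit_inputs J ts \<in> C (length ts)
     then l \<omega> (hit_inputs J ts) (entries_off (hit_inputs J ts) (map (tree_eval opA a) ts))
       (entries_at (hit_inputs J ts) (map (\<lambda>t. module_term C opA l a u (J \<inter> Lin t) t) ts))
     else 0)"

definition module_op ::
  "(nat \<Rightarrow> nat set set) \<Rightarrow> ('v \<Rightarrow> nat) \<Rightarrow> ('v \<Rightarrow> 'a list \<Rightarrow> 'a) \<Rightarrow>
    ('v \<Rightarrow> nat set \<Rightarrow> 'a list \<Rightarrow> 'u list \<Rightarrow> 'u::comm_monoid_add) \<Rightarrow> 'v \<Rightarrow> ('a \<times> 'u) list \<Rightarrow> 'a \<times> 'u" where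
  "module_op C ar opA l \<omega> zs = (opA \<omega> (map fst zs),
    \<Sum>I \<in> C (ar \<omega>). l \<omega> I (entries_off I (map fst zs)) (entries_at I (map snd zs)))"

lemma fst_module_op: "fst (module_op C ar opA l \<omega> zs) = opA \<omega> (map fst zs)"
  by (simp add: module_op_def)

lemma snd_module_op: "snd (module_op C ar opA l \<omega> zs) =
    (\<Sum>I \<in> C (ar \<omega>). l \<omega> I (entries_off I (map fst zs)) (entries_at I (map snd zs)))"
  by (simp add: module_op_def)

lemma finite_configuration: "configuration C \<Longrightarrow> finite (C n)"
  by (rule finite_subset[of _ "Pow {1..n}"]) (auto simp: configuration_def power_config_def)

lemma configuration_subset: "configuration C \<Longrightarrow> I \<in> C n \<Longrightarrow> I \<subseteq> {1..n}"
  and configuration_nonempty: "configuration C \<Longrightarrow> I \<in> C n \<Longrightarrow> I \<noteq> {}"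
  by (auto simp: configuration_def power_config_def)

locale split_module = presentation V R
  for V :: "'v basis" and R :: "('v tree \<Rightarrow>\<^sub>0 'k::field) set" +
  fixes C :: "nat \<Rightarrow> nat set set"
    and sA :: "'k \<Rightarrow> 'a::ab_group_add \<Rightarrow> 'a" and opA :: "'v \<Rightarrow> 'a list \<Rightarrow> 'a"
    and sU :: "'k \<Rightarrow> 'u::ab_group_add \<Rightarrow> 'u"
    and l :: "'v \<Rightarrow> nat set \<Rightarrow> 'a list \<Rightarrow> 'u list \<Rightarrow> 'u"
    and \<psi> :: "nat \<Rightarrow> ('v tree \<Rightarrow>\<^sub>0 'k) set set \<Rightarrow> ('a \<times> 'u) list \<Rightarrow> 'a \<times> 'u"
  assumes config: "configuration C" and sym: "symmetric_config C"
    and sA: "vector_space sA" and sU: "vector_space sU"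
    and l_left: "\<And>\<omega> I us. \<omega> \<in> gens V \<Longrightarrow> I \<in> C (arity V \<omega>) \<Longrightarrow> length us = card I \<Longrightarrow>
      multilinear_map sA sU (arity V \<omega> - card I) (\<lambda>xs. l \<omega> I xs us)"
    and l_right: "\<And>\<omega> I xs. \<omega> \<in> gens V \<Longrightarrow> I \<in> C (arity V \<omega>) \<Longrightarrow>
      length xs = arity V \<omega> - card I \<Longrightarrow> multilinear_map sU sU (card I) (l \<omega> I xs)"
    and module: "presented_algebra V R (module_prod.scale sA sU) \<psi> (module_op C (arity V) opA l)"
begin

sublocale A: vector_space sA by (rule sA)
sublocale U: vector_space sU by (rule sU)
sublocale AU: vector_space_prod sA sU ..

abbreviation mterm where
  "mterm \<equiv> module_term C opA l"

abbreviation mop where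
  "mop \<equiv> module_op C (arity V) opA l"

lemma fst_tree_eval: "fst (tree_eval mop \<rho> t) = tree_eval opA (\<lambda>j. fst (\<rho> j)) t"
proof (induction t)
  case (Node \<omega> ts)
  then have "map fst (map (tree_eval mop \<rho>) ts) = map (tree_eval opA (\<lambda>j. fst (\<rho> j))) ts"
    by simp
  then show ?case
    by (simp only: tree_eval.simps fst_module_op)
qed simp

text \<open>At the root, multilinearity of each l_I distributes over the sums belonging to the
  children in I. A choice of one nonempty label set per such child is the same as a set J with hit
  set I. The set K allows components in U to be switched off.\<close>

lemma snd_tree_eval:
  assumes "decorated_by V t" "distinct (leaves t)"
  shows "snd (tree_eval mop (\<lambda>j. (a j, if j \<in> K then u j else 0)) t) =
    (\<Sum>J | J \<subseteq> Lin t \<inter> K \<and> J \<noteq> {}. mterm a u J t)"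
  using assms
proof (induction t)
  case (Leaf j)
  have "{J. J \<subseteq> Lin (Leaf j :: 'v tree) \<inter> K \<and> J \<noteq> {}} = (if j \<in> K then {{j}} else {})"
    by (auto simp: subset_singleton_iff)
  then show ?case
    by simp
next
  case (Node \<omega> ts)
  let ?ev = "tree_eval mop (\<lambda>j. (a j, if j \<in> K then u j else 0))"
  let ?S = "\<lambda>t :: 'v tree. {J. J \<subseteq> Lin t \<inter> K \<and> J \<noteq> {}}"
  let ?D = "\<lambda>I. {J. J \<subseteq> Lin (Node \<omega> ts) \<inter> K \<and> hit_inputs J ts = I}"
  let ?off = "\<lambda>I. entries_off I (map (tree_eval opA a) ts)"
  have \<omega>: "\<omega> \<in> gens V" "arity V \<omega> = length ts"
    using Node.prems by auto
  have distinct: "distinct (concat (map leaves ts))"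
    using Node.prems by simp
  have fst: "map fst (map ?ev ts) = map (tree_eval opA a) ts"
    by (simp add: fst_tree_eval comp_def)
  have "snd (?ev t) = (\<Sum>J\<in>?S t. mterm a u J t)" if "t \<in> set ts" for t
    using Node.prems that distinct_leaves_child[OF Node.prems(2) that] by (intro Node.IH) auto
  then have snd: "map snd (map ?ev ts) = map (\<lambda>t. \<Sum>J\<in>?S t. mterm a u J t) ts"
    by simp
  have summand: "l \<omega> I (?off I) (entries_at I (map (\<lambda>t. \<Sum>J\<in>?S t. mterm a u J t) ts)) =
      (\<Sum>J\<in>?D I. mterm a u J (Node \<omega> ts))" if I: "I \<in> C (length ts)" for I
  proof -
    let ?ps = "entries_at I ts"
    have sub: "I \<subseteq> {1..length ts}"
      by (rule configuration_subset[OF config I])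
    have lin: "multilinear_map sU sU (card I) (l \<omega> I (?off I))"
      using \<omega> I sub by (intro l_right) (simp_all add: length_entries_off)
    have ps: "distinct (concat (map leaves ?ps))"
      using distinct_concat_nths[OF distinct] by (simp add: entries_at_def nths_map)
    have "l \<omega> I (?off I) (entries_at I (map (\<lambda>t. \<Sum>J\<in>?S t. mterm a u J t) ts)) =
        (\<Sum>Js\<in>listset (map ?S ?ps). l \<omega> I (?off I) (map2 (\<lambda>t J. mterm a u J t) ?ps Js))"
      unfolding entries_at_map
      by (rule multilinear_map_sum[OF lin]) (simp add: length_entries_at[OF sub])
    also have "\<dots> = (\<Sum>J\<in>?D I. l \<omega> I (?off I)
        (map2 (\<lambda>t J. mterm a u J t) ?ps (map (\<lambda>t. J \<inter> Lin t) ?ps)))"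
      unfolding hit_inputs_eq_iff[OF distinct sub]
      by (rule sum.reindex_bij_betw[symmetric, OF bij_betw_child_subsets[OF ps]])
    also have "\<dots> = (\<Sum>J\<in>?D I. mterm a u J (Node \<omega> ts))"
    proof (rule sum.cong[OF refl])
      fix J assume "J \<in> ?D I"
      then have hit: "hit_inputs J ts = I" by simp
      have "map2 (\<lambda>t J. mterm a u J t) ?ps (map (\<lambda>t. J \<inter> Lin t) ?ps) =
          map (\<lambda>t. mterm a u (J \<inter> Lin t) t) ?ps"
        by (simp add: map2_map_map[where f = id, simplified])
      then show "l \<omega> I (?off I) (map2 (\<lambda>t J. mterm a u J t) ?ps (map (\<lambda>t. J \<inter> Lin t) ?ps)) =
          mterm a u J (Node \<omega> ts)"
        using I by (simp add: hit entries_at_map)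
    qed
    finally show ?thesis .
  qed
  have "snd (?ev (Node \<omega> ts)) = (\<Sum>I\<in>C (length ts). l \<omega> I (?off I)
      (entries_at I (map (\<lambda>t. \<Sum>J\<in>?S t. mterm a u J t) ts)))"
    unfolding tree_eval.simps snd_module_op fst snd \<omega>(2) ..
  also have "\<dots> = (\<Sum>I\<in>C (length ts). \<Sum>J\<in>?D I. mterm a u J (Node \<omega> ts))"
    by (intro sum.cong refl summand)
  \<comment> \<open>The families \<open>?D I\<close> are disjoint, because J determines its hit
    set.\<close>
  also have "\<dots> = (\<Sum>J\<in>(\<Union>I\<in>C (length ts). ?D I). mterm a u J (Node \<omega> ts))"
    by (rule sum.UNION_disjoint[symmetric]) (auto intro: finite_configuration[OF config])
  \<comment> \<open>The additional sets J have a hit set outside C and contribute 0 by the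
    definition of \<open>module_term\<close>. No empty J occurs on the left, as members of C are
    nonempty.\<close>
  also have "\<dots> = (\<Sum>J\<in>?S (Node \<omega> ts). mterm a u J (Node \<omega> ts))"
  proof (rule sum.mono_neutral_left)
    show "finite (?S (Node \<omega> ts))"
      by simp
    show "(\<Union>I\<in>C (length ts). ?D I) \<subseteq> ?S (Node \<omega> ts)"
      using configuration_nonempty[OF config] by (fastforce simp: hit_inputs_def)
    show "\<forall>J\<in>?S (Node \<omega> ts) - (\<Union>I\<in>C (length ts). ?D I). mterm a u J (Node \<omega> ts) = 0"
      by auto
  qed
  finally show ?case .
qed

lemma snd_lin_eval:
  "snd (lin_eval AU.scale g r) = lin_eval sU (\<lambda>t. snd (g t)) r"
  by (rule linear_lin_eval[OF AU.linear_snd])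

text \<open>Switching off the \<open>U\<close>-components outside \<open>J\<close> yields the sum of the terms
  belonging to nonempty subsets of \<open>J\<close>; induction on \<open>J\<close> isolates the top term. This works over
  every field, where a substitution of scalar multiples would need enough scalars.\<close>

lemma lin_eval_module_term_eq_0:
  assumes r: "\<And>t. t \<in> Poly_Mapping.keys r \<Longrightarrow> decorated_by V t \<and> distinct (leaves t) \<and> J \<subseteq> Lin t"
    and vanish: "\<And>\<rho>. lin_eval AU.scale (tree_eval mop \<rho>) r = 0"
    and J: "finite J" "J \<noteq> {}"
  shows "lin_eval sU (mterm a u J) r = 0"
  using J r
proof (induction J rule: finite_psubset_induct)
  case (psubset J)
  let ?S = "{J'. J' \<subseteq> J \<and> J' \<noteq> {}}"
  have fin: "finite ?S"
    using psubset.hyps by simp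
  have "0 = snd (lin_eval AU.scale (tree_eval mop (\<lambda>j. (a j, if j \<in> J then u j else 0))) r)"
    unfolding vanish by simp
  also have "\<dots> = lin_eval sU (\<lambda>t. \<Sum>J'\<in>?S. mterm a u J' t) r"
    unfolding snd_lin_eval
  proof (rule U.lin_eval_cong)
    fix t assume "t \<in> Poly_Mapping.keys r"
    with psubset.prems(2) have t: "decorated_by V t" "distinct (leaves t)" "Lin t \<inter> J = J"
      by auto
    show "snd (tree_eval mop (\<lambda>j. (a j, if j \<in> J then u j else 0)) t) = (\<Sum>J'\<in>?S. mterm a u J' t)"
      unfolding snd_tree_eval[OF t(1,2)] t(3) ..
  qed
  also have "\<dots> = (\<Sum>J'\<in>?S. lin_eval sU (mterm a u J') r)"
    by (rule U.lin_eval_sum_fun)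
  also have "\<dots> = lin_eval sU (mterm a u J) r + (\<Sum>J'\<in>?S - {J}. lin_eval sU (mterm a u J') r)"
    using psubset.prems(1) fin by (intro sum.remove) auto
  also have "(\<Sum>J'\<in>?S - {J}. lin_eval sU (mterm a u J') r) = 0"
  proof (rule sum.neutral, rule ballI)
    fix J' assume "J' \<in> ?S - {J}"
    then have "J' \<subset> J" "J' \<noteq> {}"
      by auto
    then show "lin_eval sU (mterm a u J') r = 0"
      using psubset.prems(2) by (intro psubset.IH) auto
  qed
  finally show ?case by simp
qed

text \<open>Input i of the relabelled corolla carries the leaf \<sigma>(i), so by injectivity
  \<sigma>(I) hits exactly the inputs in I. This recovers the individual operation l_I from a term
  of a tree.\<close>

lemma module_term_corolla:
  assumes inj: "inj_on \<sigma> {1..arity V \<omega>}" and I: "I \<in> C (arity V \<omega>)"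
  shows "mterm a u (\<sigma> ` I) (relabel \<sigma> (corolla V \<omega>)) =
    l \<omega> I (entries_off I (map (\<lambda>j. a (\<sigma> j)) [1..<Suc (arity V \<omega>)]))
      (entries_at I (map (\<lambda>j. u (\<sigma> j)) [1..<Suc (arity V \<omega>)]))"
proof -
  let ?n = "arity V \<omega>"
  let ?ts = "map (\<lambda>j. Leaf (\<sigma> j)) [1..<Suc ?n] :: 'v tree list"
  have sub: "I \<subseteq> {1..?n}"
    by (rule configuration_subset[OF config I])
  have nth: "?ts ! (i - 1) = Leaf (\<sigma> i)" if "i \<in> {1..?n}" for i
    using that by (auto simp del: upt_Suc)
  have "hit_inputs (\<sigma> ` I) ?ts = {i \<in> {1..?n}. \<sigma> i \<in> \<sigma> ` I}"
    unfolding hit_inputs_def by (intro Collect_cong conj_cong)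
      (simp_all add: nth[unfolded One_nat_def] del: upt_Suc)
  also have "\<dots> = {i \<in> {1..?n}. i \<in> I}"
    by (intro Collect_cong conj_cong refl inj_on_image_mem_iff[OF inj _ sub])
  also have "\<dots> = I"
    using sub by blast
  finally have hit: "hit_inputs (\<sigma> ` I) ?ts = I" .
  have tree: "relabel \<sigma> (corolla V \<omega>) = Node \<omega> ?ts"
    by (simp add: corolla_def comp_def del: upt_Suc)
  show ?thesis
    unfolding tree module_term.simps hit using I by (simp add: comp_def del: upt_Suc)
qed

end

section \<open>The split operations obtained from a relative Rota-Baxter operator\<close>

lemma split_op_apply:
  "split_op l \<alpha> (\<omega>, I) us = l \<omega> I (entries_off I (map \<alpha> us)) (entries_at I us)"
  by (simp add: split_op_def)

locale rota_baxter_module = split_module V R C sA opA sU l \<psi>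
  for V :: "'v basis" and R :: "('v tree \<Rightarrow>\<^sub>0 'k::field) set" and C
    and sA :: "'k \<Rightarrow> 'a::ab_group_add \<Rightarrow> 'a" and opA
    and sU :: "'k \<Rightarrow> 'u::ab_group_add \<Rightarrow> 'u" and l \<psi> +
  fixes \<alpha> :: "'u \<Rightarrow> 'a"
  assumes \<alpha>: "Vector_Spaces.linear sU sA \<alpha>"
    and rota_baxter: "\<And>\<omega> us. \<omega> \<in> gens V \<Longrightarrow> length us = arity V \<omega> \<Longrightarrow>
      opA \<omega> (map \<alpha> us) = (\<Sum>I\<in>C (arity V \<omega>). \<alpha> (split_op l \<alpha> (\<omega>, I) us))"
begin

definition star_op where
  "star_op \<omega> us = (\<Sum>I\<in>C (arity V \<omega>). split_op l \<alpha> (\<omega>, I) us)"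

lemma rota_baxter_star:
  "\<omega> \<in> gens V \<Longrightarrow> length us = arity V \<omega> \<Longrightarrow> opA \<omega> (map \<alpha> us) = \<alpha> (star_op \<omega> us)"
  unfolding rota_baxter star_op_def by (rule linear_sum_fun[OF \<alpha>, symmetric])

text \<open>Each entry of the tuple is used once: as an argument in U if its index is in I, and
  otherwise through \<alpha> as an argument in A. Indices in I start at 1, list positions at 0,
  hence the distinction by \<open>Suc i\<close>.\<close>

lemma multilinear_split_op:
  assumes \<omega>: "\<omega> \<in> gens V" and I: "I \<in> C (arity V \<omega>)"
  shows "multilinear_map sU sU (arity V \<omega>) (split_op l \<alpha> (\<omega>, I))"
  unfolding multilinear_map_def
proof (intro ballI allI impI)
  let ?n = "arity V \<omega>"
  fix us :: "'u list" and i assume "us \<in> tuples ?n" and i: "i < ?n"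
  then have us: "length us = ?n"
    by (simp add: tuples_def)
  have sub: "I \<subseteq> {1..?n}"
    by (rule configuration_subset[OF config I])
  show "Vector_Spaces.linear sU sU (\<lambda>z. split_op l \<alpha> (\<omega>, I) (us[i := z]))"
  proof (cases "Suc i \<in> I")
    case True
    then obtain m where m: "m < length (entries_at I us)"
      "\<And>z. entries_at I (us[i := z]) = (entries_at I us)[m := z]"
      using nths_list_update_mem[of i us "{k. Suc k \<in> I}"] i us by (auto simp: entries_at_def)
    have off: "entries_off I (map \<alpha> (us[i := z])) = entries_off I (map \<alpha> us)" for z
      using True unfolding entries_off_def map_update by (intro nths_list_update_notin) simp
    have "multilinear_map sU sU (card I) (l \<omega> I (entries_off I (map \<alpha> us)))"
      using sub us by (intro l_right[OF \<omega> I]) (simp add: length_entries_off)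
    from multilinear_map_update[OF this, of "entries_at I us" m] show ?thesis
      using m sub us by (simp add: split_op_def off length_entries_at)
  next
    case False
    then obtain m where m: "m < length (entries_off I (map \<alpha> us))"
      "\<And>z. entries_off I ((map \<alpha> us)[i := z]) = (entries_off I (map \<alpha> us))[m := z]"
      using nths_list_update_mem[of i "map \<alpha> us" "{k. Suc k \<notin> I}"] i us
      by (auto simp: entries_off_def)
    have at: "entries_at I (us[i := z]) = entries_at I us" for z
      using False unfolding entries_at_def by (intro nths_list_update_notin) simp
    have "multilinear_map sA sU (?n - card I) (\<lambda>xs. l \<omega> I xs (entries_at I us))"
      using sub us by (intro l_left[OF \<omega> I]) (simp add: length_entries_at)
    from multilinear_map_update[OF this, of "entries_off I (map \<alpha> us)" m]
    have "Vector_Spaces.linear sA sU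
        (\<lambda>z. l \<omega> I ((entries_off I (map \<alpha> us))[m := z]) (entries_at I us))"
      using m(1) sub us by (simp add: length_entries_off)
    from Vector_Spaces.linear_compose[OF \<alpha> this] show ?thesis
      by (simp add: split_op_def at map_update m(2) comp_def)
  qed
qed

lemma multilinear_star_op:
  assumes \<omega>: "\<omega> \<in> gens V"
  shows "multilinear_map sU sU (arity V \<omega>) (star_op \<omega>)"
proof -
  interpret UU: vector_space_pair sU sU ..
  show ?thesis
    unfolding multilinear_map_def star_op_def
    using multilinear_split_op[OF \<omega>]
    by (auto simp: multilinear_map_def intro!: UU.linear_compose_sum)
qed

text \<open>The generator of the equivariance ideal vanishes in A \<oplus> U, so its term for J =
  \<sigma>(I) vanishes. In that term the permuted generator contributes its operation for
  \<sigma>(I), and the relabelled corolla of \<omega> its operation for I.\<close>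

lemma split_op_equivariant:
  assumes \<omega>: "\<omega> \<in> gens V" and I: "I \<in> C (arity V \<omega>)" and \<sigma>: "\<sigma> permutes {1..arity V \<omega>}"
    and us: "length us = arity V \<omega>"
  shows "split_op l \<alpha> (act V \<sigma> \<omega>, \<sigma> ` I) us =
    split_op l \<alpha> (\<omega>, I) (map (\<lambda>j. us ! (\<sigma> j - 1)) [1..<Suc (arity V \<omega>)])"
proof -
  let ?n = "arity V \<omega>"
  define u where "u j = us ! (j - 1)" for j
  let ?r = "btree (corolla V (act V \<sigma> \<omega>)) - btree (relabel \<sigma> (corolla V \<omega>)) :: _ \<Rightarrow>\<^sub>0 'k"
  have act: "act V \<sigma> \<omega> \<in> gens V" "arity V (act V \<sigma> \<omega>) = ?n"
    using basis \<omega> \<sigma> unfolding S_module_basis_def by blast+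
  have \<sigma>I: "\<sigma> ` I \<in> C ?n"
    using sym \<sigma> I by (auto simp: symmetric_config_def)
  have keys: "op_tree V ?n t" if "t \<in> Poly_Mapping.keys ?r" for t
  proof -
    have "?r \<in> equivariance V ?n"
      using \<omega> \<sigma> unfolding equivariance_def by blast
    then show ?thesis
      using equivariance_subset[OF basis, of ?n] that by (auto simp: mem_tree_operad_iff)
  qed
  have "lin_eval sU (mterm (\<lambda>j. \<alpha> (u j)) u (\<sigma> ` I)) ?r = 0"
  proof (rule lin_eval_module_term_eq_0)
    fix t assume "t \<in> Poly_Mapping.keys ?r"
    with configuration_subset[OF config \<sigma>I] keys[of t]
    show "decorated_by V t \<and> distinct (leaves t) \<and> \<sigma> ` I \<subseteq> Lin t"
      by (simp add: op_tree_def labeled_tree_def)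
  next
    fix \<rho> :: "nat \<Rightarrow> 'a \<times> 'u"
    let ?zs = "map \<rho> [1..<Suc ?n]"
    have "mop (act V \<sigma> \<omega>) ?zs = mop \<omega> (map (\<lambda>j. ?zs ! (\<sigma> j - 1)) [1..<Suc ?n])"
      by (rule presented_algebra_equivariant[OF module \<omega> \<sigma>]) (simp del: upt_Suc)
    also have "map (\<lambda>j. ?zs ! (\<sigma> j - 1)) [1..<Suc ?n] = map (\<lambda>j. \<rho> (\<sigma> j)) [1..<Suc ?n]"
    proof (intro map_cong refl)
      fix j assume "j \<in> set [1..<Suc ?n]"
      then have "\<sigma> j \<in> {1..?n}"
        using permutes_in_image[OF \<sigma>] by (simp del: upt_Suc)
      then show "?zs ! (\<sigma> j - 1) = \<rho> (\<sigma> j)"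
        by (auto simp del: upt_Suc)
    qed
    finally show "lin_eval AU.scale (tree_eval mop \<rho>) ?r = 0"
      using act
      by (simp add: AU.p.lin_eval_diff tree_eval_relabel tree_eval_corolla comp_def del: upt_Suc)
  next
    show "finite (\<sigma> ` I)" "\<sigma> ` I \<noteq> {}"
      using configuration_subset[OF config I] configuration_nonempty[OF config I]
      by (auto intro: finite_subset)
  qed
  then have "mterm (\<lambda>j. \<alpha> (u j)) u (\<sigma> ` I) (corolla V (act V \<sigma> \<omega>)) =
      mterm (\<lambda>j. \<alpha> (u j)) u (\<sigma> ` I) (relabel \<sigma> (corolla V \<omega>))"
    by (simp add: U.lin_eval_diff)
  moreover have "mterm (\<lambda>j. \<alpha> (u j)) u (\<sigma> ` I) (corolla V (act V \<sigma> \<omega>)) =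
      split_op l \<alpha> (act V \<sigma> \<omega>, \<sigma> ` I) us"
  proof -
    have "map u [1..<Suc ?n] = us"
      unfolding u_def by (rule map_nth_upt[OF us])
    moreover have "map (\<lambda>j. \<alpha> (u j)) [1..<Suc ?n] = map \<alpha> (map u [1..<Suc ?n])"
      by (simp del: upt_Suc)
    ultimately show ?thesis
      using module_term_corolla[of id "act V \<sigma> \<omega>" "\<sigma> ` I" "\<lambda>j. \<alpha> (u j)" u] \<sigma>I act
      by (simp add: split_op_def del: upt_Suc map_map)
  qed
  moreover have "mterm (\<lambda>j. \<alpha> (u j)) u (\<sigma> ` I) (relabel \<sigma> (corolla V \<omega>)) =
      split_op l \<alpha> (\<omega>, I) (map (\<lambda>j. us ! (\<sigma> j - 1)) [1..<Suc ?n])"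
    using module_term_corolla[OF permutes_inj_on[OF \<sigma>] I]
    by (simp add: split_op_def u_def comp_def del: upt_Suc)
  ultimately show ?thesis
    by simp
qed

lemma \<alpha>_tree_eval:
  "decorated_by V t \<Longrightarrow> \<alpha> (tree_eval star_op \<rho> t) = tree_eval opA (\<lambda>j. \<alpha> (\<rho> j)) t"
proof (induction t)
  case (Node \<omega> ts)
  let ?us = "map (tree_eval star_op \<rho>) ts"
  have "map \<alpha> ?us = map (tree_eval opA (\<lambda>j. \<alpha> (\<rho> j))) ts"
    using Node by simp
  moreover have "\<alpha> (star_op \<omega> ?us) = opA \<omega> (map \<alpha> ?us)"
    using Node.prems by (intro rota_baxter_star[symmetric]) auto
  ultimately show ?case
    by (simp only: tree_eval.simps)
qed simp

lemma module_op_graph: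
  "\<omega> \<in> gens V \<Longrightarrow> length us = arity V \<omega> \<Longrightarrow>
    mop \<omega> (map (\<lambda>u. (\<alpha> u, u)) us) = (\<alpha> (star_op \<omega> us), star_op \<omega> us)"
  by (simp add: rota_baxter_star[symmetric])
    (simp add: module_op_def star_op_def split_op_def comp_def)

lemma tree_eval_graph:
  "decorated_by V t \<Longrightarrow> tree_eval mop (\<lambda>j. (\<alpha> (\<rho> j), \<rho> j)) t =
    (\<alpha> (tree_eval star_op \<rho> t), tree_eval star_op \<rho> t)"
proof (induction t)
  case (Node \<omega> ts)
  let ?us = "map (tree_eval star_op \<rho>) ts"
  have "map (tree_eval mop (\<lambda>j. (\<alpha> (\<rho> j), \<rho> j))) ts = map (\<lambda>u. (\<alpha> u, u)) ?us"
    using Node by simp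
  moreover have "mop \<omega> (map (\<lambda>u. (\<alpha> u, u)) ?us) = (\<alpha> (star_op \<omega> ?us), star_op \<omega> ?us)"
    using Node.prems by (intro module_op_graph) auto
  ultimately show ?case
    by (simp only: tree_eval.simps)
qed simp

lemma star_op_relation:
  assumes r: "r \<in> R"
  shows "lin_eval sU (tree_eval star_op \<rho>) r = 0"
proof -
  have "lin_eval sU (tree_eval star_op \<rho>) r =
      lin_eval sU (\<lambda>t. snd (tree_eval mop (\<lambda>j. (\<alpha> (\<rho> j), \<rho> j)) t)) r"
    using rel[OF r] by (intro U.lin_eval_cong) (simp add: tree_relation_def tree_eval_graph)
  also have "\<dots> = 0"
    unfolding snd_lin_eval[symmetric] presented_algebra_relation[OF module r] by simp
  finally show ?thesis .
qed

text \<open>By symmetry of the configuration, taking images under \<sigma> permutes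
  \<open>C n\<close>, so the sum can be reindexed and compared term by term.\<close>

lemma star_op_equivariant:
  assumes \<omega>: "\<omega> \<in> gens V" and \<sigma>: "\<sigma> permutes {1..arity V \<omega>}" and us: "length us = arity V \<omega>"
  shows "star_op (act V \<sigma> \<omega>) us = star_op \<omega> (map (\<lambda>j. us ! (\<sigma> j - 1)) [1..<Suc (arity V \<omega>)])"
proof -
  let ?n = "arity V \<omega>"
  have arity: "arity V (act V \<sigma> \<omega>) = ?n"
    using basis \<omega> \<sigma> unfolding S_module_basis_def by blast
  have "bij_betw ((`) \<sigma>) (C ?n) (C ?n)"
  proof (rule bij_betw_byWitness[where f' = "(`) (inv \<sigma>)"])
    show "\<forall>I\<in>C ?n. inv \<sigma> ` \<sigma> ` I = I" "\<forall>I\<in>C ?n. \<sigma> ` inv \<sigma> ` I = I"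
      by (simp_all add: image_comp permutes_inv_o[OF \<sigma>])
    show "(`) \<sigma> ` C ?n \<subseteq> C ?n" "(`) (inv \<sigma>) ` C ?n \<subseteq> C ?n"
      using sym \<sigma> permutes_inv[OF \<sigma>] by (auto simp: symmetric_config_def)
  qed
  from sum.reindex_bij_betw[OF this, of "\<lambda>I. split_op l \<alpha> (act V \<sigma> \<omega>, I) us"]
  have "star_op (act V \<sigma> \<omega>) us = (\<Sum>I\<in>C ?n. split_op l \<alpha> (act V \<sigma> \<omega>, \<sigma> ` I) us)"
    using arity unfolding star_op_def by simp
  then show ?thesis
    unfolding star_op_def by (simp add: split_op_equivariant[OF \<omega> _ \<sigma> us] del: upt_Suc)
qed

text \<open>Empty and nonempty J share one induction, because a nonempty J restricts to the empty
  set on every child that it misses.\<close>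

lemma lin_eval_csp_tree:
  assumes "decorated_by V t" "admissible C J t" "J \<subseteq> Lin t"
  shows "lin_eval sU (tree_eval (split_op l \<alpha>) \<rho>) (csp_tree C J t) =
    (if J = {} then tree_eval star_op \<rho> t else mterm (\<lambda>j. \<alpha> (\<rho> j)) \<rho> J t)"
  using assms
proof (induction t arbitrary: J)
  case (Leaf j)
  then show ?case by simp
next
  case (Node \<omega> ts)
  let ?ev = "\<lambda>J t. lin_eval sU (tree_eval (split_op l \<alpha>) \<rho>) (csp_tree C J t)"
  have \<omega>: "\<omega> \<in> gens V" "arity V \<omega> = length ts"
    using Node.prems by auto
  have IH: "?ev (J \<inter> Lin t) t =
      (if J \<inter> Lin t = {} then tree_eval star_op \<rho> t else mterm (\<lambda>j. \<alpha> (\<rho> j)) \<rho> (J \<inter> Lin t) t)"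
    if "t \<in> set ts" for t
    using Node.prems admissible_child[OF Node.prems(2) that] that by (intro Node.IH) auto
  have node: "lin_eval sU (tree_eval (split_op l \<alpha>) \<rho>)
      (graft_node (\<omega>, I) (map (\<lambda>t. csp_tree C (J \<inter> Lin t) t) ts)) =
      split_op l \<alpha> (\<omega>, I) (map (\<lambda>t. ?ev (J \<inter> Lin t) t) ts)" if "I \<in> C (length ts)" for I
    using multilinear_split_op[OF \<omega>(1)] that \<omega>(2)
    by (subst lin_eval_graft_node[OF sU]) (simp_all add: comp_def)
  show ?case
  proof (cases "J = {}")
    case True
    have "map (\<lambda>t. ?ev (J \<inter> Lin t) t) ts = map (tree_eval star_op \<rho>) ts"
      using IH True by simp
    note node = node[unfolded this]
    have "?ev J (Node \<omega> ts) = (\<Sum>I\<in>C (length ts). lin_eval sU (tree_eval (split_op l \<alpha>) \<rho>)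
        (graft_node (\<omega>, I) (map (\<lambda>t. csp_tree C (J \<inter> Lin t) t) ts)))"
      using True by (simp add: U.lin_eval_sum)
    also have "\<dots> = (\<Sum>I\<in>C (length ts). split_op l \<alpha> (\<omega>, I) (map (tree_eval star_op \<rho>) ts))"
      by (intro sum.cong refl node)
    also have "\<dots> = star_op \<omega> (map (tree_eval star_op \<rho>) ts)"
      by (simp add: star_op_def[of \<omega>] \<omega>)
    finally show ?thesis
      using True by simp
  next
    case False
    let ?I = "hit_inputs J ts" and ?us = "map (\<lambda>t. ?ev (J \<inter> Lin t) t) ts"
    have I: "?I \<in> C (length ts)"
      using Node.prems(2) hit_inputs_nonempty[OF Node.prems(3) False]
      by (auto simp: admissible_def)
    have hit: "Suc i \<in> ?I \<longleftrightarrow> J \<inter> Lin (ts ! i) \<noteq> {}" if "i < length ts" for i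
      using that by (simp add: hit_inputs_def)
    \<comment> \<open>Children at inputs in the hit set meet J, so the nonempty case of the
      induction hypothesis applies to them.\<close>
    have at: "entries_at ?I ?us = entries_at ?I (map (\<lambda>t. mterm (\<lambda>j. \<alpha> (\<rho> j)) \<rho> (J \<inter> Lin t) t) ts)"
      unfolding entries_at_map using hit IH by (auto simp: set_entries_at)
    \<comment> \<open>Here the Rota-Baxter identity enters: a child missed by J is evaluated with
      \<open>star_op\<close>, and \<alpha> carries the result to the value of that child in
      A.\<close>
    have off: "entries_off ?I (map \<alpha> ?us) = entries_off ?I (map (tree_eval opA (\<lambda>j. \<alpha> (\<rho> j))) ts)"
      unfolding entries_off_map map_map
    proof (rule map_cong[OF refl])
      fix t assume "t \<in> set (entries_off ?I ts)"
      then obtain i where "i < length ts" "t = ts ! i" "Suc i \<notin> ?I"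
        by (auto simp: entries_off_def set_nths)
      then have t: "t \<in> set ts" "J \<inter> Lin t = {}"
        using hit by auto
      have "?ev (J \<inter> Lin t) t = tree_eval star_op \<rho> t"
        unfolding IH[OF t(1)] using t(2) by simp
      then show "(\<alpha> \<circ> (\<lambda>t. ?ev (J \<inter> Lin t) t)) t = tree_eval opA (\<lambda>j. \<alpha> (\<rho> j)) t"
        using Node.prems(1) t(1) by (simp only: comp_def \<alpha>_tree_eval decorated_by.simps)
    qed
    have "?ev J (Node \<omega> ts) = split_op l \<alpha> (\<omega>, ?I) ?us"
      using False node[OF I] by simp
    also have "\<dots> = mterm (\<lambda>j. \<alpha> (\<rho> j)) \<rho> J (Node \<omega> ts)"
      using I by (simp only: split_op_apply at off module_term.simps if_True)
    finally show ?thesis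
      using False by simp
  qed
qed

lemma csp_admissible:
  assumes r: "r \<in> R" and J: "J \<in> C (card (rel_Lin r))" and t: "t \<in> Poly_Mapping.keys r"
  shows "admissible C {x \<in> rel_Lin r. label_rank (rel_Lin r) x \<in> J} t"
proof -
  have "labeled_tree t" "Lin t = rel_Lin r"
    using rel[OF r] t by (auto simp: tree_relation_def)
  then show ?thesis
    using admissible_rank[OF config sym, of t J] J by simp
qed

lemma tree_relation_csp:
  assumes r: "r \<in> R" and J: "J \<in> C (card (rel_Lin r))"
  shows "tree_relation (csp_basis C V)
    (lin_extend (csp_tree C {x \<in> rel_Lin r. label_rank (rel_Lin r) x \<in> J}) r)"
    (is "tree_relation _ ?r")
proof -
  have *: "labeled_tree t' \<and> decorated_by (csp_basis C V) t' \<and> Lin t' = rel_Lin r"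
    if "t' \<in> Poly_Mapping.keys ?r" for t'
  proof -
    obtain t where t: "t \<in> Poly_Mapping.keys r"
      and t': "t' \<in> Poly_Mapping.keys
        (csp_tree C {x \<in> rel_Lin r. label_rank (rel_Lin r) x \<in> J} t :: _ \<Rightarrow>\<^sub>0 'k)"
      using \<open>t' \<in> _\<close> by (rule keys_lin_extend)
    have "labeled_tree t" "decorated_by V t" "Lin t = rel_Lin r"
      using rel[OF r] t by (auto simp: tree_relation_def)
    with keys_csp_tree[OF t' _ csp_admissible[OF r J t]] show ?thesis
      by (auto simp: labeled_tree_def)
  qed
  \<comment> \<open>If everything cancels, \<open>?r\<close> has no trees left and
    \<open>tree_relation\<close> holds vacuously.\<close>
  then have "rel_Lin ?r = rel_Lin r" if "Poly_Mapping.keys ?r \<noteq> {}"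
    unfolding rel_Lin_def[of ?r] using that by auto
  with * show ?thesis
    unfolding tree_relation_def by blast
qed

lemma csp_relation:
  assumes r: "r \<in> R" and J: "J \<in> C (card (rel_Lin r))"
  shows "lin_eval sU (tree_eval (split_op l \<alpha>) \<rho>)
    (lin_extend (csp_tree C {x \<in> rel_Lin r. label_rank (rel_Lin r) x \<in> J}) r) = 0"
proof -
  let ?J = "{x \<in> rel_Lin r. label_rank (rel_Lin r) x \<in> J}"
  have t: "decorated_by V t \<and> distinct (leaves t) \<and> ?J \<subseteq> Lin t" if "t \<in> Poly_Mapping.keys r" for t
    using rel[OF r] that by (auto simp: tree_relation_def labeled_tree_def)
  \<comment> \<open>Ranks exhaust 1, ..., n, so a nonempty set of ranks gives a nonempty set of
    labels. This selects the second case of \<open>lin_eval_csp_tree\<close> and permits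
    \<open>lin_eval_module_term_eq_0\<close>.\<close>
  obtain j where j: "j \<in> J" "j \<in> {1..card (rel_Lin r)}"
    using configuration_subset[OF config J] configuration_nonempty[OF config J] by blast
  then have "j \<in> label_rank (rel_Lin r) ` rel_Lin r"
    using bij_betw_label_rank[OF finite_rel_Lin, of r] by (simp add: bij_betw_def)
  then have ne: "?J \<noteq> {}"
    using j(1) by blast
  have fin: "finite ?J"
    by (rule finite_subset[OF _ finite_rel_Lin]) auto
  have "lin_eval sU (tree_eval (split_op l \<alpha>) \<rho>) (lin_extend (csp_tree C ?J) r) =
      lin_eval sU (\<lambda>t. lin_eval sU (tree_eval (split_op l \<alpha>) \<rho>) (csp_tree C ?J t)) r"
    by (rule U.lin_eval_lin_extend)
  also have "\<dots> = lin_eval sU (mterm (\<lambda>j. \<alpha> (\<rho> j)) \<rho> ?J) r"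
  proof (rule U.lin_eval_cong)
    fix t assume "t \<in> Poly_Mapping.keys r"
    then show "lin_eval sU (tree_eval (split_op l \<alpha>) \<rho>) (csp_tree C ?J t) =
        mterm (\<lambda>j. \<alpha> (\<rho> j)) \<rho> ?J t"
      using lin_eval_csp_tree[of t ?J \<rho>] t csp_admissible[OF r J] ne by auto
  qed
  also have "\<dots> = 0"
    by (rule lin_eval_module_term_eq_0[OF t presented_algebra_relation[OF module r] fin ne])
  finally show ?thesis .
qed

lemma presentation_csp: "presentation (csp_basis C V) (csp_relations C R)"
proof
  show "S_module_basis (csp_basis C V)"
    using basis sym
    by (auto simp: S_module_basis_def csp_basis_def symmetric_config_def image_comp)
  show "tree_relation (csp_basis C V) r" if "r \<in> csp_relations C R" for r
    using that tree_relation_csp by (auto simp: csp_relations_def)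
qed

lemma csp_algebra: "\<exists>\<phi>. presented_algebra (csp_basis C V) (csp_relations C R) sU \<phi> (split_op l \<alpha>)"
proof -
  interpret CSp: presentation "csp_basis C V" "csp_relations C R"
    by (rule presentation_csp)
  have gen: "v \<in> gens (csp_basis C V) \<longleftrightarrow> fst v \<in> gens V \<and> snd v \<in> C (arity V (fst v))"
    "arity (csp_basis C V) v = arity V (fst v)"
    "act (csp_basis C V) \<sigma> v = (act V \<sigma> (fst v), \<sigma> ` snd v)" for v \<sigma>
    by (auto simp: csp_basis_def case_prod_unfold)
  obtain \<phi> where "presented_algebra (csp_basis C V) (csp_relations C R) sU \<phi> (split_op l \<alpha>)"
  proof (rule CSp.presented_algebraI[OF sU])
    show "multilinear_map sU sU (arity (csp_basis C V) v) (split_op l \<alpha> v)"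
      if "v \<in> gens (csp_basis C V)" for v
      using multilinear_split_op[of "fst v" "snd v"] that by (simp add: gen)
    show "split_op l \<alpha> (act (csp_basis C V) \<sigma> v) us =
        split_op l \<alpha> v (map (\<lambda>j. us ! (\<sigma> j - 1)) [1..<Suc (arity (csp_basis C V) v)])"
      if "v \<in> gens (csp_basis C V)" "\<sigma> permutes {1..arity (csp_basis C V) v}"
        "length us = arity (csp_basis C V) v" for v \<sigma> us
      using split_op_equivariant[of "fst v" "snd v" \<sigma> us] that by (simp add: gen del: upt_Suc)
    show "lin_eval sU (tree_eval (split_op l \<alpha>) \<rho>) r = 0" if "r \<in> csp_relations C R" for r \<rho>
      using that csp_relation by (auto simp: csp_relations_def)
  qed
  then show ?thesis by blast
qed

lemma star_algebra: "\<exists>\<phi>. presented_algebra V R sU \<phi> star_op"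
proof -
  obtain \<phi> where "presented_algebra V R sU \<phi> star_op"
    by (rule presented_algebraI[OF sU multilinear_star_op star_op_equivariant star_op_relation])
  then show ?thesis by blast
qed

text \<open>Every operad element is the class of a combination of trees, on which any morphism with
  the prescribed generators is tree evaluation. What remains is linearity of \<alpha> and its
  compatibility with a single tree.\<close>

lemma star_algebra_hom:
  assumes \<phi>: "presented_algebra V R sU \<phi> star_op" and \<phi>A: "presented_algebra V R sA \<phi>A opA"
  shows "algebra_hom (presented_operad V R) sU \<phi> sA \<phi>A \<alpha>"
  unfolding algebra_hom_def
proof (intro conjI allI ballI)
  fix n P and us :: "'u list" assume "P \<in> ospace (presented_operad V R) n" "us \<in> tuples n"
  then obtain p where p: "p \<in> ospace (tree_operad V) n" "P = presented_class V R n p"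
    and us: "length us = n"
    by (auto simp: tuples_def elim: presented_class_cases)
  have "\<alpha> (\<phi> n P us) = lin_eval sA (\<lambda>t. \<alpha> (tree_eval star_op (\<lambda>j. us ! (j - 1)) t)) p"
    unfolding p(2) presented_algebra_eval[OF \<phi> p(1) us] by (rule linear_lin_eval[OF \<alpha>])
  also have "\<dots> = lin_eval sA (tree_eval opA (\<lambda>j. map \<alpha> us ! (j - 1))) p"
  proof (rule A.lin_eval_cong)
    fix t assume "t \<in> Poly_Mapping.keys p"
    then have t: "op_tree V n t"
      using p(1) by (simp add: mem_tree_operad_iff)
    then have "\<alpha> (tree_eval star_op (\<lambda>j. us ! (j - 1)) t) = tree_eval opA (\<lambda>j. \<alpha> (us ! (j - 1))) t"
      by (intro \<alpha>_tree_eval) (simp add: op_tree_def)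
    also have "\<dots> = tree_eval opA (\<lambda>j. map \<alpha> us ! (j - 1)) t"
      using t us by (intro tree_eval_cong) (auto simp: op_tree_def)
    finally show "\<alpha> (tree_eval star_op (\<lambda>j. us ! (j - 1)) t) =
        tree_eval opA (\<lambda>j. map \<alpha> us ! (j - 1)) t" .
  qed
  also have "\<dots> = \<phi>A n P (map \<alpha> us)"
    unfolding p(2) using us by (intro presented_algebra_eval[OF \<phi>A p(1), symmetric]) simp
  finally show "\<alpha> (\<phi> n P us) = \<phi>A n P (map \<alpha> us)" .
qed (rule \<alpha>)

end

theorem theorem5p11:
  fixes V :: "'v basis"
    and R :: "('v tree \<Rightarrow>\<^sub>0 'k::field) set"
    and C :: "nat \<Rightarrow> nat set set"
    and sA :: "'k \<Rightarrow> 'a::ab_group_add \<Rightarrow> 'a"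
    and \<phi>A :: "nat \<Rightarrow> ('v tree \<Rightarrow>\<^sub>0 'k) set set \<Rightarrow> 'a list \<Rightarrow> 'a"
    and opA :: "'v \<Rightarrow> 'a list \<Rightarrow> 'a"
    and sU :: "'k \<Rightarrow> 'u::ab_group_add \<Rightarrow> 'u"
    and l :: "'v \<Rightarrow> nat set \<Rightarrow> 'a list \<Rightarrow> 'u list \<Rightarrow> 'u"
    and \<alpha> :: "'u \<Rightarrow> 'a"
  assumes "S_module_basis V"
    and "locally_homogeneous V R"
    and "configuration C"
    and "symmetric_config C"
    and "presented_algebra V R sA \<phi>A opA"
    and "C_module V R C sA opA sU l"
    and "relative_Rota_Baxter V C sA opA sU l \<alpha>"
  shows "(\<exists>\<phi>. presented_algebra (csp_basis C V) (csp_relations C R) sU \<phi> (split_op l \<alpha>)) \<and>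
    (C = arity_config \<or> C = power_config \<longrightarrow>
      (\<exists>\<phi>. presented_algebra V R sU \<phi>
             (\<lambda>\<omega> us. \<Sum>I \<in> C (arity V \<omega>). split_op l \<alpha> (\<omega>, I) us) \<and>
           algebra_hom (presented_operad V R) sU \<phi> sA \<phi>A \<alpha>))"
proof -
  interpret presentation V R
    using assms(1,2) by unfold_locales (auto intro: locally_homogeneous_tree_relation)
  obtain \<psi> where \<psi>: "presented_algebra V R (module_prod.scale sA sU) \<psi> (module_op C (arity V) opA l)"
    using assms(6) unfolding C_module_def module_op_def[abs_def] by blast
  have space: "vector_space sA" "vector_space sU"
    using assms(5,6) by (auto simp: presented_algebra_def operad_algebra_def C_module_def)
  have l: "multilinear_map sA sU (arity V \<omega> - card I) (\<lambda>xs. l \<omega> I xs us)"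
    if "\<omega> \<in> gens V" "I \<in> C (arity V \<omega>)" "length us = card I" for \<omega> I us
    using assms(6) that by (simp add: C_module_def tuples_def)
  have l': "multilinear_map sU sU (card I) (l \<omega> I xs)"
    if "\<omega> \<in> gens V" "I \<in> C (arity V \<omega>)" "length xs = arity V \<omega> - card I" for \<omega> I xs
    using assms(6) that by (simp add: C_module_def tuples_def)
  have \<alpha>: "Vector_Spaces.linear sU sA \<alpha>"
    using assms(7) by (simp add: relative_Rota_Baxter_def)
  have rota_baxter: "opA \<omega> (map \<alpha> us) = (\<Sum>I\<in>C (arity V \<omega>). \<alpha> (split_op l \<alpha> (\<omega>, I) us))"
    if "\<omega> \<in> gens V" "length us = arity V \<omega>" for \<omega> us
    using assms(7) that by (simp add: relative_Rota_Baxter_def tuples_def split_op_apply)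
  interpret rota_baxter_module V R C sA opA sU l \<psi> \<alpha>
    by (intro rota_baxter_module.intro split_module.intro presentation_axioms
        split_module_axioms.intro rota_baxter_module_axioms.intro assms(3,4) space l l' \<psi> \<alpha> rota_baxter)
  obtain \<phi> where \<phi>: "presented_algebra V R sU \<phi> star_op"
    using star_algebra by blast
  moreover have "star_op = (\<lambda>\<omega> us. \<Sum>I\<in>C (arity V \<omega>). split_op l \<alpha> (\<omega>, I) us)"
    by (intro ext) (simp add: star_op_def)
  ultimately show ?thesis
    using csp_algebra star_algebra_hom[OF \<phi> assms(5)] by auto
qed

end
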